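(* Let $\zeta\ge0$ and $\kappa\ge0$ satisfy $8\zeta+\kappa<1$ and $\zeta+2\kappa<1$. Let $\{Z_n\}_{n\in\mathbb{N}}$ be a sequence of diagonal matrices $Z_n=\mathrm{diag}(z_1^{(n)},\ldots,z_n^{(n)})$ with $z_j^{(n)}\geq1$ having bounded squeezing of degree $\zeta$, such that the average energy $\lambda(n)=\frac{1}{2n}\sum_{j=1}^n(z_j^{(n)}+1/z_j^{(n)})$ is uniformly bounded in $n$, and let $\{k_n\}_{n\in\mathbb{N}}$ be a sequence of subsystem sizes bounded of degree $\kappa$; write $k=k_n$. Let $\lambda_1^{(n)},\ldots,\lambda_k^{(n)}$ be the symplectic eigenvalues of $M_{n,k}(U)$, with $U$ drawn from the Haar measure on $U(n)$. Then there are constants $C,c>0$ such that for every $\epsilon>Cn^{\zeta+2\kappa-1}$, $$\Pr\Big\{\sum_{j=1}^k\big((\lambda_j^{(n)})^2-\lambda(n)^2\big)^2>\epsilon\Big\}\leq\exp\big(-c\,\epsilon^2n^{1-8\zeta-\kappa}\big).$$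
   Context: $J_k=\begin{pmatrix}0_k&-I_k\\ I_k&0_k\end{pmatrix}$. For $U\in U(n)$, $\eta(U)=\begin{pmatrix}\mathrm{Re}(U)&\mathrm{Im}(U)\\ -\mathrm{Im}(U)&\mathrm{Re}(U)\end{pmatrix}$, $M_n(U)=\eta(U)(Z_n\oplus Z_n^{-1})\eta(U)^T$ (the covariance matrix of the pure Gaussian state obtained by applying the passive Gaussian unitary associated with $\eta(U)$ to a product of single-mode squeezed states), and $M_{n,k}(U)$ is the $2k\times2k$ submatrix of $M_n(U)$ with rows and columns indexed by $\{1,\ldots,k\}\cup\{n+1,\ldots,n+k\}$ (covariance matrix of the reduced state on the first $k$ modes). Symplectic eigenvalues of $M_{n,k}(U)$: numbers $\lambda_j\ge1$ with spectrum of $J_kM_{n,k}(U)$ equal to $\bigcup_j\{\pm i\lambda_j\}$. Bounded squeezing of degree $\zeta$: there is $C>0$ with $\|Z_n\|_\infty\le Cn^\zeta$ for all large $n$. Subsystem sizes $k_n\in\{1,\ldots,n\}$ bounded of degree $\kappa$: there is $K>0$ with $k_n\le Kn^\kappa$ for all large $n$. *)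

theory Defs
  imports "HOL-Probability.Probability" "HOL-Library.Multiset"
    "HOL-Computational_Algebra.Polynomial" "HOL-Combinatorics.Permutations"
begin

(* Matrices of varying size are functions nat => nat => 'a; only entries with
   indices below the stated dimension are meaningful. Indices are 0-based:
   modes 0..n-1; in 2n x 2n phase-space matrices, rows/cols 0..n-1 are the
   "first block" and n..2n-1 the "second block". *)

definition matmul :: "nat \<Rightarrow> (nat \<Rightarrow> nat \<Rightarrow> 'a::comm_semiring_1) \<Rightarrow> (nat \<Rightarrow> nat \<Rightarrow> 'a) \<Rightarrow> nat \<Rightarrow> nat \<Rightarrow> 'a" where
  "matmul n A B = (\<lambda>i j. if i < n \<and> j < n then (\<Sum>l<n. A i l * B l j) else 0)"

definition transp_mat :: "(nat \<Rightarrow> nat \<Rightarrow> 'a) \<Rightarrow> nat \<Rightarrow> nat \<Rightarrow> 'a" where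
  "transp_mat A = (\<lambda>i j. A j i)"

definition id_mat :: "nat \<Rightarrow> nat \<Rightarrow> nat \<Rightarrow> 'a::zero_neq_one" where
  "id_mat n = (\<lambda>i j. if i = j \<and> i < n then 1 else 0)"

definition adj_mat :: "nat \<Rightarrow> (nat \<Rightarrow> nat \<Rightarrow> complex) \<Rightarrow> nat \<Rightarrow> nat \<Rightarrow> complex" where
  "adj_mat n A = (\<lambda>i j. if i < n \<and> j < n then cnj (A j i) else 0)"

definition unitary_set :: "nat \<Rightarrow> (nat \<Rightarrow> nat \<Rightarrow> complex) set" where
  "unitary_set n = {U. (\<forall>i j. (n \<le> i \<or> n \<le> j) \<longrightarrow> U i j = 0) \<and>
                        matmul n (adj_mat n U) U = id_mat n}"

(* Haar probability measure on U(n): a left-invariant Borel probability measure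
   concentrated on U(n) (unique by uniqueness of Haar measure on compact groups). *)
definition haar_measure :: "nat \<Rightarrow> (nat \<Rightarrow> nat \<Rightarrow> complex) measure \<Rightarrow> bool" where
  "haar_measure n \<mu> \<longleftrightarrow> prob_space \<mu> \<and> sets \<mu> = sets borel \<and>
     emeasure \<mu> (unitary_set n) = 1 \<and>
     (\<forall>V\<in>unitary_set n. \<forall>A\<in>sets borel.
        emeasure \<mu> {U. matmul n V U \<in> A} = emeasure \<mu> A)"

definition eta :: "nat \<Rightarrow> (nat \<Rightarrow> nat \<Rightarrow> complex) \<Rightarrow> nat \<Rightarrow> nat \<Rightarrow> real" where
  "eta n U = (\<lambda>i j.
     if i < n \<and> j < n then Re (U i j)
     else if i < n \<and> n \<le> j \<and> j < 2*n then Im (U i (j - n))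
     else if n \<le> i \<and> i < 2*n \<and> j < n then - Im (U (i - n) j)
     else if n \<le> i \<and> i < 2*n \<and> n \<le> j \<and> j < 2*n then Re (U (i - n) (j - n))
     else 0)"

definition sqz_mat :: "nat \<Rightarrow> (nat \<Rightarrow> real) \<Rightarrow> nat \<Rightarrow> nat \<Rightarrow> real" where
  "sqz_mat n zs = (\<lambda>i j.
     if i = j \<and> i < n then zs i
     else if i = j \<and> n \<le> i \<and> i < 2*n then 1 / zs (i - n)
     else 0)"

definition cov_mat :: "nat \<Rightarrow> (nat \<Rightarrow> real) \<Rightarrow> (nat \<Rightarrow> nat \<Rightarrow> complex) \<Rightarrow> nat \<Rightarrow> nat \<Rightarrow> real" where
  "cov_mat n zs U = matmul (2*n) (matmul (2*n) (eta n U) (sqz_mat n zs)) (transp_mat (eta n U))"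

definition sub_idx :: "nat \<Rightarrow> nat \<Rightarrow> nat \<Rightarrow> nat" where
  "sub_idx n k i = (if i < k then i else n + (i - k))"

definition red_cov_mat :: "nat \<Rightarrow> nat \<Rightarrow> (nat \<Rightarrow> real) \<Rightarrow> (nat \<Rightarrow> nat \<Rightarrow> complex) \<Rightarrow> nat \<Rightarrow> nat \<Rightarrow> real" where
  "red_cov_mat n k zs U = (\<lambda>i j. if i < 2*k \<and> j < 2*k
       then cov_mat n zs U (sub_idx n k i) (sub_idx n k j) else 0)"

definition J_mat :: "nat \<Rightarrow> nat \<Rightarrow> nat \<Rightarrow> real" where
  "J_mat k = (\<lambda>i j. if i < k \<and> j = i + k then -1
                    else if k \<le> i \<and> i < 2*k \<and> j = i - k then 1 else 0)"

definition det_mat :: "nat \<Rightarrow> (nat \<Rightarrow> nat \<Rightarrow> 'a::comm_ring_1) \<Rightarrow> 'a" where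
  "det_mat n A = (\<Sum>p\<in>{p. p permutes {..<n}}. of_int (sign p) * (\<Prod>i<n. A i (p i)))"

definition char_poly_mat :: "nat \<Rightarrow> (nat \<Rightarrow> nat \<Rightarrow> 'a::comm_ring_1) \<Rightarrow> 'a poly" where
  "char_poly_mat n A = det_mat n (\<lambda>i j. (if i = j then [:0, 1:] else 0) - [:A i j:])"

(* L is the multiset of symplectic eigenvalues of the 2k x 2k matrix M:
   numbers >= 1 such that the spectrum (with algebraic multiplicity) of J_k M
   is the union of {+- i lambda_j}. *)
definition is_symp_eigs :: "nat \<Rightarrow> (nat \<Rightarrow> nat \<Rightarrow> real) \<Rightarrow> real multiset \<Rightarrow> bool" where
  "is_symp_eigs k M L \<longleftrightarrow> size L = k \<and> (\<forall>l\<in>#L. 1 \<le> l) \<and>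
     char_poly_mat (2*k) (\<lambda>i j. complex_of_real (matmul (2*k) (J_mat k) M i j)) =
       (\<Prod>l\<in>#L. [:- (\<i> * complex_of_real l), 1:] * [:\<i> * complex_of_real l, 1:])"

definition symp_eigs :: "nat \<Rightarrow> (nat \<Rightarrow> nat \<Rightarrow> real) \<Rightarrow> real multiset" where
  "symp_eigs k M = (THE L. is_symp_eigs k M L)"

definition avg_energy :: "nat \<Rightarrow> (nat \<Rightarrow> real) \<Rightarrow> real" where
  "avg_energy n zs = (\<Sum>j<n. zs j + 1 / zs j) / (2 * real n)"

end

theory Submission
  imports Defs "Jordan_Normal_Form.Schur_Decomposition"
begin

text \<open>
  Write \<open>M = \<lambda> + D\<close> for the reduced covariance matrix. Since \<open>J M\<close> has spectrum \<open>\<plusminus>i \<lambda>\<^sub>j\<close>, the sum of the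
  \<open>(\<lambda>\<^sub>j\<^sup>2 - \<lambda>\<^sup>2)\<^sup>2\<close> is half the trace of \<open>((J M)\<^sup>2 + \<lambda>\<^sup>2)\<^sup>2\<close>. It is thus of order \<open>\<parallel>D\<parallel>\<^sup>2\<close> for small \<open>D\<close> and at
  most of order \<open>\<parallel>Z\<parallel>\<^sup>2 \<parallel>D\<parallel>\<^sup>2\<close> always, so it suffices to bound the upper tail of \<open>g = \<parallel>D\<parallel>\<^sup>2 / 2\<close>.

  Left invariance of the Haar measure gives the integration by parts formula \<open>E (X f) = 0\<close> for every
  invariant vector field \<open>X\<close>. The entries of \<open>D\<close> are combinations of eigenfunctions of the Casimir operator
  with eigenvalues \<open>2n\<close> and \<open>2n + 2\<close>. Applied to \<open>X g exp (s g)\<close> and summed over a basis, integration by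
  parts therefore yields
  \<open>4n E (g exp (s g)) \<le> E ((2 \<Gamma> + s |\<nabla>g|\<^sup>2) exp (s g))\<close>, where \<open>\<Gamma>\<close> is the sum of the squared derivatives of
  the entries. As \<open>|\<nabla>g|\<^sup>2\<close> is at most of order \<open>\<parallel>Z\<parallel>\<^sup>2 g\<close> and \<open>\<Gamma>\<close> at most of order \<open>k \<parallel>Z\<parallel> (k \<lambda> + g)\<close>, this is a
  differential inequality for the moment generating function of \<open>g\<close>, valid up to \<open>s\<close> of order
  \<open>n / \<parallel>Z\<parallel>\<^sup>2\<close>, and Markov's inequality gives the tail.
\<close>

section \<open>The unitary group and rank-one rotations\<close>

text \<open>The tail that comes out is linear in \<epsilon>: if R bounds the squeezing, it has the
  form exp (- const n \<epsilon> / R^4). The quadratic exponent of the theorem is a weakening of it.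
  The sum over the symplectic eigenvalues never exceeds 64 k R^4, so only \<epsilon> up to order
  n^(\<kappa> + 4 \<zeta>) matters, and in that range n \<epsilon> / R^4 dominates \<epsilon>^2 n^(1
  - 8 \<zeta> - \<kappa>) up to a constant. The factor R^4 is a product of two losses R^2: one from
  the admissible range of s, one from large deviations of the covariance matrix, where the spectrum
  is controlled with the help of the operator norm. The threshold for \<epsilon> is the order of the
  bound on the mean of g, namely k^2 R / n, and \<zeta> + 2 \<kappa> < 1 makes it tend to zero. The
  estimates start at some large n; for each of the finitely many earlier n the constant is enlarged
  until the event is empty.\<close>

lemma unitary_setD_col:
  assumes "U \<in> unitary_set n" "l < n" "m < n"
  shows "(\<Sum>i<n. cnj (U i l) * U i m) = (if l = m then 1 else 0)"
proof -
  from assms(1) have "matmul n (Defs.adj_mat n U) U l m = id_mat n l m"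
    by (simp add: unitary_set_def)
  with assms(2,3) show ?thesis
    by (simp add: matmul_def Defs.adj_mat_def id_mat_def)
qed

lemma unitary_setI:
  assumes "\<And>i j. n \<le> i \<or> n \<le> j \<Longrightarrow> U i j = 0"
    and "\<And>l m. l < n \<Longrightarrow> m < n \<Longrightarrow> (\<Sum>i<n. cnj (U i l) * U i m) = (if l = m then 1 else 0)"
  shows "U \<in> unitary_set n"
  using assms by (auto simp: unitary_set_def matmul_def Defs.adj_mat_def id_mat_def fun_eq_iff)

text \<open>The definition of \<open>unitary_set\<close> makes the adjoint a left inverse. For
  square matrices a left inverse is also a right inverse, and the relation is moved to
  \<open>mat\<close> to use this fact.\<close>

lemma unitary_setD_row:
  assumes U: "U \<in> unitary_set n" and "i < n" "j < n"
  shows "(\<Sum>l<n. U i l * cnj (U j l)) = (if i = j then 1 else 0)"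
proof -
  define A where "A = mat n n (\<lambda>(l, i). cnj (U i l))"
  define B where "B = mat n n (\<lambda>(i, l). U i l)"
  have "A * B = 1\<^sub>m n"
    by (rule eq_matI)
      (auto simp: A_def B_def scalar_prod_def lessThan_atLeast0[symmetric] unitary_setD_col[OF U])
  then have "B * A = 1\<^sub>m n"
    by (rule mat_mult_left_right_inverse[rotated 2]) (auto simp: A_def B_def)
  then have "(B * A) $$ (i, j) = 1\<^sub>m n $$ (i, j)" by simp
  with assms(2,3) show ?thesis
    by (simp add: A_def B_def scalar_prod_def lessThan_atLeast0[symmetric])
qed

text \<open>Pythagoras. The number \<open>k\<close> of vectors is independent of the dimension
  \<open>n\<close>, so that the lemma serves both for a full unitary matrix and for its first
  \<open>k\<close> rows.\<close>

lemma sum_norm_sq_orthonormal: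
  fixes e :: "nat \<Rightarrow> nat \<Rightarrow> complex" and d :: "nat \<Rightarrow> complex"
  assumes orth: "\<And>l m. l < k \<Longrightarrow> m < k \<Longrightarrow> (\<Sum>b<n. cnj (e l b) * e m b) = (if l = m then 1 else 0)"
  shows "(\<Sum>b<n. (cmod (\<Sum>l<k. d l * e l b))\<^sup>2) = (\<Sum>l<k. (cmod (d l))\<^sup>2)"
proof -
  have "complex_of_real (\<Sum>b<n. (cmod (\<Sum>l<k. d l * e l b))\<^sup>2)
      = (\<Sum>b<n. \<Sum>m<k. \<Sum>l<k. (d m * e m b) * (cnj (d l) * cnj (e l b)))"
    unfolding of_real_sum complex_norm_square by (simp add: sum_product)
  also have "\<dots> = (\<Sum>m<k. \<Sum>l<k. \<Sum>b<n. (d m * e m b) * (cnj (d l) * cnj (e l b)))"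
    by (subst sum.swap, rule sum.cong[OF refl], rule sum.swap)
  also have "\<dots> = (\<Sum>m<k. \<Sum>l<k. d m * cnj (d l) * (\<Sum>b<n. cnj (e l b) * e m b))"
    by (simp add: sum_distrib_left mult_ac)
  also have "\<dots> = (\<Sum>m<k. \<Sum>l<k. if l = m then d m * cnj (d l) else 0)"
    by (intro sum.cong refl) (simp add: orth)
  also have "\<dots> = (\<Sum>m<k. d m * cnj (d m))"
    by (simp add: sum.delta)
  also have "\<dots> = complex_of_real (\<Sum>l<k. (cmod (d l))\<^sup>2)"
    unfolding of_real_sum complex_norm_square ..
  finally show ?thesis by (simp only: of_real_eq_iff)
qed

lemma norm_unitary_entry_le:
  assumes U: "U \<in> unitary_set n"
  shows "cmod (U i l) \<le> 1"
proof (cases "i < n \<and> l < n")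
  case True
  have "complex_of_real (\<Sum>i<n. (cmod (U i l))\<^sup>2) = (\<Sum>i<n. cnj (U i l) * U i l)"
    unfolding of_real_sum complex_norm_square by (simp add: mult.commute)
  also have "\<dots> = of_real 1" using True unitary_setD_col[OF U, of l l] by simp
  finally have "(\<Sum>i<n. (cmod (U i l))\<^sup>2) = 1" by (simp only: of_real_eq_iff)
  moreover have "(cmod (U i l))\<^sup>2 \<le> (\<Sum>i<n. (cmod (U i l))\<^sup>2)"
    using True by (intro member_le_sum) auto
  ultimately show ?thesis by (simp add: power2_le_iff_abs_le abs_square_le_1)
next
  case False
  with U show ?thesis by (auto simp: unitary_set_def)
qed

text \<open>\<open>rot_mat n v t\<close> is \<open>exp (i t v v*)\<close>; the convention \<open>x / 0 = 0\<close> makes it the identity for \<open>v = 0\<close>.\<close>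

definition rot_phase :: "nat \<Rightarrow> (nat \<Rightarrow> complex) \<Rightarrow> real \<Rightarrow> complex" where
  "rot_phase n v t = (let w = (\<Sum>b<n. (cmod (v b))\<^sup>2) in (cis (t * w) - 1) / of_real w)"

definition rot_mat :: "nat \<Rightarrow> (nat \<Rightarrow> complex) \<Rightarrow> real \<Rightarrow> nat \<Rightarrow> nat \<Rightarrow> complex" where
  "rot_mat n v t = (\<lambda>i j. if i < n \<and> j < n
     then (if i = j then 1 else 0) + rot_phase n v t * v i * cnj (v j) else 0)"

abbreviation rot :: "nat \<Rightarrow> (nat \<Rightarrow> complex) \<Rightarrow> real \<Rightarrow> (nat \<Rightarrow> nat \<Rightarrow> complex) \<Rightarrow> nat \<Rightarrow> nat \<Rightarrow> complex" where
  "rot n v t U \<equiv> matmul n (rot_mat n v t) U"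

lemma rot_eq:
  "rot n v t U = (\<lambda>i l. if i < n \<and> l < n
     then U i l + rot_phase n v t * v i * (\<Sum>b<n. cnj (v b) * U b l) else 0)"
proof (intro ext, goal_cases)
  case (1 i l)
  have "(\<Sum>m<n. ((if i = m then 1 else 0) + rot_phase n v t * v i * cnj (v m)) * U m l)
      = (\<Sum>m<n. if m = i then U m l else 0) + (\<Sum>m<n. rot_phase n v t * v i * (cnj (v m) * U m l))"
    by (subst sum.distrib[symmetric], rule sum.cong) (auto simp: algebra_simps)
  then show ?case
    by (auto simp: matmul_def rot_mat_def sum_distrib_left mult.assoc)
qed

text \<open>With w the squared norm of \<open>v\<close> and f the phase, 1 + f w =
  \<open>cis (t * w)\<close>. The claim is that this number has modulus 1, after division by w; it
  is exactly what unitarity of 1 + f v v* requires.\<close>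

lemma rot_phase_unimodular:
  "rot_phase n v t + cnj (rot_phase n v t)
     + cnj (rot_phase n v t) * rot_phase n v t * of_real (\<Sum>b<n. (cmod (v b))\<^sup>2) = 0"
proof -
  define w where "w = (\<Sum>b<n. (cmod (v b))\<^sup>2)"
  show ?thesis
  proof (cases "w = 0")
    case False
    have "cnj (cis (t * w)) * cis (t * w) = 1"
      by (simp add: cis_cnj cis_mult)
    with False show ?thesis
      unfolding rot_phase_def Let_def w_def[symmetric]
      by (simp add: field_simps)
  qed (simp add: rot_phase_def Let_def flip: w_def)
qed

text \<open>Multiplicativity of 1 + f w = \<open>cis (t * w)\<close> in \<open>t\<close>, divided by
  w.\<close>

lemma rot_phase_add:
  "rot_phase n v (s + t) = rot_phase n v s + rot_phase n v t
     + rot_phase n v s * rot_phase n v t * of_real (\<Sum>b<n. (cmod (v b))\<^sup>2)"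
proof -
  define w where "w = (\<Sum>b<n. (cmod (v b))\<^sup>2)"
  show ?thesis
  proof (cases "w = 0")
    case False
    have "cis ((s + t) * w) = cis (s * w) * cis (t * w)"
      by (simp add: cis_mult algebra_simps)
    with False show ?thesis
      unfolding rot_phase_def Let_def w_def[symmetric]
      by (simp add: field_simps)
  qed (simp add: rot_phase_def Let_def flip: w_def)
qed

lemma rot_phase_0 [simp]: "rot_phase n v 0 = 0"
  by (simp add: rot_phase_def)

lemma sum_cnj_mult_self: "(\<Sum>b<n. cnj (v b) * v b) = complex_of_real (\<Sum>b<n. (cmod (v b))\<^sup>2)"
  unfolding of_real_sum complex_norm_square by (simp add: mult.commute)

lemma rot_mat_unitary: "rot_mat n v t \<in> unitary_set n"
proof (rule unitary_setI)
  fix l m assume lm: "l < n" "m < n"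
  define f where "f = rot_phase n v t"
  have "(\<Sum>i<n. cnj (rot_mat n v t i l) * rot_mat n v t i m)
      = (\<Sum>i<n. (if i = l then (if l = m then 1 else 0) + f * v l * cnj (v m) else 0)
          + (if i = m then cnj f * cnj (v m) * v l else 0)
          + cnj f * v l * f * cnj (v m) * (cnj (v i) * v i))"
    using lm by (intro sum.cong refl) (auto simp: rot_mat_def f_def algebra_simps)
  also have "\<dots> = (if l = m then 1 else 0) + f * v l * cnj (v m) + cnj f * cnj (v m) * v l
          + cnj f * v l * f * cnj (v m) * (\<Sum>i<n. cnj (v i) * v i)"
    using lm by (simp add: sum.distrib sum_distrib_left)
  also have "\<dots> = (if l = m then 1 else 0) + v l * cnj (v m) *
       (f + cnj f + cnj f * f * of_real (\<Sum>b<n. (cmod (v b))\<^sup>2))"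
    unfolding sum_cnj_mult_self by (simp add: algebra_simps)
  also have "\<dots> = (if l = m then 1 else 0)"
    unfolding f_def rot_phase_unimodular by simp
  finally show "(\<Sum>i<n. cnj (rot_mat n v t i l) * rot_mat n v t i m) = (if l = m then 1 else 0)" .
qed (auto simp: rot_mat_def)

lemma rot_0: "U \<in> unitary_set n \<Longrightarrow> rot n v 0 U = U"
  by (auto simp: rot_eq unitary_set_def fun_eq_iff)

text \<open>The group law carries a derivative known at time 0, for every unitary starting point, to
  all times along the curve.\<close>

lemma rot_add: "rot n v (s + t) U = rot n v s (rot n v t U)"
proof (intro ext)
  fix i l
  show "rot n v (s + t) U i l = rot n v s (rot n v t U) i l"
  proof (cases "i < n \<and> l < n")
    case True
    define x where "x = (\<Sum>b<n. cnj (v b) * U b l)"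
    have "(\<Sum>b<n. cnj (v b) * rot n v t U b l)
        = (\<Sum>b<n. cnj (v b) * U b l + rot_phase n v t * x * (cnj (v b) * v b))"
      using True by (intro sum.cong) (auto simp: rot_eq x_def algebra_simps)
    also have "\<dots> = x + rot_phase n v t * x * of_real (\<Sum>b<n. (cmod (v b))\<^sup>2)"
      by (simp add: sum.distrib x_def sum_cnj_mult_self flip: sum_distrib_left)
    finally have *: "(\<Sum>b<n. cnj (v b) * rot n v t U b l)
       = x + rot_phase n v t * x * of_real (\<Sum>b<n. (cmod (v b))\<^sup>2)" .
    have "rot n v s (rot n v t U) i l = rot n v t U i l + rot_phase n v s * v i *
        (x + rot_phase n v t * x * of_real (\<Sum>b<n. (cmod (v b))\<^sup>2))"
      using True by (simp only: rot_eq[of n v s "rot n v t U"] *) simp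
    also have "\<dots> = U i l + rot_phase n v t * v i * x + rot_phase n v s * v i *
        (x + rot_phase n v t * x * of_real (\<Sum>b<n. (cmod (v b))\<^sup>2))"
      using True by (simp add: rot_eq x_def)
    also have "\<dots> = rot n v (s + t) U i l"
      using True by (simp add: rot_eq rot_phase_add algebra_simps flip: x_def)
    finally show ?thesis by simp
  qed (auto simp: rot_eq)
qed

lemma matmul_unitary:
  assumes V: "V \<in> unitary_set n" and U: "U \<in> unitary_set n"
  shows "matmul n V U \<in> unitary_set n"
proof (rule unitary_setI)
  fix l m assume lm: "l < n" "m < n"
  have "(\<Sum>i<n. cnj (matmul n V U i l) * matmul n V U i m)
      = (\<Sum>i<n. \<Sum>a<n. \<Sum>b<n. (cnj (V i a) * cnj (U a l)) * (V i b * U b m))"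
    using lm by (simp add: matmul_def sum_product)
  also have "\<dots> = (\<Sum>a<n. \<Sum>b<n. \<Sum>i<n. (cnj (V i a) * cnj (U a l)) * (V i b * U b m))"
    by (subst sum.swap, rule sum.cong[OF refl], rule sum.swap)
  also have "\<dots> = (\<Sum>a<n. \<Sum>b<n. cnj (U a l) * U b m * (\<Sum>i<n. cnj (V i a) * V i b))"
    by (simp add: sum_distrib_left mult_ac)
  also have "\<dots> = (\<Sum>a<n. \<Sum>b<n. if b = a then cnj (U a l) * U b m else 0)"
    by (intro sum.cong refl) (simp add: unitary_setD_col[OF V])
  also have "\<dots> = (\<Sum>a<n. cnj (U a l) * U a m)" by simp
  also have "\<dots> = (if l = m then 1 else 0)" using lm by (rule unitary_setD_col[OF U])
  finally show "(\<Sum>i<n. cnj (matmul n V U i l) * matmul n V U i m) = (if l = m then 1 else 0)" .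
qed (auto simp: matmul_def)

lemma rot_unitary: "U \<in> unitary_set n \<Longrightarrow> rot n v t U \<in> unitary_set n"
  by (intro matmul_unitary rot_mat_unitary)

text \<open>For a zero vector the phase is constantly 0 and so is its derivative. The next lemma
  still gets one uniform formula, because \<open>v i\<close> vanishes in that case.\<close>

lemma rot_phase_has_derivative:
  "(rot_phase n v has_vector_derivative (if (\<Sum>b<n. (cmod (v b))\<^sup>2) = 0 then 0 else \<i>)) (at 0)"
proof -
  define w where "w = (\<Sum>b<n. (cmod (v b))\<^sup>2)"
  have "((\<lambda>z. (exp (\<i> * (z * of_real w)) - 1) / of_real w) has_field_derivative
      (\<i> * of_real w) / of_real w) (at (of_real 0))"
    by (cases "w = 0") (auto intro!: derivative_eq_intros simp: field_simps)
  from has_vector_derivative_real_field[OF this]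
  have "((\<lambda>t. (cis (t * w) - 1) / of_real w) has_vector_derivative (\<i> * of_real w) / of_real w) (at 0)"
    by (simp add: cis_conv_exp)
  moreover have "rot_phase n v = (\<lambda>t. (cis (t * w) - 1) / of_real w)"
    by (simp add: rot_phase_def w_def Let_def fun_eq_iff)
  ultimately show ?thesis by (auto simp flip: w_def)
qed

lemma rot_entry_has_derivative:
  assumes "i < n" "l < n"
  shows "((\<lambda>t. rot n v t U i l) has_vector_derivative (\<i> * (v i * (\<Sum>b<n. cnj (v b) * U b l)))) (at 0)"
proof -
  let ?w = "\<Sum>b<n. (cmod (v b))\<^sup>2"
  have "((\<lambda>t. U i l + rot_phase n v t * (v i * (\<Sum>b<n. cnj (v b) * U b l))) has_vector_derivative
      0 + (if ?w = 0 then 0 else \<i>) * (v i * (\<Sum>b<n. cnj (v b) * U b l))) (at 0)"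
    by (intro has_vector_derivative_add has_vector_derivative_const
        has_vector_derivative_mult_left rot_phase_has_derivative)
  moreover have "v i = 0" if "?w = 0"
    using that assms(1) by (subst (asm) sum_nonneg_eq_0_iff) auto
  ultimately show ?thesis
    using assms by (auto simp: rot_eq mult.assoc split: if_splits)
qed

section \<open>Integration by parts for the Haar measure\<close>

text \<open>The bound is asked for on U(n) only, since already the entries are unbounded on the
  space of all matrices. As U(n) has full measure, this is enough for integrability.\<close>

definition tame :: "nat \<Rightarrow> ((nat \<Rightarrow> nat \<Rightarrow> complex) \<Rightarrow> complex) \<Rightarrow> bool" where
  "tame n f \<longleftrightarrow> f \<in> borel_measurable borel \<and> (\<exists>K. \<forall>U\<in>unitary_set n. cmod (f U) \<le> K)"

lemma tame_measurable: "tame n f \<Longrightarrow> f \<in> borel_measurable borel"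
  by (simp add: tame_def)

lemma tame_bounded:
  assumes "tame n f"
  obtains K where "K \<ge> 0" "\<And>U. U \<in> unitary_set n \<Longrightarrow> cmod (f U) \<le> K"
proof -
  obtain K where K: "\<And>U. U \<in> unitary_set n \<Longrightarrow> cmod (f U) \<le> K"
    using assms by (auto simp: tame_def)
  show ?thesis by (rule that[of "max 0 K"]) (use K in \<open>fastforce simp: le_max_iff_disj\<close>)+
qed

lemma tame_const [intro!]: "tame n (\<lambda>_. c)"
  by (auto simp: tame_def)

lemma tame_add [intro!]:
  assumes "tame n f" "tame n h" shows "tame n (\<lambda>U. f U + h U)"
proof -
  obtain K L where "\<And>U. U \<in> unitary_set n \<Longrightarrow> cmod (f U) \<le> K" "\<And>U. U \<in> unitary_set n \<Longrightarrow> cmod (h U) \<le> L"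
    using assms by (auto simp: tame_def)
  then have "\<And>U. U \<in> unitary_set n \<Longrightarrow> cmod (f U + h U) \<le> K + L"
    by (meson norm_triangle_mono)
  then show ?thesis using assms by (auto simp: tame_def)
qed

lemma tame_mult [intro!]:
  assumes "tame n f" "tame n h" shows "tame n (\<lambda>U. f U * h U)"
proof -
  obtain K where K: "K \<ge> 0" "\<And>U. U \<in> unitary_set n \<Longrightarrow> cmod (f U) \<le> K"
    using tame_bounded[OF assms(1)] by metis
  obtain L where L: "L \<ge> 0" "\<And>U. U \<in> unitary_set n \<Longrightarrow> cmod (h U) \<le> L"
    using tame_bounded[OF assms(2)] by metis
  from K L have "\<And>U. U \<in> unitary_set n \<Longrightarrow> cmod (f U * h U) \<le> K * L"
    by (auto simp: norm_mult intro!: mult_mono)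
  then show ?thesis using assms by (auto simp: tame_def)
qed

lemma tame_uminus [intro!]: "tame n f \<Longrightarrow> tame n (\<lambda>U. - f U)"
  by (auto simp: tame_def)

lemma tame_sum [intro!]: "(\<And>i. i \<in> A \<Longrightarrow> tame n (f i)) \<Longrightarrow> tame n (\<lambda>U. \<Sum>i\<in>A. f i U)"
  by (induction A rule: infinite_finite_induct) auto

lemma tame_if [intro!]:
  "(P \<Longrightarrow> tame n f) \<Longrightarrow> (\<not> P \<Longrightarrow> tame n h) \<Longrightarrow> tame n (\<lambda>U. if P then f U else h U)"
  by (cases P) simp_all

lemma tame_exp [intro!]:
  assumes "tame n f" shows "tame n (\<lambda>U. exp (f U))"
proof -
  obtain K where K: "\<And>U. U \<in> unitary_set n \<Longrightarrow> cmod (f U) \<le> K"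
    using assms by (auto simp: tame_def)
  then have "\<And>U. U \<in> unitary_set n \<Longrightarrow> cmod (exp (f U)) \<le> exp K"
    by (meson exp_le_cancel_iff norm_exp order_trans)
  moreover have [measurable]: "f \<in> borel_measurable borel"
    using assms by (rule tame_measurable)
  ultimately show ?thesis by (auto simp: tame_def)
qed

lemma continuous_entry: "continuous_on UNIV (\<lambda>U :: nat \<Rightarrow> nat \<Rightarrow> complex. U i l)"
  by (rule continuous_on_product_then_coordinatewise
      [OF continuous_on_product_then_coordinatewise[OF continuous_on_id]])

lemma measurable_entry [measurable]:
  "(\<lambda>U :: nat \<Rightarrow> nat \<Rightarrow> complex. U i l) \<in> borel_measurable borel"
  by (rule borel_measurable_continuous_onI[OF continuous_entry])

lemma tame_entry [intro!]: "tame n (\<lambda>U. U i l)"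
  by (auto simp: tame_def intro!: exI[of _ 1] norm_unitary_entry_le)

lemma tame_cnj [intro!]: "tame n f \<Longrightarrow> tame n (\<lambda>U. cnj (f U))"
  by (auto simp: tame_def intro!: borel_measurable_continuous_on[of cnj] continuous_intros)

lemma matmul_measurable [measurable]:
  fixes V :: "nat \<Rightarrow> nat \<Rightarrow> complex"
  shows "matmul n V \<in> borel_measurable borel"
proof -
  have "continuous_on UNIV (\<lambda>U. matmul n V U i l)" for i l
    unfolding matmul_def by (cases "i < n \<and> l < n") (auto intro!: continuous_on_sum continuous_on_mult continuous_on_const continuous_entry)
  then show ?thesis
    by (rule borel_measurable_continuous_onI[OF continuous_on_coordinatewise_then_product
          [OF continuous_on_coordinatewise_then_product]])
qed

section \<open>Integrals with respect to the Haar measure\<close>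

lemma haar_prob_space: "haar_measure n \<mu> \<Longrightarrow> prob_space \<mu>"
  by (simp add: haar_measure_def)

lemma haar_sets: "haar_measure n \<mu> \<Longrightarrow> sets \<mu> = sets borel"
  by (simp add: haar_measure_def)

lemma haar_space: "haar_measure n \<mu> \<Longrightarrow> space \<mu> = UNIV"
  using sets_eq_imp_space_eq[of \<mu> borel] by (simp add: haar_measure_def)

lemma haar_measurable:
  "haar_measure n \<mu> \<Longrightarrow> f \<in> borel_measurable borel \<Longrightarrow> f \<in> borel_measurable \<mu>"
  using measurable_cong_sets[OF haar_sets[of n \<mu>] refl] by blast

lemma haar_AE_unitary:
  assumes "haar_measure n \<mu>" shows "AE U in \<mu>. U \<in> unitary_set n"
proof -
  interpret prob_space \<mu> by (rule haar_prob_space[OF assms])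
  have e: "emeasure \<mu> (unitary_set n) = 1" using assms by (simp add: haar_measure_def)
  \<comment> \<open>A non-measurable set would have \<open>emeasure\<close> 0, so the value 1 forces
    measurability.\<close>
  then have "unitary_set n \<in> sets \<mu>"
    using emeasure_notin_sets[of "unitary_set n" \<mu>] by fastforce
  with e show ?thesis by (simp add: AE_in_set_eq_1 emeasure_eq_measure)
qed

lemma haar_distr:
  assumes "haar_measure n \<mu>" "V \<in> unitary_set n"
  shows "distr \<mu> borel (matmul n V) = \<mu>"
proof (rule measure_eqI)
  show "sets (distr \<mu> borel (matmul n V)) = sets \<mu>" using haar_sets[OF assms(1)] by simp
  fix A assume A: "A \<in> sets (distr \<mu> borel (matmul n V))"
  then have "A \<in> sets borel" by simp
  moreover have "matmul n V \<in> measurable \<mu> borel"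
    by (rule haar_measurable[OF assms(1) matmul_measurable])
  moreover have "matmul n V -` A \<inter> space \<mu> = {U. matmul n V U \<in> A}"
    using haar_space[OF assms(1)] by auto
  ultimately show "emeasure (distr \<mu> borel (matmul n V)) A = emeasure \<mu> A"
    using assms by (simp add: emeasure_distr haar_measure_def)
qed

lemma haar_integral_translate:
  assumes "haar_measure n \<mu>" "V \<in> unitary_set n" "f \<in> borel_measurable borel"
  shows "(\<integral>U. f (matmul n V U) \<partial>\<mu>) = (\<integral>U. f U \<partial>\<mu> :: complex)"
proof -
  have "(\<integral>U. f U \<partial>\<mu>) = (\<integral>U. f U \<partial>distr \<mu> borel (matmul n V))"
    by (simp add: haar_distr[OF assms(1,2)])
  also have "\<dots> = (\<integral>U. f (matmul n V U) \<partial>\<mu>)"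
    by (rule integral_distr[OF haar_measurable[OF assms(1) matmul_measurable] assms(3)])
  finally show ?thesis by simp
qed

lemma tame_integrable:
  assumes "haar_measure n \<mu>" "tame n f" shows "integrable \<mu> f"
proof -
  interpret prob_space \<mu> by (rule haar_prob_space[OF assms(1)])
  obtain K where K: "\<And>U. U \<in> unitary_set n \<Longrightarrow> cmod (f U) \<le> K"
    using assms(2) by (auto simp: tame_def)
  show ?thesis
  proof (rule integrable_const_bound[of _ K])
    show "AE U in \<mu>. cmod (f U) \<le> K"
      using haar_AE_unitary[OF assms(1)] by eventually_elim (rule K)
  qed (rule haar_measurable[OF assms(1) tame_measurable[OF assms(2)]])
qed

text \<open>\<open>G a b\<close> is the derivative of \<open>f\<close> along the left translation generated by the matrix unit
  \<open>E a b\<close>, extended complex-linearly from skew-Hermitian generators. Prescribing it along the rank-one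
  generators \<open>i v v*\<close>, whose one-parameter groups are explicit, determines it by polarization.\<close>

definition has_grad :: "nat \<Rightarrow> ((nat \<Rightarrow> nat \<Rightarrow> complex) \<Rightarrow> complex) \<Rightarrow>
    (nat \<Rightarrow> nat \<Rightarrow> (nat \<Rightarrow> nat \<Rightarrow> complex) \<Rightarrow> complex) \<Rightarrow> bool" where
  "has_grad n f G \<longleftrightarrow> tame n f \<and> (\<forall>a<n. \<forall>b<n. tame n (G a b)) \<and>
     (\<forall>U\<in>unitary_set n. \<forall>v. ((\<lambda>t. f (rot n v t U)) has_vector_derivative
        (\<i> * (\<Sum>a<n. \<Sum>b<n. v a * cnj (v b) * G a b U))) (at 0))"

lemma has_vector_derivative_imp_tendsto:
  assumes "(f has_vector_derivative D) (at x)"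
  shows "((\<lambda>h. (f (x + h) - f x) /\<^sub>R h) \<longlongrightarrow> D) (at 0)"
proof -
  have lim: "((\<lambda>h. norm (f (x + h) - f x - h *\<^sub>R D) / norm h) \<longlongrightarrow> 0) (at 0)"
    using assms by (simp add: has_vector_derivative_def has_derivative_at)
  have eq: "norm (f (x + h) - f x - h *\<^sub>R D) / norm h = norm ((f (x + h) - f x) /\<^sub>R h - D)"
    if "h \<noteq> 0" for h
  proof -
    have "(f (x + h) - f x) /\<^sub>R h - D = (f (x + h) - f x - h *\<^sub>R D) /\<^sub>R h"
      using that by (simp add: scaleR_diff_right)
    then show ?thesis by (simp add: divide_inverse mult.commute)
  qed
  have "((\<lambda>h. norm ((f (x + h) - f x) /\<^sub>R h - D)) \<longlongrightarrow> 0) (at 0)"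
    by (rule Lim_transform_eventually[OF lim]) (auto simp: eventually_at_filter eq simp del: real_norm_def)
  then show ?thesis by (simp add: tendsto_norm_zero_iff LIM_zero_iff)
qed

text \<open>By invariance every difference quotient of \<open>f\<close> along the rotation has
  integral 0. The quotients converge to \<open>f'\<close>, and the mean value theorem bounds them by
  the supremum of \<open>f'\<close> on U(n), since the curve stays in U(n). Dominated convergence
  then passes to the limit.\<close>

lemma integral_directional_derivative_zero:
  assumes haar: "haar_measure n \<mu>" and f: "tame n f" and f': "tame n f'"
    and deriv: "\<And>U. U \<in> unitary_set n \<Longrightarrow> ((\<lambda>t. f (rot n v t U)) has_vector_derivative f' U) (at 0)"
  shows "(\<integral>U. f' U \<partial>\<mu>) = 0"
proof -
  interpret prob_space \<mu> by (rule haar_prob_space[OF haar])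
  obtain K where K: "K \<ge> 0" "\<And>U. U \<in> unitary_set n \<Longrightarrow> cmod (f' U) \<le> K"
    using tame_bounded[OF f'] by metis
  have deriv_t: "((\<lambda>t. f (rot n v t U)) has_vector_derivative f' (rot n v t U)) (at t)"
    if U: "U \<in> unitary_set n" for U t
  proof -
    have "((\<lambda>s. f (rot n v s (rot n v t U))) has_vector_derivative f' (rot n v t U)) (at (t - t))"
      using deriv[OF rot_unitary[OF U]] by simp
    then have "(((\<lambda>s. f (rot n v s (rot n v t U))) \<circ> (\<lambda>s. s - t)) has_vector_derivative
        (1 *\<^sub>R f' (rot n v t U))) (at t)"
      by (intro vector_diff_chain_at) (auto intro!: derivative_eq_intros)
    then show ?thesis by (simp add: o_def flip: rot_add)
  qed
  have lip: "cmod (f (rot n v t U) - f U) \<le> K * \<bar>t\<bar>" if U: "U \<in> unitary_set n" for U t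
  proof -
    have "norm (f (rot n v t U) - f (rot n v 0 U)) \<le> K * norm (t - 0)"
    proof (rule differentiable_bound[where S = UNIV])
      fix s :: real
      show "((\<lambda>t. f (rot n v t U)) has_derivative (\<lambda>h. h *\<^sub>R f' (rot n v s U))) (at s)"
        using deriv_t[OF U, of s] by (simp add: has_vector_derivative_def)
      show "onorm (\<lambda>h. h *\<^sub>R f' (rot n v s U)) \<le> K"
        by (rule onorm_le) (use K(2)[OF rot_unitary[OF U, of v s]] in
            \<open>auto simp: mult.commute[of K] intro!: mult_left_mono\<close>)
    qed auto
    then show ?thesis using rot_0[OF U] by simp
  qed
  \<comment> \<open>Dominated convergence is applied to sequences, so the limit at 0 is taken along
    the times 1 / (m + 1).\<close>
  define T where "T m = inverse (real (Suc m))" for m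
  define s where "s m U = (f (rot n v (T m) U) - f U) /\<^sub>R T m" for m U
  have Tpos: "T m > 0" for m by (simp add: T_def)
  have T0: "filterlim T (at 0) sequentially"
    unfolding filterlim_at T_def using LIMSEQ_inverse_real_of_nat by auto
  have frot [measurable]: "(\<lambda>U. f (rot n v t U)) \<in> borel_measurable borel" for t
    using measurable_compose[OF matmul_measurable tame_measurable[OF f]] .
  have fm [measurable]: "f \<in> borel_measurable borel" by (rule tame_measurable[OF f])
  have int_rot: "integrable \<mu> (\<lambda>U. f (rot n v t U))" for t
  proof -
    have "integrable (distr \<mu> borel (matmul n (rot_mat n v t))) f"
      unfolding haar_distr[OF haar rot_mat_unitary] by (rule tame_integrable[OF haar f])
    then show ?thesis
      by (rule integrable_distr[OF haar_measurable[OF haar matmul_measurable]])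
  qed
  have "(\<lambda>m. integral\<^sup>L \<mu> (s m)) \<longlonglongrightarrow> integral\<^sup>L \<mu> f'"
  proof (rule integral_dominated_convergence[where w = "\<lambda>_. K"])
    show "f' \<in> borel_measurable \<mu>" by (rule haar_measurable[OF haar tame_measurable[OF f']])
    show "s m \<in> borel_measurable \<mu>" for m
      by (rule haar_measurable[OF haar]) (unfold s_def, measurable)
    show "integrable \<mu> (\<lambda>_. K)" by simp
    show "AE U in \<mu>. (\<lambda>m. s m U) \<longlonglongrightarrow> f' U"
      using haar_AE_unitary[OF haar]
    proof eventually_elim
      fix U assume U: "U \<in> unitary_set n"
      have "((\<lambda>h. (f (rot n v (0 + h) U) - f (rot n v 0 U)) /\<^sub>R h) \<longlongrightarrow> f' U) (at 0)"
        by (rule has_vector_derivative_imp_tendsto[OF deriv[OF U]])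
      then have "((\<lambda>h. (f (rot n v h U) - f U) /\<^sub>R h) \<longlongrightarrow> f' U) (at 0)"
        by (simp add: rot_0[OF U])
      then show "(\<lambda>m. s m U) \<longlonglongrightarrow> f' U"
        unfolding s_def by (rule filterlim_compose[OF _ T0])
    qed
    show "AE U in \<mu>. norm (s m U) \<le> K" for m
      using haar_AE_unitary[OF haar]
    proof eventually_elim
      fix U assume U: "U \<in> unitary_set n"
      show "norm (s m U) \<le> K"
        using lip[OF U, of "T m"] Tpos[of m]
        by (simp add: s_def pos_divide_le_eq flip: divide_inverse_commute)
    qed
  qed
  moreover have "integral\<^sup>L \<mu> (s m) = 0" for m
    unfolding s_def using int_rot tame_integrable[OF haar f]
      haar_integral_translate[OF haar rot_mat_unitary fm]
    by simp
  ultimately have "(\<lambda>m. 0) \<longlonglongrightarrow> integral\<^sup>L \<mu> f'" by simp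
  then show ?thesis using LIMSEQ_unique tendsto_const by blast
qed

lemma sesquilinear_diagonal_zero:
  fixes B :: "nat \<Rightarrow> nat \<Rightarrow> complex"
  assumes zero: "\<And>v :: nat \<Rightarrow> complex. (\<Sum>a<n. \<Sum>b<n. v a * cnj (v b) * B a b) = 0"
    and ab: "a < n" "b < n"
  shows "B a b = 0"
proof -
  define e where "e i j = (if j = i then 1 else 0 :: complex)" for i j :: nat
  have expand: "(\<Sum>a'<n. \<Sum>b'<n. (e a a' + c * e b a') * cnj (e a b' + c * e b b') * B a' b')
      = B a a + c * B b a + cnj c * B a b + c * cnj c * B b b" for c
  proof -
    have inner: "(\<Sum>b'<n. x * cnj (e a b' + c * e b b') * B a' b')
        = x * (B a' a + cnj c * B a' b)" for x a'
    proof -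
      have "(\<Sum>b'<n. x * cnj (e a b' + c * e b b') * B a' b')
          = (\<Sum>b'<n. (if b' = a then x * B a' b' else 0) + (if b' = b then x * cnj c * B a' b' else 0))"
        by (intro sum.cong) (auto simp: e_def algebra_simps)
      then show ?thesis using ab by (simp add: sum.distrib algebra_simps)
    qed
    have "(\<Sum>a'<n. (e a a' + c * e b a') * (B a' a + cnj c * B a' b))
        = (\<Sum>a'<n. (if a' = a then B a' a + cnj c * B a' b else 0)
           + (if a' = b then c * (B a' a + cnj c * B a' b) else 0))"
      by (intro sum.cong) (auto simp: e_def algebra_simps)
    then show ?thesis using ab unfolding inner by (simp add: sum.distrib algebra_simps)
  qed
  have z: "B a a + c * B b a + cnj c * B a b + c * cnj c * B b b = 0" for c
    unfolding expand[symmetric] by (rule zero)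
  \<comment> \<open>Averaging c times the form over the fourth roots of unity c removes the terms
    with c and c^2 and keeps \<open>B a b\<close>, whose coefficient is |c|^2 = 1.\<close>
  define y where "y c = c * (B a a + c * B b a + cnj c * B a b + c * cnj c * B b b)" for c
  have "4 * B a b = y 1 + y \<i> + y (-1) + y (-\<i>)"
    by (simp add: y_def algebra_simps)
  then show ?thesis unfolding y_def z by simp
qed

text \<open>For each \<open>v\<close> the integrated derivative along the generator of
  \<open>v\<close> vanishes. It is a sesquilinear form in \<open>v\<close> with the integrals of
  \<open>G a b\<close> as coefficients, so polarization isolates each of them.\<close>

lemma integral_grad_zero:
  assumes haar: "haar_measure n \<mu>" and grad: "has_grad n f G" and ab: "a < n" "b < n"
  shows "(\<integral>U. G a b U \<partial>\<mu>) = 0"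
proof -
  have tameG: "tame n (G a b)" if "a < n" "b < n" for a b
    using grad that by (simp add: has_grad_def)
  have "(\<Sum>a<n. \<Sum>b<n. v a * cnj (v b) * (\<integral>U. G a b U \<partial>\<mu>)) = 0" for v
  proof -
    have int: "integrable \<mu> (G a b)" if "a < n" "b < n" for a b
      by (intro tame_integrable[OF haar] tameG that)
    have "(\<integral>U. \<i> * (\<Sum>a<n. \<Sum>b<n. v a * cnj (v b) * G a b U) \<partial>\<mu>) = 0"
      by (rule integral_directional_derivative_zero[OF haar, of f _ v])
        (use grad in \<open>auto simp: has_grad_def\<close>)
    moreover have "(\<integral>U. \<i> * (\<Sum>a<n. \<Sum>b<n. v a * cnj (v b) * G a b U) \<partial>\<mu>)
        = \<i> * (\<Sum>a<n. \<Sum>b<n. v a * cnj (v b) * (\<integral>U. G a b U \<partial>\<mu>))"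
    proof -
      have "(\<integral>U. (\<Sum>a<n. \<Sum>b<n. v a * cnj (v b) * G a b U) \<partial>\<mu>)
          = (\<Sum>a<n. \<integral>U. (\<Sum>b<n. v a * cnj (v b) * G a b U) \<partial>\<mu>)"
        by (intro Bochner_Integration.integral_sum Bochner_Integration.integrable_sum
            integrable_mult_right int) auto
      also have "\<dots> = (\<Sum>a<n. \<Sum>b<n. \<integral>U. v a * cnj (v b) * G a b U \<partial>\<mu>)"
        by (intro sum.cong refl Bochner_Integration.integral_sum integrable_mult_right int) auto
      finally show ?thesis by simp
    qed
    ultimately show ?thesis by simp
  qed
  then show ?thesis using ab by (rule sesquilinear_diagonal_zero)
qed

section \<open>Rules of calculus for gradients\<close>

lemma has_grad_tame: "has_grad n f G \<Longrightarrow> tame n f"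
  by (simp add: has_grad_def)

lemma has_grad_tame_grad: "has_grad n f G \<Longrightarrow> a < n \<Longrightarrow> b < n \<Longrightarrow> tame n (G a b)"
  by (simp add: has_grad_def)

lemma has_grad_const: "has_grad n (\<lambda>_. c) (\<lambda>a b U. 0)"
  by (auto simp: has_grad_def)

lemma has_grad_add:
  assumes "has_grad n f F" "has_grad n h H"
  shows "has_grad n (\<lambda>U. f U + h U) (\<lambda>a b U. F a b U + H a b U)"
proof -
  have "((\<lambda>t. f (rot n v t U) + h (rot n v t U)) has_vector_derivative
        (\<i> * (\<Sum>a<n. \<Sum>b<n. v a * cnj (v b) * (F a b U + H a b U)))) (at 0)"
    if "U \<in> unitary_set n" for U v
  proof -
    have "((\<lambda>t. f (rot n v t U) + h (rot n v t U)) has_vector_derivative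
        (\<i> * (\<Sum>a<n. \<Sum>b<n. v a * cnj (v b) * F a b U)
         + \<i> * (\<Sum>a<n. \<Sum>b<n. v a * cnj (v b) * H a b U))) (at 0)"
      using assms that by (intro has_vector_derivative_add) (auto simp: has_grad_def)
    then show ?thesis by (simp add: sum.distrib algebra_simps)
  qed
  then show ?thesis using assms by (auto simp: has_grad_def)
qed

lemma has_grad_mult:
  assumes "has_grad n f F" "has_grad n h H"
  shows "has_grad n (\<lambda>U. f U * h U) (\<lambda>a b U. F a b U * h U + f U * H a b U)"
proof -
  have "((\<lambda>t. f (rot n v t U) * h (rot n v t U)) has_vector_derivative
        (\<i> * (\<Sum>a<n. \<Sum>b<n. v a * cnj (v b) * (F a b U * h U + f U * H a b U)))) (at 0)"
    if U: "U \<in> unitary_set n" for U v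
  proof -
    have "((\<lambda>t. f (rot n v t U) * h (rot n v t U)) has_vector_derivative
        (f (rot n v 0 U) * (\<i> * (\<Sum>a<n. \<Sum>b<n. v a * cnj (v b) * H a b U))
         + (\<i> * (\<Sum>a<n. \<Sum>b<n. v a * cnj (v b) * F a b U)) * h (rot n v 0 U))) (at 0)"
      using assms that by (intro has_vector_derivative_mult) (auto simp: has_grad_def)
    moreover have "\<i> * (\<Sum>a<n. \<Sum>b<n. v a * cnj (v b) * (F a b U * h U + f U * H a b U))
        = f U * (\<i> * (\<Sum>a<n. \<Sum>b<n. v a * cnj (v b) * H a b U))
         + (\<i> * (\<Sum>a<n. \<Sum>b<n. v a * cnj (v b) * F a b U)) * h U"
      unfolding sum_distrib_left sum_distrib_right sum.distrib[symmetric]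
      by (intro sum.cong refl) (simp add: algebra_simps)
    ultimately show ?thesis
      by (simp only: rot_0[OF U])
  qed
  then show ?thesis using assms by (auto simp: has_grad_def)
qed

lemma has_grad_sum:
  assumes "\<And>i. i \<in> A \<Longrightarrow> has_grad n (f i) (F i)"
  shows "has_grad n (\<lambda>U. \<Sum>i\<in>A. f i U) (\<lambda>a b U. \<Sum>i\<in>A. F i a b U)"
  using assms
  by (induction A rule: infinite_finite_induct) (auto intro!: has_grad_add has_grad_const)

lemma has_grad_cmult:
  "has_grad n f F \<Longrightarrow> has_grad n (\<lambda>U. c * f U) (\<lambda>a b U. c * F a b U)"
  using has_grad_mult[OF has_grad_const, of n f F c] by simp

lemma has_grad_uminus: "has_grad n f F \<Longrightarrow> has_grad n (\<lambda>U. - f U) (\<lambda>a b U. - F a b U)"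
  using has_grad_cmult[of n f F "-1"] by simp

lemma has_grad_diff:
  "has_grad n f F \<Longrightarrow> has_grad n h H \<Longrightarrow>
    has_grad n (\<lambda>U. f U - h U) (\<lambda>a b U. F a b U - H a b U)"
  using has_grad_add[OF _ has_grad_uminus, of n f F h H] by simp

lemma has_grad_if:
  "(P \<Longrightarrow> has_grad n f F) \<Longrightarrow> (\<not> P \<Longrightarrow> has_grad n h H) \<Longrightarrow>
    has_grad n (\<lambda>U. if P then f U else h U) (\<lambda>a b U. if P then F a b U else H a b U)"
  by (cases P) simp_all

lemma has_grad_exp:
  assumes "has_grad n f F"
  shows "has_grad n (\<lambda>U. exp (f U)) (\<lambda>a b U. F a b U * exp (f U))"
proof -
  have "((\<lambda>t. exp (f (rot n v t U))) has_vector_derivative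
        (\<i> * (\<Sum>a<n. \<Sum>b<n. v a * cnj (v b) * (F a b U * exp (f U))))) (at 0)"
    if U: "U \<in> unitary_set n" for U v
  proof -
    have "((exp \<circ> (\<lambda>t. f (rot n v t U))) has_vector_derivative
        (\<i> * (\<Sum>a<n. \<Sum>b<n. v a * cnj (v b) * F a b U)) * exp (f (rot n v 0 U))) (at 0)"
      by (rule field_vector_diff_chain_at) (use assms that in \<open>auto simp: has_grad_def DERIV_exp\<close>)
    moreover have "\<i> * (\<Sum>a<n. \<Sum>b<n. v a * cnj (v b) * (F a b U * exp (f U)))
        = (\<i> * (\<Sum>a<n. \<Sum>b<n. v a * cnj (v b) * F a b U)) * exp (f U)"
      unfolding sum_distrib_left sum_distrib_right
      by (intro sum.cong refl) (simp add: mult_ac)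
    ultimately show ?thesis
      by (simp only: rot_0[OF U] o_def)
  qed
  then show ?thesis using assms by (auto simp: has_grad_def)
qed

lemma sum_sum_delta1:
  assumes "i < (n::nat)"
  shows "(\<Sum>a<n. \<Sum>b<n. f a b * (if i = a then g a b else 0)) = (\<Sum>b<n. f i b * g i b :: complex)"
proof -
  have "(\<Sum>a<n. \<Sum>b<n. f a b * (if i = a then g a b else 0))
      = (\<Sum>a<n. if a = i then (\<Sum>b<n. f a b * g a b) else 0)"
    by (intro sum.cong) auto
  then show ?thesis using assms by simp
qed

text \<open>Left multiplication by the matrix unit \<open>E a b\<close> puts row \<open>b\<close>
  into row \<open>a\<close> and clears all other rows.\<close>

lemma has_grad_entry:
  assumes "i < n" "l < n"
  shows "has_grad n (\<lambda>U. U i l) (\<lambda>a b U. if i = a then U b l else 0)"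
proof -
  have "(\<Sum>a<n. \<Sum>b<n. v a * cnj (v b) * (if i = a then U b l else 0))
      = v i * (\<Sum>b<n. cnj (v b) * U b l)" for v and U :: "nat \<Rightarrow> nat \<Rightarrow> complex"
    using sum_sum_delta1[OF assms(1), of "\<lambda>a b. v a * cnj (v b)" "\<lambda>a b. U b l"]
    by (simp add: sum_distrib_left mult.assoc)
  then show ?thesis
    using rot_entry_has_derivative[OF assms] by (auto simp: has_grad_def)
qed

text \<open>Real derivatives commute with conjugation, but \<open>F a b\<close> is the
  complex-linear extension from the generators i v v*. Conjugating the coefficients i v_a cnj v_b
  gives the sign and exchanges the two indices.\<close>

lemma has_grad_cnj:
  assumes "has_grad n f F"
  shows "has_grad n (\<lambda>U. cnj (f U)) (\<lambda>a b U. - cnj (F b a U))"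
proof -
  have "((\<lambda>t. cnj (f (rot n v t U))) has_vector_derivative
        (\<i> * (\<Sum>a<n. \<Sum>b<n. v a * cnj (v b) * - cnj (F b a U)))) (at 0)"
    if U: "U \<in> unitary_set n" for U v
  proof -
    have "((\<lambda>t. cnj (f (rot n v t U))) has_vector_derivative
        cnj (\<i> * (\<Sum>a<n. \<Sum>b<n. v a * cnj (v b) * F a b U))) (at 0)"
      by (rule has_vector_derivative_cnj) (use assms that in \<open>auto simp: has_grad_def\<close>)
    also have "cnj (\<i> * (\<Sum>a<n. \<Sum>b<n. v a * cnj (v b) * F a b U))
        = \<i> * (\<Sum>a<n. \<Sum>b<n. v b * cnj (v a) * - cnj (F a b U))"
      by (simp add: sum_negf mult.commute)
    also have "\<dots> = \<i> * (\<Sum>a<n. \<Sum>b<n. v a * cnj (v b) * - cnj (F b a U))"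
      by (subst sum.swap) (rule refl)
    finally show ?thesis .
  qed
  then show ?thesis using assms by (auto simp: has_grad_def)
qed

lemma tame_norm_sq_measurable:
  assumes "tame n f" shows "(\<lambda>U. (cmod (f U))\<^sup>2) \<in> borel_measurable borel"
proof -
  note [measurable] = tame_measurable[OF assms]
  show ?thesis by measurable
qed

section \<open>Concentration of the covariance matrix\<close>

text \<open>The matrix factors into an isometry, the diagonal matrix of the \<open>r l\<close> and
  another isometry, so its operator norm is at most \<open>R\<close>. The rows \<open>V\<close> will
  be those of the conjugate of \<open>U\<close> for \<open>W\<close>, and those of \<open>U\<close>
  itself for \<open>S\<close>.\<close>

lemma norm_bilinear_le:
  fixes x :: "nat \<Rightarrow> complex" and r :: "nat \<Rightarrow> real"
  assumes U: "U \<in> unitary_set n" and r: "\<And>l. l < n \<Longrightarrow> \<bar>r l\<bar> \<le> R"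
    and orth: "\<And>i j. i < k \<Longrightarrow> j < k \<Longrightarrow> (\<Sum>l<n. cnj (V i l) * V j l) = (if i = j then 1 else 0)"
  shows "(\<Sum>b<n. (cmod (\<Sum>j<k. (\<Sum>l<n. of_real (r l) * (U b l * V j l)) * x j))\<^sup>2)
    \<le> R\<^sup>2 * (\<Sum>j<k. (cmod (x j))\<^sup>2)"
proof -
  have "(\<Sum>j<k. (\<Sum>l<n. of_real (r l) * (U b l * V j l)) * x j)
      = (\<Sum>l<n. (of_real (r l) * (\<Sum>j<k. x j * V j l)) * U b l)" for b
    unfolding sum_distrib_left sum_distrib_right by (subst sum.swap) (simp add: mult_ac)
  then have "(\<Sum>b<n. (cmod (\<Sum>j<k. (\<Sum>l<n. of_real (r l) * (U b l * V j l)) * x j))\<^sup>2)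
      = (\<Sum>l<n. (cmod (of_real (r l) * (\<Sum>j<k. x j * V j l)))\<^sup>2)"
    using sum_norm_sq_orthonormal[where k = n and n = n and e = "\<lambda>l b. U b l", OF unitary_setD_col[OF U]] by simp
  also have "\<dots> \<le> (\<Sum>l<n. R\<^sup>2 * (cmod (\<Sum>j<k. x j * V j l))\<^sup>2)"
    using order_trans[OF r abs_ge_self] by (intro sum_mono) (auto simp: norm_mult power_mult_distrib
        intro!: mult_right_mono abs_le_square_iff[THEN iffD1])
  also have "\<dots> = R\<^sup>2 * (\<Sum>j<k. (cmod (x j))\<^sup>2)"
    using sum_norm_sq_orthonormal[where k = k and n = n and e = V and d = x, OF orth] by (simp flip: sum_distrib_left)
  finally show ?thesis .
qed

lemma norm_add_sq_le: "(cmod (x + y))\<^sup>2 \<le> 2 * (cmod x)\<^sup>2 + 2 * (cmod y)\<^sup>2"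
proof -
  have "(cmod (x + y))\<^sup>2 \<le> (cmod x + cmod y)\<^sup>2" by (intro power_mono norm_triangle_ineq) auto
  also have "\<dots> \<le> 2 * (cmod x)\<^sup>2 + 2 * (cmod y)\<^sup>2"
    using sum_squares_bound[of "cmod x" "cmod y"] by (simp add: power2_sum)
  finally show ?thesis .
qed

lemma norm_diff_sq_le: "(cmod (x - y))\<^sup>2 \<le> 2 * (cmod x)\<^sup>2 + 2 * (cmod y)\<^sup>2"
  using norm_add_sq_le[of x "- y"] by simp

text \<open>With \<open>p = (z + 1/z)/2\<close> and \<open>q = (z - 1/z)/2\<close>, the Hermitian matrix \<open>W = U p U*\<close> and the symmetric
  matrix \<open>S = U q U\<^sup>T\<close> carry the same information as the covariance matrix, and \<open>2 * dev\<close> is the squared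
  Hilbert-Schmidt distance of the reduced covariance matrix from \<open>lam\<close> times the identity.\<close>

locale network =
  fixes n k :: nat and p q :: "nat \<Rightarrow> real" and lam P :: real
  assumes k_le_n: "k \<le> n" and n_pos: "n > 0"
    and p_nonneg: "\<And>l. l < n \<Longrightarrow> 0 \<le> p l"
    and q_le_p: "\<And>l. l < n \<Longrightarrow> \<bar>q l\<bar> \<le> p l"
    and p_le: "\<And>l. l < n \<Longrightarrow> p l \<le> P"
    and lam_eq: "lam * real n = (\<Sum>l<n. p l)"
    and lam_ge: "lam \<ge> 1"
begin

definition W :: "nat \<Rightarrow> nat \<Rightarrow> (nat \<Rightarrow> nat \<Rightarrow> complex) \<Rightarrow> complex" where
  "W i j U = (\<Sum>l<n. of_real (p l) * (U i l * cnj (U j l)))"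

definition S :: "nat \<Rightarrow> nat \<Rightarrow> (nat \<Rightarrow> nat \<Rightarrow> complex) \<Rightarrow> complex" where
  "S i j U = (\<Sum>l<n. of_real (q l) * (U i l * U j l))"

definition T :: "nat \<Rightarrow> nat \<Rightarrow> (nat \<Rightarrow> nat \<Rightarrow> complex) \<Rightarrow> complex" where
  "T i j U = W i j U - (if i = j then of_real lam else 0)"

definition dev :: "(nat \<Rightarrow> nat \<Rightarrow> complex) \<Rightarrow> real" where
  "dev U = (\<Sum>i<k. \<Sum>j<k. (cmod (T i j U))\<^sup>2 + (cmod (S i j U))\<^sup>2)"

text \<open>The gradient calculus concerns complex-valued functions. Here the squared moduli are
  products with conjugates, to which its rules apply directly.\<close>

definition cdev :: "(nat \<Rightarrow> nat \<Rightarrow> complex) \<Rightarrow> complex" where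
  "cdev U = (\<Sum>i<k. \<Sum>j<k. T i j U * cnj (T i j U) + S i j U * cnj (S i j U))"

lemma cdev_eq: "cdev U = of_real (dev U)"
  unfolding cdev_def dev_def of_real_sum of_real_add complex_norm_square ..

text \<open>\<open>dW i j a b\<close> is the \<open>(a, b)\<close> component of the gradient of \<open>W i j\<close>, and \<open>ddW i j c d a b\<close> that of
  \<open>dW i j c d\<close>; likewise for \<open>S\<close>.\<close>

definition dW :: "nat \<Rightarrow> nat \<Rightarrow> nat \<Rightarrow> nat \<Rightarrow> (nat \<Rightarrow> nat \<Rightarrow> complex) \<Rightarrow> complex" where
  "dW i j a b U = (if i = a then W b j U else 0) - (if j = b then W i a U else 0)"

definition dS :: "nat \<Rightarrow> nat \<Rightarrow> nat \<Rightarrow> nat \<Rightarrow> (nat \<Rightarrow> nat \<Rightarrow> complex) \<Rightarrow> complex" where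
  "dS i j a b U = (if i = a then S b j U else 0) + (if j = a then S i b U else 0)"

definition ddW :: "nat \<Rightarrow> nat \<Rightarrow> nat \<Rightarrow> nat \<Rightarrow> nat \<Rightarrow> nat \<Rightarrow> (nat \<Rightarrow> nat \<Rightarrow> complex) \<Rightarrow> complex" where
  "ddW i j c d a b U = (if i = c then dW d j a b U else 0) - (if j = d then dW i c a b U else 0)"

definition ddS :: "nat \<Rightarrow> nat \<Rightarrow> nat \<Rightarrow> nat \<Rightarrow> nat \<Rightarrow> nat \<Rightarrow> (nat \<Rightarrow> nat \<Rightarrow> complex) \<Rightarrow> complex" where
  "ddS i j c d a b U = (if i = c then dS d j a b U else 0) + (if j = c then dS i d a b U else 0)"

lemma cnj_W: "cnj (W i j U) = W j i U"
  by (simp add: W_def mult.commute)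

lemma S_commute: "S i j U = S j i U"
  by (simp add: S_def mult.commute)

lemma cnj_T: "cnj (T i j U) = T j i U"
  by (auto simp: T_def cnj_W)

lemma has_grad_W:
  assumes "i < n" "j < n" shows "has_grad n (W i j) (dW i j)"
proof -
  have "has_grad n (\<lambda>U. \<Sum>l<n. of_real (p l) * (U i l * cnj (U j l)))
     (\<lambda>a b U. \<Sum>l<n. of_real (p l) * ((if i = a then U b l else 0) * cnj (U j l)
        + U i l * - cnj (if j = b then U a l else 0)))"
    using assms by (intro has_grad_sum has_grad_cmult has_grad_mult has_grad_cnj has_grad_entry) auto
  moreover have "(\<Sum>l<n. of_real (p l) * ((if i = a then U b l else 0) * cnj (U j l)
        + U i l * - cnj (if j = b then U a l else 0))) = dW i j a b U" for a b U
    by (simp add: dW_def W_def algebra_simps sum_subtractf sum_negf)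
  ultimately show ?thesis by (simp add: W_def[abs_def])
qed

lemma has_grad_S:
  assumes "i < n" "j < n" shows "has_grad n (S i j) (dS i j)"
proof -
  have "has_grad n (\<lambda>U. \<Sum>l<n. of_real (q l) * (U i l * U j l))
     (\<lambda>a b U. \<Sum>l<n. of_real (q l) * ((if i = a then U b l else 0) * U j l
        + U i l * (if j = a then U b l else 0)))"
    using assms by (intro has_grad_sum has_grad_cmult has_grad_mult has_grad_entry) auto
  moreover have "(\<Sum>l<n. of_real (q l) * ((if i = a then U b l else 0) * U j l
        + U i l * (if j = a then U b l else 0))) = dS i j a b U" for a b U
    by (simp add: dS_def S_def algebra_simps sum.distrib)
  ultimately show ?thesis by (simp add: S_def[abs_def])
qed

lemma has_grad_T:
  assumes "i < n" "j < n" shows "has_grad n (T i j) (dW i j)"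
  using has_grad_diff[OF has_grad_W[OF assms] has_grad_const[of n "if i = j then of_real lam else 0"]]
  by (simp add: T_def[abs_def])

lemma has_grad_dW:
  assumes "i < n" "j < n" "c < n" "d < n" shows "has_grad n (dW i j c d) (ddW i j c d)"
proof -
  have "has_grad n (\<lambda>U. (if i = c then W d j U else 0) - (if j = d then W i c U else 0))
      (\<lambda>a b U. (if i = c then dW d j a b U else 0) - (if j = d then dW i c a b U else 0))"
    by (intro has_grad_diff has_grad_if has_grad_const has_grad_W assms)
  then show ?thesis by (simp only: dW_def[abs_def] ddW_def[abs_def])
qed

lemma has_grad_dS:
  assumes "i < n" "j < n" "c < n" "d < n" shows "has_grad n (dS i j c d) (ddS i j c d)"
proof -
  have "has_grad n (\<lambda>U. (if i = c then S d j U else 0) + (if j = c then S i d U else 0))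
      (\<lambda>a b U. (if i = c then dS d j a b U else 0) + (if j = c then dS i d a b U else 0))"
    by (intro has_grad_add has_grad_if has_grad_const has_grad_S assms)
  then show ?thesis by (simp only: dS_def[abs_def] ddS_def[abs_def])
qed

text \<open>Gradient of \<open>cdev\<close>. It and its own gradient \<open>H\<close> are left in
  the shape in which the product and conjugation rules produce them, double negations included, so
  that both are verified by the rules alone. The closed form is \<open>G_eq\<close>.\<close>

definition G :: "nat \<Rightarrow> nat \<Rightarrow> (nat \<Rightarrow> nat \<Rightarrow> complex) \<Rightarrow> complex" where
  "G a b U = (\<Sum>i<k. \<Sum>j<k.
     (dW i j a b U * cnj (T i j U) + T i j U * - cnj (dW i j b a U)) +
     (dS i j a b U * cnj (S i j U) + S i j U * - cnj (dS i j b a U)))"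

definition H :: "nat \<Rightarrow> nat \<Rightarrow> nat \<Rightarrow> nat \<Rightarrow> (nat \<Rightarrow> nat \<Rightarrow> complex) \<Rightarrow> complex" where
  "H c d a b U = (\<Sum>i<k. \<Sum>j<k.
     ((ddW i j c d a b U * cnj (T i j U) + dW i j c d U * - cnj (dW i j b a U)) +
      (dW i j a b U * - cnj (dW i j d c U) + T i j U * - (- cnj (ddW i j d c b a U)))) +
     ((ddS i j c d a b U * cnj (S i j U) + dS i j c d U * - cnj (dS i j b a U)) +
      (dS i j a b U * - cnj (dS i j d c U) + S i j U * - (- cnj (ddS i j d c b a U)))))"

lemma has_grad_cdev: "has_grad n cdev G"
  unfolding cdev_def[abs_def] G_def[abs_def]
  by (intro has_grad_sum has_grad_add has_grad_mult has_grad_cnj has_grad_T has_grad_S)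
    (use k_le_n in auto)

lemma has_grad_G:
  assumes "c < n" "d < n" shows "has_grad n (G c d) (H c d)"
  unfolding H_def[abs_def] G_def[abs_def]
  by (intro has_grad_sum has_grad_add has_grad_mult has_grad_uminus has_grad_cnj
      has_grad_T has_grad_S has_grad_dW has_grad_dS)
    (use k_le_n assms in auto)

text \<open>\<open>dev\<close> is real, so its gradient is anti-Hermitian. Hence
  \<open>G b a\<close> times \<open>G a b\<close> is minus a squared modulus, which is why the
  gradient term enters \<open>Lexp\<close> with a negative sign.\<close>

lemma cnj_G: "cnj (G a b U) = - G b a U"
  unfolding G_def by (simp add: sum_negf[symmetric] algebra_simps)

text \<open>The trace is constant on U(n). The Casimir operator turns it into a multiple of the
  identity, and this makes the centred entries \<open>T\<close> the eigenfunctions, with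
  \<open>lam\<close> the right centre.\<close>

lemma trace_W:
  assumes U: "U \<in> unitary_set n" shows "(\<Sum>a<n. W a a U) = of_real (lam * real n)"
proof -
  have "(\<Sum>a<n. W a a U) = (\<Sum>l<n. of_real (p l) * (\<Sum>a<n. cnj (U a l) * U a l))"
    unfolding W_def sum_distrib_left by (subst sum.swap) (simp add: mult_ac)
  also have "\<dots> = (\<Sum>l<n. of_real (p l))"
    by (intro sum.cong refl) (simp add: unitary_setD_col[OF U])
  finally show ?thesis by (simp add: lam_eq)
qed

text \<open>The entries of \<open>W - lam\<close> and of \<open>S\<close> are eigenfunctions of the Casimir operator with eigenvalues of
  order \<open>n\<close>; this is the source of the concentration rate.\<close>

lemma casimir_W:
  assumes U: "U \<in> unitary_set n" and ij: "i < n" "j < n"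
  shows "(\<Sum>a<n. \<Sum>b<n. ddW i j b a a b U) = of_nat (2 * n) * T i j U"
proof -
  have 1: "(\<Sum>b<n. if i = b then W b j U - (if j = b then W a a U else 0) else 0)
      = W i j U - (if i = j then W a a U else 0)" for a
    using ij by (simp add: sum.delta')
  have 2: "(\<Sum>a<n. if j = a then (if i = a then W b b U else 0) - W i a U else 0)
      = (if i = j then W b b U else 0) - W i j U" for b
    using ij by (simp add: sum.delta')
  have "(\<Sum>a<n. \<Sum>b<n. ddW i j b a a b U)
      = (\<Sum>a<n. \<Sum>b<n. if i = b then W b j U - (if j = b then W a a U else 0) else 0)
        - (\<Sum>a<n. \<Sum>b<n. if j = a then (if i = a then W b b U else 0) - W i a U else 0)"
    unfolding sum_subtractf[symmetric] ddW_def dW_def by (intro sum.cong refl) auto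
  also have "(\<Sum>a<n. \<Sum>b<n. if j = a then (if i = a then W b b U else 0) - W i a U else 0)
      = (\<Sum>b<n. \<Sum>a<n. if j = a then (if i = a then W b b U else 0) - W i a U else 0)"
    by (rule sum.swap)
  finally show ?thesis unfolding 1 2
    using trace_W[OF U] by (auto simp: sum_subtractf T_def algebra_simps)
qed

text \<open>Both indices of \<open>S\<close> transform in the same way, so the cross terms exchange
  \<open>i\<close> and \<open>j\<close> instead of producing a trace. By symmetry of
  \<open>S\<close> they contribute the additional 2.\<close>

lemma casimir_S:
  assumes ij: "i < n" "j < n"
  shows "(\<Sum>a<n. \<Sum>b<n. ddS i j b a a b U) = of_nat (2 * n + 2) * S i j U"
proof -
  have 1: "(\<Sum>b<n. if i = b then S b j U + (if j = a then S a b U else 0) else 0)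
      = S i j U + (if j = a then S a i U else 0)" for a
    using ij by (simp add: sum.delta')
  have 2: "(\<Sum>b<n. if j = b then (if i = a then S b a U else 0) + S i b U else 0)
      = (if i = a then S j a U else 0) + S i j U" for a
    using ij by (simp add: sum.delta')
  have "(\<Sum>a<n. \<Sum>b<n. ddS i j b a a b U)
      = (\<Sum>a<n. \<Sum>b<n. if i = b then S b j U + (if j = a then S a b U else 0) else 0)
        + (\<Sum>a<n. \<Sum>b<n. if j = b then (if i = a then S b a U else 0) + S i b U else 0)"
    unfolding sum.distrib[symmetric] ddS_def dS_def by (intro sum.cong refl) auto
  then show ?thesis unfolding 1 2
    using ij by (simp add: sum.distrib S_commute[of j i] algebra_simps)
qed

definition Gam :: "(nat \<Rightarrow> nat \<Rightarrow> complex) \<Rightarrow> real" where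
  "Gam U = (\<Sum>i<k. \<Sum>j<k. \<Sum>a<n. \<Sum>b<n. (cmod (dW i j a b U))\<^sup>2 + (cmod (dS i j a b U))\<^sup>2)"

text \<open>Leibniz rule of second order: an entry f with eigenvalue e contributes 2 e |f|^2 minus
  twice its squared gradient, the minus being the sign in \<open>has_grad_cnj\<close>. The separate
  sum over \<open>S\<close> is the excess of the eigenvalue 2n + 2 over 2n.\<close>

lemma laplace_dev:
  assumes U: "U \<in> unitary_set n"
  shows "(\<Sum>a<n. \<Sum>b<n. H b a a b U) =
    of_real (4 * real n * dev U + 4 * (\<Sum>i<k. \<Sum>j<k. (cmod (S i j U))\<^sup>2) - 2 * Gam U)"
proof -
  define tW where "tW i j = complex_of_real (\<Sum>a<n. \<Sum>b<n. (cmod (dW i j a b U))\<^sup>2)" for i j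
  define tS where "tS i j = complex_of_real (\<Sum>a<n. \<Sum>b<n. (cmod (dS i j a b U))\<^sup>2)" for i j
  have W1: "(\<Sum>a<n. \<Sum>b<n. dW i j a b U * cnj (dW i j a b U)) = tW i j" for i j
    unfolding tW_def of_real_sum complex_norm_square ..
  have S1: "(\<Sum>a<n. \<Sum>b<n. dS i j a b U * cnj (dS i j a b U)) = tS i j" for i j
    unfolding tS_def of_real_sum complex_norm_square ..
  have W2: "(\<Sum>a<n. \<Sum>b<n. dW i j b a U * cnj (dW i j b a U)) = tW i j" for i j
    by (subst sum.swap) (rule W1)
  have S2: "(\<Sum>a<n. \<Sum>b<n. dS i j b a U * cnj (dS i j b a U)) = tS i j" for i j
    by (subst sum.swap) (rule S1)
  have W3: "(\<Sum>a<n. \<Sum>b<n. ddW i j a b b a U) = of_nat (2 * n) * T i j U" if "i < k" "j < k" for i j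
    using that k_le_n by (subst sum.swap) (intro casimir_W U; simp)
  have S3: "(\<Sum>a<n. \<Sum>b<n. ddS i j a b b a U) = of_nat (2 * n + 2) * S i j U" if "i < k" "j < k" for i j
    using that k_le_n by (subst sum.swap) (intro casimir_S; simp)
  have swap: "(\<Sum>a<n. \<Sum>b<n. \<Sum>i<k. \<Sum>j<k. f a b i j) = (\<Sum>i<k. \<Sum>j<k. \<Sum>a<n. \<Sum>b<n. f a b i j)"
    for f :: "nat \<Rightarrow> nat \<Rightarrow> nat \<Rightarrow> nat \<Rightarrow> complex"
  proof -
    have swap3: "(\<Sum>b<n. \<Sum>i<k. \<Sum>j<k. h b i j) = (\<Sum>i<k. \<Sum>j<k. \<Sum>b<n. h b i j)"
      for h :: "nat \<Rightarrow> nat \<Rightarrow> nat \<Rightarrow> complex"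
      by (subst sum.swap, rule sum.cong[OF refl], rule sum.swap)
    have "(\<Sum>a<n. \<Sum>b<n. \<Sum>i<k. \<Sum>j<k. f a b i j) = (\<Sum>a<n. \<Sum>i<k. \<Sum>j<k. \<Sum>b<n. f a b i j)"
      by (rule sum.cong[OF refl], rule swap3)
    also have "\<dots> = (\<Sum>i<k. \<Sum>j<k. \<Sum>a<n. \<Sum>b<n. f a b i j)" by (rule swap3)
    finally show ?thesis .
  qed
  have "(\<Sum>a<n. \<Sum>b<n. H b a a b U) = (\<Sum>i<k. \<Sum>j<k.
      ((\<Sum>a<n. \<Sum>b<n. ddW i j b a a b U) * cnj (T i j U) - (\<Sum>a<n. \<Sum>b<n. dW i j b a U * cnj (dW i j b a U))
       - (\<Sum>a<n. \<Sum>b<n. dW i j a b U * cnj (dW i j a b U)) + T i j U * cnj (\<Sum>a<n. \<Sum>b<n. ddW i j a b b a U))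
    + ((\<Sum>a<n. \<Sum>b<n. ddS i j b a a b U) * cnj (S i j U) - (\<Sum>a<n. \<Sum>b<n. dS i j b a U * cnj (dS i j b a U))
       - (\<Sum>a<n. \<Sum>b<n. dS i j a b U * cnj (dS i j a b U)) + S i j U * cnj (\<Sum>a<n. \<Sum>b<n. ddS i j a b b a U)))"
    unfolding H_def swap cnj_sum sum_distrib_left sum_distrib_right
      sum_subtractf[symmetric] sum.distrib[symmetric]
    by (intro sum.cong refl) simp
  also have "\<dots> = (\<Sum>i<k. \<Sum>j<k. of_nat (4 * n) * (T i j U * cnj (T i j U) + S i j U * cnj (S i j U))
      + 4 * (S i j U * cnj (S i j U)) - 2 * (tW i j + tS i j))"
  proof (intro sum.cong refl, goal_cases)
    case (1 i j)
    then have ij: "i < k" "j < k" "i < n" "j < n" using k_le_n by auto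
    show ?case
      unfolding W1 W2 S1 S2 W3[OF ij(1,2)] S3[OF ij(1,2)] casimir_W[OF U ij(3,4)] casimir_S[OF ij(3,4)]
      by (simp add: algebra_simps)
  qed
  also have "\<dots> = of_nat (4 * n) * cdev U + 4 * of_real (\<Sum>i<k. \<Sum>j<k. (cmod (S i j U))\<^sup>2)
      - 2 * of_real (Gam U)"
    unfolding cdev_def Gam_def tW_def tS_def of_real_sum of_real_add complex_norm_square
    by (simp add: sum.distrib sum_subtractf sum_distrib_left algebra_simps)
  finally show ?thesis by (simp add: cdev_eq)
qed

section \<open>Bounds for the squared gradients\<close>

lemma norm_W_le:
  assumes U: "U \<in> unitary_set n"
  shows "(\<Sum>b<n. (cmod (\<Sum>j<k. W b j U * x j))\<^sup>2) \<le> P\<^sup>2 * (\<Sum>j<k. (cmod (x j))\<^sup>2)"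
  unfolding W_def
  by (rule norm_bilinear_le[OF U]) (use p_nonneg p_le k_le_n unitary_setD_row[OF U] in auto)

lemma norm_S_le:
  assumes U: "U \<in> unitary_set n"
  shows "(\<Sum>b<n. (cmod (\<Sum>j<k. S b j U * x j))\<^sup>2) \<le> P\<^sup>2 * (\<Sum>j<k. (cmod (x j))\<^sup>2)"
  unfolding S_def
proof (rule norm_bilinear_le[OF U])
  show "\<bar>q l\<bar> \<le> P" if "l < n" for l using q_le_p[OF that] p_le[OF that] by simp
  fix i j assume "i < k" "j < k"
  then show "(\<Sum>l<n. cnj (U i l) * U j l) = (if i = j then 1 else 0)"
    using unitary_setD_row[OF U, of j i] k_le_n by (simp add: mult.commute)
qed

definition w :: "nat \<Rightarrow> (nat \<Rightarrow> nat \<Rightarrow> complex) \<Rightarrow> real" where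
  "w j U = (\<Sum>l<n. p l * (cmod (U j l))\<^sup>2)"

lemma W_diag: "W j j U = of_real (w j U)"
  unfolding W_def w_def of_real_sum of_real_mult complex_norm_square ..

lemma P_nonneg: "0 \<le> P"
  using p_nonneg[OF n_pos] p_le[OF n_pos] by linarith

text \<open>Only one of the two factors \<open>p l\<close> in the squared norm is replaced by its
  maximum \<open>P\<close>; the other stays and builds up the mode energy \<open>w j\<close>. The
  bound is therefore linear in the squeezing.\<close>

lemma norm_col_le:
  fixes r :: "nat \<Rightarrow> real"
  assumes U: "U \<in> unitary_set n" and r: "\<And>l. l < n \<Longrightarrow> \<bar>r l\<bar> \<le> p l"
    and V: "\<And>l. l < n \<Longrightarrow> cmod (V l) = cmod (U j l)"
  shows "(\<Sum>b<n. (cmod (\<Sum>l<n. of_real (r l) * (U b l * V l)))\<^sup>2) \<le> P * w j U"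
proof -
  have "(\<Sum>l<n. of_real (r l) * (U b l * V l)) = (\<Sum>l<n. (of_real (r l) * V l) * U b l)" for b
    by (simp add: mult_ac)
  then have "(\<Sum>b<n. (cmod (\<Sum>l<n. of_real (r l) * (U b l * V l)))\<^sup>2)
      = (\<Sum>l<n. (cmod (of_real (r l) * V l))\<^sup>2)"
    using sum_norm_sq_orthonormal[where k = n and n = n and e = "\<lambda>l b. U b l", OF unitary_setD_col[OF U]] by simp
  also have "\<dots> \<le> (\<Sum>l<n. P * (p l * (cmod (U j l))\<^sup>2))"
  proof (rule sum_mono)
    fix l assume "l \<in> {..<n}"
    then have l: "l < n" by simp
    have "(r l)\<^sup>2 \<le> (p l)\<^sup>2" using r[OF l] p_nonneg[OF l] by (simp add: abs_le_square_iff[symmetric])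
    also have "\<dots> \<le> P * p l" using p_nonneg[OF l] p_le[OF l]
      by (simp add: power2_eq_square mult_right_mono)
    finally have "(r l)\<^sup>2 * (cmod (U j l))\<^sup>2 \<le> P * p l * (cmod (U j l))\<^sup>2"
      by (rule mult_right_mono) simp
    then show "(cmod (of_real (r l) * V l))\<^sup>2 \<le> P * (p l * (cmod (U j l))\<^sup>2)"
      using V[OF l] by (simp add: norm_mult power_mult_distrib mult.assoc)
  qed
  finally show ?thesis by (simp add: w_def sum_distrib_left)
qed

lemma norm_W_col_le: "U \<in> unitary_set n \<Longrightarrow> (\<Sum>b<n. (cmod (W b j U))\<^sup>2) \<le> P * w j U"
  unfolding W_def by (rule norm_col_le) (use p_nonneg in auto)

lemma norm_S_col_le: "U \<in> unitary_set n \<Longrightarrow> (\<Sum>b<n. (cmod (S b j U))\<^sup>2) \<le> P * w j U"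
  unfolding S_def by (rule norm_col_le) (use q_le_p in auto)

lemma norm_dW_le:
  assumes U: "U \<in> unitary_set n" and ij: "i < n" "j < n"
  shows "(\<Sum>a<n. \<Sum>b<n. (cmod (dW i j a b U))\<^sup>2) \<le> 2 * (P * w i U + P * w j U)"
proof -
  have "(\<Sum>a<n. \<Sum>b<n. (cmod (dW i j a b U))\<^sup>2)
     \<le> (\<Sum>a<n. \<Sum>b<n. 2 * (cmod (if i = a then W b j U else 0))\<^sup>2 + 2 * (cmod (if j = b then W i a U else 0))\<^sup>2)"
    unfolding dW_def by (intro sum_mono norm_diff_sq_le)
  also have "\<dots> = (\<Sum>a<n. if a = i then \<Sum>b<n. 2 * (cmod (W b j U))\<^sup>2 else 0)
      + (\<Sum>a<n. \<Sum>b<n. if b = j then 2 * (cmod (W i a U))\<^sup>2 else 0)"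
    unfolding sum.distrib by (intro arg_cong2[where f = "(+)"] sum.cong refl) auto
  also have "\<dots> = 2 * (\<Sum>b<n. (cmod (W b j U))\<^sup>2) + 2 * (\<Sum>a<n. (cmod (W a i U))\<^sup>2)"
    using ij by (simp add: sum_distrib_left flip: cnj_W[of i])
  also have "\<dots> \<le> 2 * (P * w i U + P * w j U)"
    using norm_W_col_le[OF U, of i] norm_W_col_le[OF U, of j] by simp
  finally show ?thesis .
qed

lemma norm_dS_le:
  assumes U: "U \<in> unitary_set n" and ij: "i < n" "j < n"
  shows "(\<Sum>a<n. \<Sum>b<n. (cmod (dS i j a b U))\<^sup>2) \<le> 2 * (P * w i U + P * w j U)"
proof -
  have "(\<Sum>a<n. \<Sum>b<n. (cmod (dS i j a b U))\<^sup>2)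
     \<le> (\<Sum>a<n. \<Sum>b<n. 2 * (cmod (if i = a then S b j U else 0))\<^sup>2 + 2 * (cmod (if j = a then S i b U else 0))\<^sup>2)"
    unfolding dS_def by (intro sum_mono norm_add_sq_le)
  also have "\<dots> = (\<Sum>a<n. if a = i then \<Sum>b<n. 2 * (cmod (S b j U))\<^sup>2 else 0)
      + (\<Sum>a<n. if a = j then \<Sum>b<n. 2 * (cmod (S b i U))\<^sup>2 else 0)"
    unfolding sum.distrib by (intro arg_cong2[where f = "(+)"] sum.cong refl) (auto simp: S_commute)
  also have "\<dots> = 2 * (\<Sum>b<n. (cmod (S b j U))\<^sup>2) + 2 * (\<Sum>b<n. (cmod (S b i U))\<^sup>2)"
    using ij by (simp add: sum_distrib_left)
  also have "\<dots> \<le> 2 * (P * w i U + P * w j U)"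
    using norm_S_col_le[OF U, of i] norm_S_col_le[OF U, of j] by simp
  finally show ?thesis .
qed

lemma dev_nonneg: "0 \<le> dev U"
  unfolding dev_def by (intro sum_nonneg) auto

text \<open>Bounding this sum by \<open>k * P\<close> would lose a factor of the squeezing in the threshold for \<open>\<epsilon>\<close>.\<close>

lemma sum_w_le: "(\<Sum>j<k. w j U) \<le> 2 * real k * lam + dev U"
proof -
  have "w j U \<le> 2 * lam + (cmod (T j j U))\<^sup>2" for j
  proof -
    have "T j j U = of_real (w j U - lam)" by (simp add: T_def W_diag)
    then have "(cmod (T j j U))\<^sup>2 = (w j U - lam)\<^sup>2" by (simp only: norm_of_real power2_abs)
    \<comment> \<open>From x \<le> 1 + x^2; the summand 1 is then absorbed by a second
      \<open>lam\<close>, as \<open>lam\<close> \<ge> 1.\<close>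
    moreover have "w j U - lam \<le> 1 + (w j U - lam)\<^sup>2"
      using sum_squares_bound[of 1 "w j U - lam"] by (simp, smt (verit) zero_le_power2)
    ultimately show ?thesis using lam_ge by linarith
  qed
  then have "(\<Sum>j<k. w j U) \<le> (\<Sum>j<k. 2 * lam + (cmod (T j j U))\<^sup>2)" by (intro sum_mono)
  also have "\<dots> = 2 * real k * lam + (\<Sum>j<k. (cmod (T j j U))\<^sup>2)" by (simp add: sum.distrib)
  also have "(\<Sum>j<k. (cmod (T j j U))\<^sup>2) \<le> dev U"
    unfolding dev_def
  proof (rule sum_mono)
    fix i assume "i \<in> {..<k}"
    then have "(cmod (T i i U))\<^sup>2 + (cmod (S i i U))\<^sup>2 \<le> (\<Sum>j<k. (cmod (T i j U))\<^sup>2 + (cmod (S i j U))\<^sup>2)"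
      by (intro member_le_sum[of i]) auto
    then show "(cmod (T i i U))\<^sup>2 \<le> (\<Sum>j<k. (cmod (T i j U))\<^sup>2 + (cmod (S i j U))\<^sup>2)"
      by (smt (verit) zero_le_power2)
  qed
  finally show ?thesis by simp
qed

lemma Gam_le:
  assumes U: "U \<in> unitary_set n"
  shows "Gam U \<le> 8 * real k * P * (2 * real k * lam + dev U)"
proof -
  have "Gam U \<le> (\<Sum>i<k. \<Sum>j<k. 4 * (P * w i U + P * w j U))"
    unfolding Gam_def
  proof (intro sum_mono)
    fix i j assume "i \<in> {..<k}" "j \<in> {..<k}"
    then have "i < n" "j < n" using k_le_n by auto
    from norm_dW_le[OF U this] norm_dS_le[OF U this]
    show "(\<Sum>a<n. \<Sum>b<n. (cmod (dW i j a b U))\<^sup>2 + (cmod (dS i j a b U))\<^sup>2) \<le> 4 * (P * w i U + P * w j U)"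
      by (simp add: sum.distrib)
  qed
  also have "\<dots> = 8 * real k * P * (\<Sum>j<k. w j U)"
    by (simp add: sum.distrib sum_distrib_left sum_distrib_right algebra_simps)
  also have "\<dots> \<le> 8 * real k * P * (2 * real k * lam + dev U)"
    using P_nonneg by (intro mult_left_mono sum_w_le) auto
  finally show ?thesis .
qed

text \<open>The \<open>n\<close> by \<open>k\<close> matrix W T* + S S*, with the inner index
  restricted to the first \<open>k\<close> modes. Its norm is at most an operator norm, of
  \<open>W\<close> or \<open>S\<close>, times a Hilbert-Schmidt norm that is part of
  \<open>dev\<close>.\<close>

definition Z :: "nat \<Rightarrow> nat \<Rightarrow> (nat \<Rightarrow> nat \<Rightarrow> complex) \<Rightarrow> complex" where
  "Z b a U = (\<Sum>j<k. W b j U * cnj (T a j U)) + (\<Sum>j<k. S b j U * cnj (S a j U))"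

text \<open>The factor 2 has two origins. For \<open>T\<close>, which is Hermitian, the two
  conjugate halves of the product rule coincide; for \<open>S\<close>, which is symmetric, both
  indices contribute equally.\<close>

lemma G_eq:
  "G a b U = 2 * (if a < k then Z b a U else 0) - 2 * (if b < k then cnj (Z a b U) else 0)"
proof -
  have sd: "(\<Sum>i<k. if i = x then f i else 0) = (if x < k then f x else 0)" for x and f :: "nat \<Rightarrow> complex"
    by (simp add: sum.delta)
  have W1: "(\<Sum>i<k. \<Sum>j<k. dW i j a b U * cnj (T i j U))
     = (if a < k then \<Sum>j<k. W b j U * cnj (T a j U) else 0)
       - (if b < k then cnj (\<Sum>j<k. W a j U * cnj (T b j U)) else 0)" for a b
  proof -
    have "(\<Sum>i<k. \<Sum>j<k. dW i j a b U * cnj (T i j U))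
      = (\<Sum>i<k. if i = a then \<Sum>j<k. W b j U * cnj (T a j U) else 0)
        - (\<Sum>i<k. \<Sum>j<k. if j = b then W i a U * cnj (T i b U) else 0)"
      unfolding dW_def left_diff_distrib sum_subtractf
      by (intro arg_cong2[where f = "(-)"] sum.cong refl) auto
    also have "\<dots> = (if a < k then \<Sum>j<k. W b j U * cnj (T a j U) else 0)
        - (if b < k then \<Sum>i<k. W i a U * cnj (T i b U) else 0)"
      unfolding sd by simp
    finally show ?thesis by (simp add: cnj_W cnj_T)
  qed
  have S1: "(\<Sum>i<k. \<Sum>j<k. dS i j a b U * cnj (S i j U))
     = 2 * (if a < k then \<Sum>j<k. S b j U * cnj (S a j U) else 0)" for a b
  proof -
    have "(\<Sum>i<k. \<Sum>j<k. dS i j a b U * cnj (S i j U))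
      = (\<Sum>i<k. if i = a then \<Sum>j<k. S b j U * cnj (S a j U) else 0)
        + (\<Sum>i<k. \<Sum>j<k. if j = a then S b i U * cnj (S a i U) else 0)"
      unfolding dS_def distrib_right sum.distrib
      by (intro arg_cong2[where f = "(+)"] sum.cong refl) (auto simp: S_commute)
    also have "\<dots> = (if a < k then \<Sum>j<k. S b j U * cnj (S a j U) else 0)
        + (if a < k then \<Sum>j<k. S b j U * cnj (S a j U) else 0)"
      unfolding sd by simp
    finally show ?thesis by simp
  qed
  have "G a b U = (\<Sum>i<k. \<Sum>j<k. dW i j a b U * cnj (T i j U))
      - cnj (\<Sum>i<k. \<Sum>j<k. dW i j b a U * cnj (T i j U))
      + (\<Sum>i<k. \<Sum>j<k. dS i j a b U * cnj (S i j U))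
      - cnj (\<Sum>i<k. \<Sum>j<k. dS i j b a U * cnj (S i j U))"
    unfolding G_def cnj_sum sum.distrib[symmetric] sum_subtractf[symmetric]
    by (intro sum.cong refl) (simp add: mult.commute)
  then show ?thesis unfolding W1 S1 Z_def by (auto simp: algebra_simps)
qed

lemma norm_Z_le:
  assumes U: "U \<in> unitary_set n"
  shows "(\<Sum>a<k. \<Sum>b<n. (cmod (Z b a U))\<^sup>2) \<le> 2 * P\<^sup>2 * dev U"
proof -
  have "(\<Sum>b<n. (cmod (Z b a U))\<^sup>2) \<le> 2 * P\<^sup>2 * (\<Sum>j<k. (cmod (T a j U))\<^sup>2 + (cmod (S a j U))\<^sup>2)" for a
  proof -
    have "(\<Sum>b<n. (cmod (Z b a U))\<^sup>2)
       \<le> (\<Sum>b<n. 2 * (cmod (\<Sum>j<k. W b j U * cnj (T a j U)))\<^sup>2 + 2 * (cmod (\<Sum>j<k. S b j U * cnj (S a j U)))\<^sup>2)"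
      unfolding Z_def by (intro sum_mono norm_add_sq_le)
    also have "\<dots> \<le> 2 * (P\<^sup>2 * (\<Sum>j<k. (cmod (T a j U))\<^sup>2)) + 2 * (P\<^sup>2 * (\<Sum>j<k. (cmod (S a j U))\<^sup>2))"
      using norm_W_le[OF U, of "\<lambda>j. cnj (T a j U)"] norm_S_le[OF U, of "\<lambda>j. cnj (S a j U)"]
      by (simp add: sum.distrib sum_distrib_left[symmetric])
    finally show ?thesis by (simp add: sum.distrib algebra_simps)
  qed
  then have "(\<Sum>a<k. \<Sum>b<n. (cmod (Z b a U))\<^sup>2)
     \<le> (\<Sum>a<k. 2 * P\<^sup>2 * (\<Sum>j<k. (cmod (T a j U))\<^sup>2 + (cmod (S a j U))\<^sup>2))" by (intro sum_mono)
  then show ?thesis unfolding dev_def by (simp only: sum_distrib_left)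
qed

lemma norm_G_le:
  assumes U: "U \<in> unitary_set n"
  shows "(\<Sum>a<n. \<Sum>b<n. (cmod (G a b U))\<^sup>2) \<le> 32 * P\<^sup>2 * dev U"
proof -
  have restrict: "(\<Sum>a<n. if a < k then f a else 0) = (\<Sum>a<k. f a)" for f :: "nat \<Rightarrow> real"
  proof -
    have "{..<n} \<inter> {a. a < k} = {..<k}" using k_le_n by auto
    then show ?thesis by (simp add: sum.If_cases)
  qed
  let ?N = "\<Sum>a<k. \<Sum>b<n. (cmod (Z b a U))\<^sup>2"
  have "(\<Sum>a<n. \<Sum>b<n. (cmod (G a b U))\<^sup>2) \<le> (\<Sum>a<n. \<Sum>b<n.
      8 * (if a < k then (cmod (Z b a U))\<^sup>2 else 0) + 8 * (if b < k then (cmod (Z a b U))\<^sup>2 else 0))"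
  proof (intro sum_mono)
    fix a b
    show "(cmod (G a b U))\<^sup>2 \<le> 8 * (if a < k then (cmod (Z b a U))\<^sup>2 else 0) + 8 * (if b < k then (cmod (Z a b U))\<^sup>2 else 0)"
      unfolding G_eq
      using norm_diff_sq_le[of "2 * (if a < k then Z b a U else 0)" "2 * (if b < k then cnj (Z a b U) else 0)"]
      by (auto simp: norm_mult power_mult_distrib)
  qed
  also have "\<dots> = 8 * (\<Sum>a<n. if a < k then \<Sum>b<n. (cmod (Z b a U))\<^sup>2 else 0)
      + 8 * (\<Sum>b<n. \<Sum>a<n. if b < k then (cmod (Z a b U))\<^sup>2 else 0)"
  proof -
    have "(\<Sum>a<n. \<Sum>b<n. 8 * (if b < k then (cmod (Z a b U))\<^sup>2 else 0))
        = 8 * (\<Sum>b<n. \<Sum>a<n. if b < k then (cmod (Z a b U))\<^sup>2 else 0)"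
      unfolding sum_distrib_left by (rule sum.swap)
    moreover have "(\<Sum>a<n. \<Sum>b<n. 8 * (if a < k then (cmod (Z b a U))\<^sup>2 else 0))
        = 8 * (\<Sum>a<n. if a < k then \<Sum>b<n. (cmod (Z b a U))\<^sup>2 else 0)"
      unfolding sum_distrib_left by (intro sum.cong refl) (simp add: sum_distrib_left)
    ultimately show ?thesis by (simp add: sum.distrib)
  qed
  also have "(\<Sum>b<n. \<Sum>a<n. if b < k then (cmod (Z a b U))\<^sup>2 else 0)
     = (\<Sum>b<n. if b < k then \<Sum>a<n. (cmod (Z a b U))\<^sup>2 else 0)"
    by (intro sum.cong refl) simp
  finally have "(\<Sum>a<n. \<Sum>b<n. (cmod (G a b U))\<^sup>2) \<le> 16 * ?N"
    unfolding restrict by simp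
  with norm_Z_le[OF U] show ?thesis by simp
qed

section \<open>The moment generating function and the tail of \<open>dev\<close>\<close>

lemma tame_cdev: "tame n cdev"
  by (rule has_grad_tame[OF has_grad_cdev])

lemma tame_G: "a < n \<Longrightarrow> b < n \<Longrightarrow> tame n (G a b)"
  by (rule has_grad_tame_grad[OF has_grad_cdev])

lemma tame_H: "c < n \<Longrightarrow> d < n \<Longrightarrow> a < n \<Longrightarrow> b < n \<Longrightarrow> tame n (H c d a b)"
  by (rule has_grad_tame_grad[OF has_grad_G])

lemma dev_measurable [measurable]: "dev \<in> borel_measurable borel"
proof -
  note [measurable] = tame_measurable[OF tame_cdev]
  have "(\<lambda>U. Re (cdev U)) \<in> borel_measurable borel" by measurable
  then show ?thesis by (simp add: cdev_eq)
qed

lemma exp_cdev: "exp (of_real s * cdev U) = of_real (exp (s * dev U))"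
  by (simp add: cdev_eq exp_of_real[symmetric])

lemma integrable_exp_dev:
  assumes "haar_measure n \<mu>" shows "integrable \<mu> (\<lambda>U. exp (s * dev U))"
proof -
  have "tame n (\<lambda>U. exp (of_real s * cdev U))" using tame_cdev by auto
  from integrable_Re[OF tame_integrable[OF assms this]] show ?thesis
    unfolding exp_cdev by simp
qed

lemma integrable_dev_exp_dev:
  assumes "haar_measure n \<mu>" shows "integrable \<mu> (\<lambda>U. dev U * exp (s * dev U))"
proof -
  have "tame n (\<lambda>U. cdev U * exp (of_real s * cdev U))" using tame_cdev by auto
  from integrable_Re[OF tame_integrable[OF assms this]] show ?thesis
    unfolding exp_cdev by (simp add: cdev_eq)
qed

text \<open>The sum over \<open>a\<close> and \<open>b\<close> of the \<open>(a, b)\<close> derivative of \<open>G b a * exp (s * dev)\<close>, on unitary matrices.\<close>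

definition Lexp :: "real \<Rightarrow> (nat \<Rightarrow> nat \<Rightarrow> complex) \<Rightarrow> real" where
  "Lexp s U = (4 * real n * dev U + 4 * (\<Sum>i<k. \<Sum>j<k. (cmod (S i j U))\<^sup>2) - 2 * Gam U
     - s * (\<Sum>a<n. \<Sum>b<n. (cmod (G a b U))\<^sup>2)) * exp (s * dev U)"

lemma integral_Lexp:
  assumes haar: "haar_measure n \<mu>"
  shows "integrable \<mu> (Lexp s)" "(\<integral>U. Lexp s U \<partial>\<mu>) = 0"
proof -
  define F where "F a b U = H b a a b U * exp (of_real s * cdev U) +
      G b a U * (of_real s * G a b U * exp (of_real s * cdev U))" for a b U
  have tameF: "tame n (F a b)" if "a < n" "b < n" for a b
    unfolding F_def using that tame_H tame_G tame_cdev by auto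
  have intF: "(\<integral>U. F a b U \<partial>\<mu>) = 0" if "a < n" "b < n" for a b
  proof -
    have "has_grad n (\<lambda>U. G b a U * exp (of_real s * cdev U))
      (\<lambda>a' b' U. H b a a' b' U * exp (of_real s * cdev U) +
        G b a U * (of_real s * G a' b' U * exp (of_real s * cdev U)))"
      using that by (intro has_grad_mult has_grad_exp has_grad_cmult has_grad_cdev has_grad_G)
    from integral_grad_zero[OF haar this that] show ?thesis by (simp add: F_def)
  qed
  have tame_sumF: "tame n (\<lambda>U. \<Sum>a<n. \<Sum>b<n. F a b U)"
    using tameF by auto
  have int_sumF: "(\<integral>U. (\<Sum>a<n. \<Sum>b<n. F a b U) \<partial>\<mu>) = 0"
  proof -
    have "(\<integral>U. (\<Sum>a<n. \<Sum>b<n. F a b U) \<partial>\<mu>) = (\<Sum>a<n. \<integral>U. (\<Sum>b<n. F a b U) \<partial>\<mu>)"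
      by (intro Bochner_Integration.integral_sum tame_integrable[OF haar] tame_sum tameF) auto
    also have "\<dots> = (\<Sum>a<n. \<Sum>b<n. \<integral>U. F a b U \<partial>\<mu>)"
      by (intro sum.cong refl Bochner_Integration.integral_sum tame_integrable[OF haar] tameF) auto
    finally show ?thesis by (simp add: intF)
  qed
  have eq: "(\<Sum>a<n. \<Sum>b<n. F a b U) = of_real (Lexp s U)" if U: "U \<in> unitary_set n" for U
  proof -
    have G: "G b a U * (of_real s * G a b U * e) = - (of_real s * of_real ((cmod (G a b U))\<^sup>2) * e)" for a b e
      unfolding complex_norm_square cnj_G by (simp add: mult_ac)
    have "(\<Sum>a<n. \<Sum>b<n. F a b U) = ((\<Sum>a<n. \<Sum>b<n. H b a a b U)
        - of_real s * of_real (\<Sum>a<n. \<Sum>b<n. (cmod (G a b U))\<^sup>2)) * exp (of_real s * cdev U)"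
      unfolding F_def G of_real_sum sum_distrib_left sum_distrib_right left_diff_distrib sum_subtractf[symmetric]
      by (intro sum.cong refl) simp
    then show ?thesis unfolding laplace_dev[OF U] exp_cdev by (simp add: Lexp_def)
  qed
  \<comment> \<open>\<open>laplace_dev\<close> uses unitarity, so the two integrands agree only
    almost everywhere, and the measurability of \<open>Lexp\<close> has to be shown
    separately.\<close>
  have AE: "AE U in \<mu>. Re (\<Sum>a<n. \<Sum>b<n. F a b U) = Lexp s U"
    using haar_AE_unitary[OF haar] by eventually_elim (simp only: eq Re_complex_of_real)
  have [measurable]: "Gam \<in> borel_measurable borel"
  proof -
    show ?thesis unfolding Gam_def[abs_def] using k_le_n
      by (intro borel_measurable_sum borel_measurable_add tame_norm_sq_measurable[of n]
          has_grad_tame[OF has_grad_dW] has_grad_tame[OF has_grad_dS])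
        auto
  qed
  have [measurable]: "Lexp s \<in> borel_measurable borel"
  proof -
    have "(\<lambda>U. \<Sum>i<k. \<Sum>j<k. (cmod (S i j U))\<^sup>2) \<in> borel_measurable borel"
      using k_le_n by (intro borel_measurable_sum tame_norm_sq_measurable[of n]
          has_grad_tame[OF has_grad_S]) auto
    moreover have "(\<lambda>U. \<Sum>a<n. \<Sum>b<n. (cmod (G a b U))\<^sup>2) \<in> borel_measurable borel"
      by (intro borel_measurable_sum tame_norm_sq_measurable[of n] tame_G) auto
    ultimately show ?thesis unfolding Lexp_def[abs_def] by measurable
  qed
  have mu: "Lexp s \<in> borel_measurable \<mu>" by (rule haar_measurable[OF haar]) measurable
  have int: "integrable \<mu> (\<lambda>U. Re (\<Sum>a<n. \<Sum>b<n. F a b U))"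
    by (intro integrable_Re tame_integrable[OF haar tame_sumF])
  show "integrable \<mu> (Lexp s)"
    by (rule integrable_cong_AE_imp[OF int mu]) (use AE in auto)
  have "(\<integral>U. Lexp s U \<partial>\<mu>) = (\<integral>U. Re (\<Sum>a<n. \<Sum>b<n. F a b U) \<partial>\<mu>)"
    by (rule integral_cong_AE[OF mu borel_measurable_integrable[OF int]]) (use AE in auto)
  also have "\<dots> = Re (\<integral>U. (\<Sum>a<n. \<Sum>b<n. F a b U) \<partial>\<mu>)"
    by (rule integral_Re[OF tame_integrable[OF haar tame_sumF]])
  finally show "(\<integral>U. Lexp s U \<partial>\<mu>) = 0" by (simp add: int_sumF)
qed

text \<open>The bound on the mean of \<open>dev\<close> that \<open>exp_moment_derivative_le\<close>
  gives for s = 0.\<close>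

definition A :: real where "A = 16 * (real k)\<^sup>2 * P * lam / real n"

lemma A_nonneg: "0 \<le> A"
  using P_nonneg lam_ge by (simp add: A_def)

text \<open>The Laplacian offers \<open>4 * n * dev\<close>. One \<open>n * dev\<close> pays for the
  part of \<open>Gam\<close> proportional to \<open>dev\<close>, by \<open>kP\<close>, and another
  for the gradient term, by the bound on \<open>s\<close>. The remaining \<open>2 * n * dev\<close>
  stands against the constant part of \<open>Gam\<close>, which is \<open>2 * n * A\<close>.\<close>

lemma exp_moment_derivative_le:
  assumes haar: "haar_measure n \<mu>" and kP: "16 * real k * P \<le> real n"
    and s: "0 \<le> s" "32 * s * P\<^sup>2 \<le> real n"
  shows "(\<integral>U. dev U * exp (s * dev U) \<partial>\<mu>) \<le> A * (\<integral>U. exp (s * dev U) \<partial>\<mu>)"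
proof -
  have le: "(2 * real n * dev U - 2 * real n * A) * exp (s * dev U) \<le> Lexp s U"
    if U: "U \<in> unitary_set n" for U
    unfolding Lexp_def
  proof (rule mult_right_mono)
    have "2 * Gam U \<le> 16 * real k * P * (2 * real k * lam) + 16 * real k * P * dev U"
      using Gam_le[OF U] by (simp add: algebra_simps)
    also have "16 * real k * P * dev U \<le> real n * dev U"
      by (intro mult_right_mono kP dev_nonneg)
    also have "16 * real k * P * (2 * real k * lam) = 2 * real n * A"
      using n_pos by (simp add: A_def power2_eq_square)
    finally have 1: "2 * Gam U \<le> 2 * real n * A + real n * dev U" by simp
    have "s * (\<Sum>a<n. \<Sum>b<n. (cmod (G a b U))\<^sup>2) \<le> s * (32 * P\<^sup>2 * dev U)"
      by (intro mult_left_mono norm_G_le U s)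
    also have "\<dots> = (32 * s * P\<^sup>2) * dev U" by simp
    also have "\<dots> \<le> real n * dev U"
      by (intro mult_right_mono s dev_nonneg)
    finally have 2: "s * (\<Sum>a<n. \<Sum>b<n. (cmod (G a b U))\<^sup>2) \<le> real n * dev U" .
    have "0 \<le> (\<Sum>i<k. \<Sum>j<k. (cmod (S i j U))\<^sup>2)" by (intro sum_nonneg) auto
    with 1 2 show "2 * real n * dev U - 2 * real n * A \<le> 4 * real n * dev U
        + 4 * (\<Sum>i<k. \<Sum>j<k. (cmod (S i j U))\<^sup>2) - 2 * Gam U - s * (\<Sum>a<n. \<Sum>b<n. (cmod (G a b U))\<^sup>2)"
      by linarith
  qed simp
  have eq: "(2 * real n * dev U - 2 * real n * A) * exp (s * dev U)
      = 2 * real n * (dev U * exp (s * dev U)) - 2 * real n * A * exp (s * dev U)" for U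
    by (simp add: algebra_simps)
  note int = integrable_dev_exp_dev[OF haar, of s] integrable_exp_dev[OF haar, of s]
  have "(\<integral>U. 2 * real n * (dev U * exp (s * dev U)) - 2 * real n * A * exp (s * dev U) \<partial>\<mu>)
      \<le> (\<integral>U. Lexp s U \<partial>\<mu>)"
  proof (rule integral_mono_AE)
    show "AE U in \<mu>. 2 * real n * (dev U * exp (s * dev U)) - 2 * real n * A * exp (s * dev U) \<le> Lexp s U"
      using haar_AE_unitary[OF haar] unfolding eq[symmetric] by eventually_elim (rule le)
  qed (use int integral_Lexp(1)[OF haar] in auto)
  then have "2 * real n * (\<integral>U. dev U * exp (s * dev U) \<partial>\<mu>) - 2 * real n * A * (\<integral>U. exp (s * dev U) \<partial>\<mu>) \<le> 0"
    using int integral_Lexp(2)[OF haar] by simp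
  then have "2 * real n * ((\<integral>U. dev U * exp (s * dev U) \<partial>\<mu>) - A * (\<integral>U. exp (s * dev U) \<partial>\<mu>)) \<le> 0"
    by (simp add: algebra_simps)
  then show ?thesis using n_pos by (simp add: mult_le_0_iff)
qed

text \<open>A Gronwall argument for \<open>s \<mapsto> E exp (s * dev)\<close>, in finite steps to avoid differentiating under the integral.\<close>

lemma exp_moment_le:
  assumes haar: "haar_measure n \<mu>" and kP: "16 * real k * P \<le> real n"
    and s: "0 \<le> s" "32 * s * P\<^sup>2 \<le> real n"
  shows "(\<integral>U. exp (s * dev U) \<partial>\<mu>) \<le> exp (2 * A * s)"
proof -
  interpret prob_space \<mu> by (rule haar_prob_space[OF haar])
  define h where "h s = (\<integral>U. exp (s * dev U) \<partial>\<mu>)" for s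
  \<comment> \<open>With this many steps x = \<open>A * d\<close> is at most 1/2, as needed for 1
    \<le> (1 + 2 x) (1 - x). That inequality is where the factor 2 in the exponent comes
    from.\<close>
  obtain N :: nat where N: "2 * A * s < real N" using reals_Archimedean2 by blast
  moreover have "0 \<le> 2 * A * s" using A_nonneg s(1) by simp
  ultimately have Npos: "N > 0" by (cases N) auto
  define d where "d = s / real N"
  have d0: "0 \<le> d" using s(1) by (simp add: d_def)
  have Ad: "2 * (A * d) \<le> 1" using N Npos by (simp add: d_def field_simps)
  have Ad0: "0 \<le> A * d" using A_nonneg d0 by simp
  \<comment> \<open>Convexity: exp (- y) \<ge> 1 - y with y = \<open>d * dev\<close> compares
    \<open>h (r - d)\<close> with the tangent of \<open>h\<close> at \<open>r\<close>, whose slope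
    is at most \<open>A * h r\<close>. The step goes backwards because the tangent is taken at the
    right end.\<close>
  have step: "h r * (1 - A * d) \<le> h (r - d)" if r: "0 \<le> r" "r \<le> s" for r
  proof -
    have "32 * r * P\<^sup>2 \<le> 32 * s * P\<^sup>2" using r by (intro mult_right_mono) auto
    then have le: "(\<integral>U. dev U * exp (r * dev U) \<partial>\<mu>) \<le> A * h r"
      unfolding h_def using r s by (intro exp_moment_derivative_le[OF haar kP]) auto
    note int = integrable_dev_exp_dev[OF haar, of r] integrable_exp_dev[OF haar]
    have "h r - d * (\<integral>U. dev U * exp (r * dev U) \<partial>\<mu>)
        = (\<integral>U. exp (r * dev U) - d * (dev U * exp (r * dev U)) \<partial>\<mu>)"
      using int by (simp add: h_def)
    also have "\<dots> \<le> h (r - d)"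
      unfolding h_def
    proof (rule integral_mono)
      fix U
      have "(1 - d * dev U) * exp (r * dev U) \<le> exp (- d * dev U) * exp (r * dev U)"
        using exp_ge_add_one_self[of "- d * dev U"] by (intro mult_right_mono) auto
      also have "\<dots> = exp ((r - d) * dev U)"
        by (simp add: exp_add[symmetric] algebra_simps)
      finally show "exp (r * dev U) - d * (dev U * exp (r * dev U)) \<le> exp ((r - d) * dev U)"
        by (simp add: algebra_simps)
    qed (use int in auto)
    finally have "h r - d * (\<integral>U. dev U * exp (r * dev U) \<partial>\<mu>) \<le> h (r - d)" .
    with mult_left_mono[OF le d0] show ?thesis by (simp add: algebra_simps)
  qed
  have "h (real m * d) \<le> exp (2 * A * (real m * d))" if "m \<le> N" for m
    using that
  proof (induction m)
    case 0
    show ?case by (simp add: h_def prob_space)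
  next
    case (Suc m)
    have "real (Suc m) * d \<le> real N * d" using Suc.prems d0 by (intro mult_right_mono) auto
    then have "h (real (Suc m) * d) * (1 - A * d) \<le> h (real (Suc m) * d - d)"
      using d0 Npos by (intro step mult_nonneg_nonneg) (auto simp: d_def)
    also have "real (Suc m) * d - d = real m * d" by (simp add: algebra_simps)
    also have "h (real m * d) \<le> exp (2 * A * (real m * d))" using Suc by simp
    also have "\<dots> \<le> exp (2 * A * (real m * d)) * (exp (2 * (A * d)) * (1 - A * d))"
    proof -
      have "1 \<le> (1 + 2 * (A * d)) * (1 - A * d)"
      proof -
        have "(1 + 2 * (A * d)) * (1 - A * d) = 1 + (A * d) * (1 - 2 * (A * d))" by (simp add: algebra_simps)
        then show ?thesis using Ad Ad0 by simp
      qed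
      also have "\<dots> \<le> exp (2 * (A * d)) * (1 - A * d)"
        using Ad Ad0 by (intro mult_right_mono exp_ge_add_one_self) auto
      finally show ?thesis by simp
    qed
    also have "\<dots> = exp (2 * A * (real (Suc m) * d)) * (1 - A * d)"
      by (simp add: algebra_simps exp_add)
    finally show ?case using Ad Ad0 by simp
  qed
  from this[of N] show ?thesis using Npos by (simp add: d_def h_def)
qed

theorem dev_tail:
  assumes haar: "haar_measure n \<mu>" and kP: "16 * real k * P \<le> real n" and P: "P > 0"
    and t: "4 * A \<le> t"
  shows "measure \<mu> {U. t < dev U} \<le> exp (- (real n * t / (64 * P\<^sup>2)))"
proof -
  interpret prob_space \<mu> by (rule haar_prob_space[OF haar])
  \<comment> \<open>The largest \<open>s\<close> that \<open>exp_moment_le\<close> admits. The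
    assumption \<open>4 * A \<le> t\<close> lets \<open>t - 2 * A\<close> be replaced by
    \<open>t / 2\<close> below.\<close>
  define s where "s = real n / (32 * P\<^sup>2)"
  have s0: "0 \<le> s" by (simp add: s_def)
  have sP: "32 * s * P\<^sup>2 \<le> real n" using P by (simp add: s_def)
  have sets: "{U. t < dev U} \<in> sets \<mu>"
    using haar_sets[OF haar] by measurable
  have "measure \<mu> {U. t < dev U} = (\<integral>U. indicator {U. t < dev U} U \<partial>\<mu>)"
    using sets haar_space[OF haar] by simp
  also have "\<dots> \<le> (\<integral>U. exp (- (s * t)) * exp (s * dev U) \<partial>\<mu>)"
  proof (rule integral_mono)
    show "integrable \<mu> (indicat_real {U. t < dev U})" using sets by (simp add: emeasure_eq_measure)
    show "integrable \<mu> (\<lambda>U. exp (- (s * t)) * exp (s * dev U))"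
      using integrable_exp_dev[OF haar] by simp
    fix U
    show "indicat_real {U. t < dev U} U \<le> exp (- (s * t)) * exp (s * dev U)"
      using s0 by (auto simp: indicator_def exp_add[symmetric] mult_left_mono)
  qed
  also have "\<dots> = exp (- (s * t)) * (\<integral>U. exp (s * dev U) \<partial>\<mu>)" by simp
  also have "\<dots> \<le> exp (- (s * t)) * exp (2 * A * s)"
    by (intro mult_left_mono exp_moment_le[OF haar kP s0 sP]) auto
  also have "\<dots> = exp (- s * (t - 2 * A))" by (simp add: exp_add[symmetric] algebra_simps)
  also have "\<dots> \<le> exp (- s * (t / 2))"
    using mult_left_mono[of "t / 2" "t - 2 * A" s] t s0 by simp
  also have "- s * (t / 2) = - (real n * t / (64 * P\<^sup>2))" by (simp add: s_def)
  finally show ?thesis .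
qed

end

section \<open>Symplectic eigenvalues\<close>

lemma char_poly_mat_eq: "char_poly_mat m A = char_poly (mat m m (\<lambda>(i, j). A i j))"
proof -
  have "(if i = j then [:0, 1:] else 0) - [:A i j:] =
      char_poly_matrix (mat m m (\<lambda>(i, j). A i j)) $$ (i, j)" if "i < m" "j < m" for i j
    using that by (auto simp: char_poly_matrix_def)
  then show ?thesis
    unfolding char_poly_mat_def det_mat_def char_poly_def det_def
    by (auto simp: char_poly_matrix_def lessThan_atLeast0 permutes_in_image
        intro!: sum.cong prod.cong arg_cong2[where f = "(*)"])
qed

lemma upper_triangular_mult:
  fixes X Y :: "'a :: comm_ring_1 mat"
  assumes X: "X \<in> carrier_mat m m" "upper_triangular X" and Y: "Y \<in> carrier_mat m m" "upper_triangular Y"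
  shows "upper_triangular (X * Y)" and "i < m \<Longrightarrow> (X * Y) $$ (i, i) = X $$ (i, i) * Y $$ (i, i)"
proof -
  have entry: "(X * Y) $$ (i, j) = (\<Sum>l<m. X $$ (i, l) * Y $$ (l, j))" if "i < m" "j < m" for i j
    using that X(1) Y(1) by (simp add: scalar_prod_def lessThan_atLeast0)
  have X0: "X $$ (i, l) = 0" if "l < i" "i < m" for i l using that X by auto
  have Y0: "Y $$ (i, l) = 0" if "l < i" "i < m" for i l using that Y by auto
  show "upper_triangular (X * Y)"
  proof
    fix i j assume ij: "j < i" "i < dim_row (X * Y)"
    then have "i < m" "j < m" using X(1) by auto
    then show "(X * Y) $$ (i, j) = 0" unfolding entry[OF \<open>i < m\<close> \<open>j < m\<close>]
      using ij X0 Y0 by (intro sum.neutral ballI) (metis lessThan_iff linorder_not_less mult_zero_left mult_zero_right order_le_less_trans)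
  qed
  assume i: "i < m"
  have "(\<Sum>l<m. X $$ (i, l) * Y $$ (l, i)) = (\<Sum>l\<in>{i}. X $$ (i, l) * Y $$ (l, i))"
    using i X0 Y0 by (intro sum.mono_neutral_right)
      (auto, metis linorder_neqE_nat mult_zero_left mult_zero_right)
  then show "(X * Y) $$ (i, i) = X $$ (i, i) * Y $$ (i, i)" unfolding entry[OF i i] by simp
qed

lemma trace_mult_commute:
  fixes X Y :: "'a :: comm_ring_1 mat"
  assumes "X \<in> carrier_mat m m" "Y \<in> carrier_mat m m"
  shows "(\<Sum>i<m. (X * Y) $$ (i, i)) = (\<Sum>i<m. (Y * X) $$ (i, i))"
proof -
  have "(\<Sum>i<m. (X * Y) $$ (i, i)) = (\<Sum>i<m. \<Sum>l<m. X $$ (i, l) * Y $$ (l, i))"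
    using assms by (simp add: scalar_prod_def lessThan_atLeast0)
  also have "\<dots> = (\<Sum>l<m. \<Sum>i<m. Y $$ (l, i) * X $$ (i, l))"
    by (subst sum.swap) (simp add: mult.commute)
  also have "\<dots> = (\<Sum>i<m. (Y * X) $$ (i, i))"
    using assms by (simp add: scalar_prod_def lessThan_atLeast0)
  finally show ?thesis .
qed

text \<open>The matrix need not be normal. In the Schur form it is similar to a triangular matrix
  with the eigenvalues on the diagonal; polynomials act on that diagonal entrywise, and the trace is
  invariant under similarity.\<close>

lemma trace_shifted_square:
  fixes A :: "complex mat"
  assumes A: "A \<in> carrier_mat m m" and cp: "char_poly A = (\<Prod>e\<leftarrow>es. [:- e, 1:])"
  shows "(\<Sum>i<m. ((A * A + c \<cdot>\<^sub>m 1\<^sub>m m) * (A * A + c \<cdot>\<^sub>m 1\<^sub>m m)) $$ (i, i)) = (\<Sum>e\<leftarrow>es. (e\<^sup>2 + c)\<^sup>2)"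
proof -
  obtain B R Q where schur: "schur_decomposition A es = (B, R, Q)"
    by (cases "schur_decomposition A es") auto
  from schur_decomposition[OF A cp schur]
  have wit: "similar_mat_wit A B R Q" and ut: "upper_triangular B" and diag: "diag_mat B = es" by auto
  from similar_mat_witD2[OF A wit]
  have RQ: "R * Q = 1\<^sub>m m" "Q * R = 1\<^sub>m m" and AB: "A = R * B * Q"
    and carr: "B \<in> carrier_mat m m" "R \<in> carrier_mat m m" "Q \<in> carrier_mat m m" by auto
  define C where "C = B * B + c \<cdot>\<^sub>m 1\<^sub>m m"
  have C: "C \<in> carrier_mat m m" using carr by (simp add: C_def)
  have conj_mult: "(R * X * Q) * (R * Y * Q) = R * (X * Y) * Q"
    if X: "X \<in> carrier_mat m m" and Y: "Y \<in> carrier_mat m m" for X Y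
  proof -
    have "(R * X * Q) * (R * Y * Q) = R * X * (Q * R) * (Y * Q)"
      using carr X Y by (simp add: assoc_mult_mat[of _ m m _ m _ m])
    also have "\<dots> = R * X * (Y * Q)" using carr X Y RQ by simp
    also have "\<dots> = R * (X * Y) * Q"
      using carr X Y by (simp add: assoc_mult_mat[of _ m m _ m _ m])
    finally show ?thesis .
  qed
  have "R * C * Q = R * (B * B) * Q + R * (c \<cdot>\<^sub>m 1\<^sub>m m) * Q"
  proof -
    have "R * C = R * (B * B) + R * (c \<cdot>\<^sub>m 1\<^sub>m m)"
      unfolding C_def by (rule mult_add_distrib_mat) (use carr in auto)
    then show ?thesis using carr by (simp add: add_mult_distrib_mat[of _ m m])
  qed
  also have "R * (c \<cdot>\<^sub>m 1\<^sub>m m) * Q = c \<cdot>\<^sub>m 1\<^sub>m m"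
    using carr RQ by (simp add: mult_smult_distrib[of R m m "1\<^sub>m m" m] mult_smult_assoc_mat[of R m m Q m])
  finally have "A * A + c \<cdot>\<^sub>m 1\<^sub>m m = R * C * Q"
    using conj_mult[OF carr(1) carr(1)] by (simp add: AB)
  then have "(\<Sum>i<m. ((A * A + c \<cdot>\<^sub>m 1\<^sub>m m) * (A * A + c \<cdot>\<^sub>m 1\<^sub>m m)) $$ (i, i)) = (\<Sum>i<m. (R * (C * C) * Q) $$ (i, i))"
    by (simp add: conj_mult[OF C C])
  also have "\<dots> = (\<Sum>i<m. (Q * (R * (C * C))) $$ (i, i))"
    by (rule trace_mult_commute) (use carr C in auto)
  also have "Q * (R * (C * C)) = C * C"
    using carr C RQ by (simp add: assoc_mult_mat[of Q m m R m "C * C" m, symmetric])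
  also have "(\<Sum>i<m. (C * C) $$ (i, i)) = (\<Sum>i<m. ((B $$ (i, i))\<^sup>2 + c)\<^sup>2)"
  proof (rule sum.cong[OF refl])
    fix i assume "i \<in> {..<m}"
    then have i: "i < m" by simp
    note BB = upper_triangular_mult[OF carr(1) ut carr(1) ut]
    have utC: "upper_triangular C"
      using BB(1) carr(1) unfolding C_def upper_triangular_def by auto
    have "C $$ (i, i) = (B $$ (i, i))\<^sup>2 + c"
      using i BB(2)[OF i] carr(1) by (simp add: C_def power2_eq_square del: index_mult_mat(1))
    then show "(C * C) $$ (i, i) = ((B $$ (i, i))\<^sup>2 + c)\<^sup>2"
      unfolding upper_triangular_mult(2)[OF C utC C utC i] by (simp add: power2_eq_square)
  qed
  also have "\<dots> = (\<Sum>e\<leftarrow>es. (e\<^sup>2 + c)\<^sup>2)"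
    unfolding diag[symmetric] diag_mat_def using carr(1)
    by (simp add: sum_list_sum_nth lessThan_atLeast0)
  finally show ?thesis .
qed

section \<open>Existence and uniqueness of the symplectic eigenvalues\<close>

lemma proots_prod_linear: "proots (\<Prod>a\<in>#X. [:- a, 1:]) = (X :: complex multiset)"
proof (induction X)
  case (add x X)
  have "(\<Prod>a\<in>#X. [:- a, 1:]) \<noteq> 0" by (auto simp: prod_mset_zero_iff)
  then show ?case using add by (simp add: proots_mult del: mult_pCons_left)
qed auto

lemma symp_prod_eq:
  fixes L :: "real multiset"
  shows "(\<Prod>l\<in>#L. [:- (\<i> * complex_of_real l), 1:] * [:\<i> * complex_of_real l, 1:])
    = (\<Prod>a\<in>#image_mset (\<lambda>l. \<i> * of_real l) L + image_mset (\<lambda>l. - (\<i> * of_real l)) L. [:- a, 1:])"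
  by (simp add: prod_mset.distrib image_mset.compositionality o_def
      del: mult_pCons_left mult_pCons_right)

text \<open>As all members are at least 1, they are recovered, with multiplicity, as the imaginary
  parts of those roots of the characteristic polynomial that lie in the upper half plane. This gives
  the definite description in \<open>symp_eigs\<close> its meaning.\<close>

lemma is_symp_eigs_unique:
  assumes "is_symp_eigs k M L" "is_symp_eigs k M L'"
  shows "L = L'"
proof -
  have *: "image_mset Im (filter_mset (\<lambda>a. Im a > 0)
        (image_mset (\<lambda>l. \<i> * complex_of_real l) L + image_mset (\<lambda>l. - (\<i> * complex_of_real l)) L)) = L"
    if "\<forall>l\<in>#L. 1 \<le> l" for L
    using that by (induction L) auto
  have eq: "image_mset (\<lambda>l. \<i> * complex_of_real l) L + image_mset (\<lambda>l. - (\<i> * complex_of_real l)) L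
     = image_mset (\<lambda>l. \<i> * complex_of_real l) L' + image_mset (\<lambda>l. - (\<i> * complex_of_real l)) L'"
    using assms unfolding is_symp_eigs_def symp_prod_eq by (metis proots_prod_linear)
  have L: "\<forall>l\<in>#L. 1 \<le> l" "\<forall>l\<in>#L'. 1 \<le> l" using assms by (auto simp: is_symp_eigs_def)
  from *[OF L(1)] show ?thesis unfolding eq *[OF L(2)] by simp
qed

lemma symp_eigs_eq: "is_symp_eigs k M L \<Longrightarrow> symp_eigs k M = L"
  unfolding symp_eigs_def by (rule the_equality) (auto dest: is_symp_eigs_unique)

lemma sum_block: "(\<Sum>i<2 * k. f i) = (\<Sum>i<k. f i) + (\<Sum>i<k. f (k + i :: nat) :: 'a :: comm_monoid_add)"
proof -
  have "(\<Sum>i<2 * k. f i) = (\<Sum>i<k. f i) + (\<Sum>i=k..<2*k. f i)"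
    using sum.atLeastLessThan_concat[of 0 k "2 * k" f] by (simp add: lessThan_atLeast0)
  also have "(\<Sum>i=k..<2*k. f i) = (\<Sum>i<k. f (k + i))"
    using sum.shift_bounds_nat_ivl[of f 0 k k] by (simp add: lessThan_atLeast0 mult_2 add.commute)
  finally show ?thesis .
qed

lemma J_mult_entry:
  assumes "i < k" "j < 2 * k"
  shows "matmul (2 * k) (J_mat k) M i j = - M (k + i) j" "matmul (2 * k) (J_mat k) M (k + i) j = M i j"
proof -
  have "(\<Sum>l<2*k. J_mat k i l * M l j) = (\<Sum>l<2*k. if l = k + i then - M l j else 0)"
    using assms by (intro sum.cong) (auto simp: J_mat_def)
  then show "matmul (2 * k) (J_mat k) M i j = - M (k + i) j" using assms by (simp add: matmul_def)
  have "(\<Sum>l<2*k. J_mat k (k + i) l * M l j) = (\<Sum>l<2*k. if l = i then M l j else 0)"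
    using assms by (intro sum.cong) (auto simp: J_mat_def)
  then show "matmul (2 * k) (J_mat k) M (k + i) j = M i j" using assms by (simp add: matmul_def)
qed

text \<open>The value v* (i J) v of the Hermitian form i J.\<close>

definition tau :: "nat \<Rightarrow> (nat \<Rightarrow> complex) \<Rightarrow> real" where
  "tau k v = 2 * Im (\<Sum>i<k. cnj (v i) * v (k + i))"

text \<open>The uncertainty relation \<open>M \<ge> \<plusminus>i J\<close> together with \<open>M > 0\<close>.\<close>

definition uncertainty :: "nat \<Rightarrow> (nat \<Rightarrow> nat \<Rightarrow> real) \<Rightarrow> bool" where
  "uncertainty k M \<longleftrightarrow> (\<forall>v. (\<exists>i<2*k. v i \<noteq> 0) \<longrightarrow> (\<exists>Q>0. \<bar>tau k v\<bar> \<le> Q \<and>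
     (\<Sum>i<2*k. \<Sum>j<2*k. cnj (v i) * of_real (M i j) * v j) = of_real Q))"

text \<open>If J M v = e v, then M v = - e J v because J^2 = -1. Pairing with \<open>v\<close> gives
  Q = i e \<open>tau k v\<close> with Q > 0. So e is imaginary, and |e| = Q /
  |\<open>tau k v\<close>| \<ge> 1.\<close>

lemma symplectic_eigenvalue_imaginary:
  assumes unc: "uncertainty k M"
    and ev: "eigenvalue (mat (2 * k) (2 * k) (\<lambda>(i, j). complex_of_real (matmul (2 * k) (J_mat k) M i j))) e"
      (is "eigenvalue ?A e")
  shows "Re e = 0 \<and> 1 \<le> \<bar>Im e\<bar>"
proof -
  from ev obtain x where x: "x \<in> carrier_vec (2 * k)" "x \<noteq> 0\<^sub>v (2 * k)" "?A *\<^sub>v x = e \<cdot>\<^sub>v x"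
    by (auto simp: eigenvalue_def eigenvector_def)
  define v where "v i = x $ i" for i
  have nz: "\<exists>i<2*k. v i \<noteq> 0" using x(1,2) unfolding v_def by (metis carrier_vecD eq_vecI index_zero_vec)
  have eq: "(\<Sum>j<2*k. of_real (matmul (2 * k) (J_mat k) M i j) * v j) = e * v i" if "i < 2 * k" for i
  proof -
    have "(?A *\<^sub>v x) $ i = (e \<cdot>\<^sub>v x) $ i" using x(3) by simp
    then show ?thesis using that x(1) by (simp add: scalar_prod_def v_def lessThan_atLeast0)
  qed
  define y where "y i = (\<Sum>j<2*k. of_real (M i j) * v j)" for i
  have y1: "y i = e * v (k + i)" if "i < k" for i
    using eq[of "k + i"] that by (simp add: y_def J_mult_entry)
  have y2: "y (k + i) = - (e * v i)" if "i < k" for i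
  proof -
    have "- y (k + i) = e * v i"
      using eq[of i] that by (simp add: y_def J_mult_entry sum_negf)
    then show ?thesis by (metis minus_minus)
  qed
  obtain Q where Q: "Q > 0" "\<bar>tau k v\<bar> \<le> Q"
    "(\<Sum>i<2*k. \<Sum>j<2*k. cnj (v i) * of_real (M i j) * v j) = of_real Q"
    using unc nz unfolding uncertainty_def by blast
  define z where "z = (\<Sum>i<k. cnj (v i) * v (k + i))"
  have "of_real Q = (\<Sum>i<2*k. cnj (v i) * y i)"
    unfolding Q(3)[symmetric] y_def by (simp add: sum_distrib_left mult.assoc)
  also have "\<dots> = (\<Sum>i<k. cnj (v i) * (e * v (k + i))) + (\<Sum>i<k. cnj (v (k + i)) * - (e * v i))"
    unfolding sum_block by (simp add: y1 y2)
  also have "\<dots> = e * (z - cnj z)"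
    by (simp add: z_def sum_distrib_left sum_negf algebra_simps)
  also have "z - cnj z = \<i> * of_real (tau k v)"
  proof -
    have "tau k v = 2 * Im z" by (simp only: tau_def z_def)
    then show ?thesis by (simp add: complex_eq_iff)
  qed
  finally have main: "e * (\<i> * of_real (tau k v)) = of_real Q" by simp
  have re: "Im e * tau k v = - Q" and im: "Re e * tau k v = 0"
    using main by (auto simp: complex_eq_iff)
  have t0: "tau k v \<noteq> 0" using re Q(1) by auto
  have "\<bar>tau k v\<bar> \<le> \<bar>Im e\<bar> * \<bar>tau k v\<bar>" using re Q(1,2) by (simp flip: abs_mult)
  then have "1 \<le> \<bar>Im e\<bar>" using t0 by (simp add: mult_le_cancel_right1)
  then show ?thesis using im t0 by simp
qed

lemma real_char_poly_roots_cnj: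
  fixes A :: "complex mat"
  assumes A: "A \<in> carrier_mat m m" and real: "map_mat cnj A = A"
    and cp: "char_poly A = (\<Prod>a\<leftarrow>as. [:- a, 1:])"
  shows "image_mset cnj (mset as) = mset as"
proof -
  interpret cnj: comm_ring_hom cnj by unfold_locales auto
  interpret mp: map_poly_comm_ring_hom cnj ..
  have "map_poly cnj (\<Prod>a\<leftarrow>as. [:- a, 1:]) = (\<Prod>a\<leftarrow>as. [:- cnj a, 1:])" for as
    by (induction as) (auto simp: mp.hom_mult simp del: mult_pCons_left)
  moreover have "char_poly A = map_poly cnj (char_poly A)"
    using cnj.char_poly_hom[OF A] real by simp
  ultimately have "(\<Prod>a\<leftarrow>as. [:- a, 1:]) = (\<Prod>a\<leftarrow>map cnj as. [:- a, 1:])"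
    using cp by (simp add: o_def)
  then have "(\<Prod>a\<in>#mset as. [:- a, 1:]) = (\<Prod>a\<in>#mset (map cnj as). [:- a, 1:])"
    by (simp only: mset_map[symmetric] prod_mset_prod_list)
  then show ?thesis by (metis mset_map proots_prod_linear)
qed

text \<open>The multiset of roots is invariant under conjugation, as the matrix is real, and
  contains no real number by the uncertainty relation. It therefore splits into its part in the
  upper half plane and the mirror image of that part, each of size \<open>k\<close>.\<close>

lemma symp_eigs_exist:
  assumes unc: "uncertainty k M"
  shows "is_symp_eigs k M (symp_eigs k M)"
proof -
  define A where "A = mat (2 * k) (2 * k) (\<lambda>(i, j). complex_of_real (matmul (2 * k) (J_mat k) M i j))"
  have A: "A \<in> carrier_mat (2 * k) (2 * k)" by (simp add: A_def)
  obtain as where as: "char_poly A = (\<Prod>a\<leftarrow>as. [:- a, 1:])" "length as = 2 * k"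
    using char_poly_factorized[OF A] by blast
  define X where "X = mset as"
  have cpX: "char_poly A = (\<Prod>a\<in>#X. [:- a, 1:])"
    unfolding as X_def by (simp only: mset_map[symmetric] prod_mset_prod_list)
  have cnjX: "image_mset cnj X = X"
    unfolding X_def by (rule real_char_poly_roots_cnj[OF A _ as(1)]) (auto simp: A_def)
  have root: "Re a = 0 \<and> 1 \<le> \<bar>Im a\<bar>" if "a \<in># X" for a
  proof -
    have "poly (char_poly A) a = 0" using that unfolding as(1) X_def by (simp add: poly_prod_list_zero_iff)
    then have "eigenvalue A a" using eigenvalue_root_char_poly[OF A] by simp
    then show ?thesis unfolding A_def by (rule symplectic_eigenvalue_imaginary[OF unc])
  qed
  define Xp where "Xp = filter_mset (\<lambda>a. Im a > 0) X"
  have "filter_mset (\<lambda>a. \<not> Im a > 0) X = filter_mset (\<lambda>a. Im a < 0) X"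
    using root by (intro filter_mset_cong) fastforce+
  also have "\<dots> = filter_mset (\<lambda>a. Im a < 0) (image_mset cnj X)" by (simp add: cnjX)
  also have "\<dots> = image_mset cnj Xp"
    by (simp add: filter_mset_image_mset Xp_def)
  finally have X: "X = Xp + image_mset cnj Xp"
    unfolding Xp_def using multiset_partition by metis
  define L where "L = image_mset Im Xp"
  have Xp: "a \<in># Xp \<Longrightarrow> Re a = 0 \<and> 1 \<le> Im a" for a
    using root[of a] by (auto simp: Xp_def)
  have "image_mset (\<lambda>l. \<i> * of_real l) L = Xp"
  proof -
    have "image_mset (\<lambda>l. \<i> * of_real l) L = image_mset id Xp"
      unfolding L_def image_mset.compositionality o_def using Xp
      by (intro image_mset_cong) (auto simp: complex_eq_iff)
    then show ?thesis by simp
  qed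
  moreover have "image_mset (\<lambda>l. - (\<i> * of_real l)) L = image_mset cnj Xp"
    unfolding L_def image_mset.compositionality o_def using Xp
    by (intro image_mset_cong) (auto simp: complex_eq_iff)
  moreover have "size X = 2 * k" using as(2) by (simp add: X_def)
  ultimately have "is_symp_eigs k M L"
    unfolding is_symp_eigs_def symp_prod_eq char_poly_mat_eq A_def[symmetric] cpX
    using X Xp by (auto simp: L_def)
  then show ?thesis using symp_eigs_eq by metis
qed

lemma sum_symp_eigs_eq_trace:
  fixes c :: real
  assumes L: "is_symp_eigs k M L"
  defines "A \<equiv> matmul (2 * k) (J_mat k) M"
  defines "B \<equiv> \<lambda>i j. (\<Sum>m<2*k. A i m * A m j) + (if i = j then c\<^sup>2 else 0)"
  shows "2 * (\<Sum>l\<in>#L. (l\<^sup>2 - c\<^sup>2)\<^sup>2) = (\<Sum>i<2*k. \<Sum>j<2*k. B i j * B j i)"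
proof -
  define Am where "Am = mat (2 * k) (2 * k) (\<lambda>(i, j). complex_of_real (A i j))"
  have Am: "Am \<in> carrier_mat (2 * k) (2 * k)" by (simp add: Am_def)
  define X where "X = image_mset (\<lambda>l. \<i> * of_real l) L + image_mset (\<lambda>l. - (\<i> * of_real l)) L"
  obtain es where es: "mset es = X" using ex_mset by blast
  have "char_poly Am = (\<Prod>a\<in>#X. [:- a, 1:])"
    using L unfolding is_symp_eigs_def symp_prod_eq char_poly_mat_eq A_def Am_def X_def by simp
  also have "\<dots> = (\<Prod>a\<leftarrow>es. [:- a, 1:])"
    unfolding es[symmetric] by (simp only: mset_map[symmetric] prod_mset_prod_list)
  finally have cp: "char_poly Am = (\<Prod>a\<leftarrow>es. [:- a, 1:])" .
  define Bm where "Bm = Am * Am + (of_real (c\<^sup>2)) \<cdot>\<^sub>m 1\<^sub>m (2 * k)"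
  have Bm: "Bm $$ (i, j) = of_real (B i j)" if "i < 2 * k" "j < 2 * k" for i j
    using that by (simp add: Bm_def Am_def B_def scalar_prod_def lessThan_atLeast0)
  have "complex_of_real (\<Sum>i<2*k. \<Sum>j<2*k. B i j * B j i) = (\<Sum>i<2*k. (Bm * Bm) $$ (i, i))"
  proof -
    have "Bm \<in> carrier_mat (2 * k) (2 * k)" using Am by (simp add: Bm_def)
    then have "(Bm * Bm) $$ (i, i) = (\<Sum>j<2*k. Bm $$ (i, j) * Bm $$ (j, i))" if "i < 2 * k" for i
      using that by (simp add: scalar_prod_def lessThan_atLeast0)
    then show ?thesis by (simp add: Bm)
  qed
  also have "\<dots> = (\<Sum>e\<leftarrow>es. (e\<^sup>2 + of_real (c\<^sup>2))\<^sup>2)"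
    unfolding Bm_def by (rule trace_shifted_square[OF Am cp])
  also have "\<dots> = (\<Sum>e\<in>#X. (e\<^sup>2 + of_real (c\<^sup>2))\<^sup>2)"
    unfolding es[symmetric] by (simp only: mset_map[symmetric] sum_mset_sum_list)
  also have "\<dots> = of_real (2 * (\<Sum>l\<in>#L. (l\<^sup>2 - c\<^sup>2)\<^sup>2))"
  proof -
    have "((\<i> * of_real l)\<^sup>2 + complex_of_real (c\<^sup>2))\<^sup>2 = of_real ((l\<^sup>2 - c\<^sup>2)\<^sup>2)" for l
      by (simp add: power_mult_distrib power2_commute)
    then have "(\<Sum>e\<in>#image_mset (\<lambda>l. \<i> * of_real l) L. (e\<^sup>2 + complex_of_real (c\<^sup>2))\<^sup>2) = of_real (\<Sum>l\<in>#L. (l\<^sup>2 - c\<^sup>2)\<^sup>2)"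
      "(\<Sum>e\<in>#image_mset (\<lambda>l. - (\<i> * of_real l)) L. (e\<^sup>2 + complex_of_real (c\<^sup>2))\<^sup>2) = of_real (\<Sum>l\<in>#L. (l\<^sup>2 - c\<^sup>2)\<^sup>2)" for L
      by (induction L; simp)+
    then show ?thesis unfolding X_def image_mset_union sum_mset.union by (simp only: mult_2 of_real_add)
  qed
  finally show ?thesis by (simp only: of_real_eq_iff)
qed

section \<open>Passive networks acting on squeezed states\<close>

text \<open>There are no conjugates because the rows \<open>r\<close> will be real; the coefficients
  may then be real or complex.\<close>

lemma parseval:
  fixes r :: "nat \<Rightarrow> nat \<Rightarrow> 'a :: comm_ring_1"
  assumes orth: "\<And>i j. i < m \<Longrightarrow> j < m \<Longrightarrow> (\<Sum>l<N. r i l * r j l) = (if i = j then 1 else 0)"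
  shows "(\<Sum>l<N. (\<Sum>i<m. a i * r i l) * (\<Sum>j<m. u j * r j l)) = (\<Sum>i<m. a i * u i)"
proof -
  have "(\<Sum>l<N. (\<Sum>i<m. a i * r i l) * (\<Sum>j<m. u j * r j l))
      = (\<Sum>l<N. \<Sum>i<m. \<Sum>j<m. (a i * r i l) * (u j * r j l))"
    by (simp add: sum_product)
  also have "\<dots> = (\<Sum>i<m. \<Sum>j<m. \<Sum>l<N. (a i * r i l) * (u j * r j l))"
    by (subst sum.swap, rule sum.cong[OF refl], rule sum.swap)
  also have "\<dots> = (\<Sum>i<m. \<Sum>j<m. a i * u j * (\<Sum>l<N. r i l * r j l))"
    by (simp add: sum_distrib_left mult_ac)
  also have "\<dots> = (\<Sum>i<m. \<Sum>j<m. if j = i then a i * u j else 0)"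
    by (intro sum.cong refl) (simp add: orth)
  finally show ?thesis by simp
qed

lemma sum_power2_add_le: "(x + y)\<^sup>2 \<le> 2 * x\<^sup>2 + 2 * (y :: real)\<^sup>2"
  using sum_squares_bound[of x y] by (simp add: power2_sum)

text \<open>\<open>K_mat\<close> is \<open>J (M - c)\<close>, so that \<open>(J M)\<^sup>2 + c\<^sup>2 = K\<^sup>2 + c (J K + K J)\<close>.\<close>

definition K_mat :: "nat \<Rightarrow> real \<Rightarrow> (nat \<Rightarrow> nat \<Rightarrow> real) \<Rightarrow> nat \<Rightarrow> nat \<Rightarrow> real" where
  "K_mat k c M i j = matmul (2 * k) (J_mat k) M i j - c * J_mat k i j"

definition D_mat :: "real \<Rightarrow> (nat \<Rightarrow> nat \<Rightarrow> real) \<Rightarrow> nat \<Rightarrow> nat \<Rightarrow> real" where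
  "D_mat c M i j = M i j - (if i = j then c else 0)"

lemma K_mat_entry:
  assumes "i < k" "j < 2 * k"
  shows "K_mat k c M i j = - D_mat c M (k + i) j" "K_mat k c M (k + i) j = D_mat c M i j"
  using assms unfolding K_mat_def D_mat_def J_mult_entry[OF assms] by (auto simp: J_mat_def)

section \<open>Hilbert-Schmidt estimates for the symplectic spectrum\<close>

lemma norm_J_left:
  "(\<Sum>i<2*k. (\<Sum>m<2*k. J_mat k i m * x m)\<^sup>2) = (\<Sum>i<2*k. (x i :: real)\<^sup>2)"
proof -
  have "(\<Sum>m<2*k. J_mat k i m * x m) = - x (k + i)" "(\<Sum>m<2*k. J_mat k (k + i) m * x m) = x i"
    if "i < k" for i
  proof -
    have "(\<Sum>m<2*k. J_mat k i m * x m) = (\<Sum>m<2*k. if m = k + i then - x m else 0)"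
      using that by (intro sum.cong) (auto simp: J_mat_def)
    then show "(\<Sum>m<2*k. J_mat k i m * x m) = - x (k + i)" using that by simp
    have "(\<Sum>m<2*k. J_mat k (k + i) m * x m) = (\<Sum>m<2*k. if m = i then x m else 0)"
      using that by (intro sum.cong) (auto simp: J_mat_def)
    then show "(\<Sum>m<2*k. J_mat k (k + i) m * x m) = x i" using that by simp
  qed
  then show ?thesis unfolding sum_block[of _ k] by simp
qed

lemma norm_J_right:
  "(\<Sum>j<2*k. (\<Sum>m<2*k. x m * J_mat k m j)\<^sup>2) = (\<Sum>i<2*k. (x i :: real)\<^sup>2)"
proof -
  have "x m * J_mat k m j = - (J_mat k j m * x m)" if "m < 2 * k" "j < 2 * k" for m j
    using that by (auto simp: J_mat_def)
  then have "(\<Sum>m<2*k. x m * J_mat k m j) = - (\<Sum>m<2*k. J_mat k j m * x m)" if "j < 2 * k" for j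
    using that by (simp add: sum_negf[symmetric])
  then show ?thesis using norm_J_left[of k x] by simp
qed

lemma J_square:
  assumes "i < 2 * k" "j < 2 * k"
  shows "(\<Sum>m<2*k. J_mat k i m * J_mat k m j) = (if i = j then -1 else 0)"
proof (cases "i < k")
  case True
  have "(\<Sum>m<2*k. J_mat k i m * J_mat k m j) = (\<Sum>m<2*k. if m = k + i then - J_mat k m j else 0)"
    using True by (intro sum.cong) (auto simp: J_mat_def)
  also have "\<dots> = - J_mat k (k + i) j" using True by simp
  finally show ?thesis using True assms by (auto simp: J_mat_def)
next
  case False
  have "(\<Sum>m<2*k. J_mat k i m * J_mat k m j) = (\<Sum>m<2*k. if m = i - k then J_mat k m j else 0)"
    using False assms by (intro sum.cong) (auto simp: J_mat_def)
  also have "\<dots> = J_mat k (i - k) j" using False assms by auto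
  finally show ?thesis using False assms by (auto simp: J_mat_def)
qed

lemma norm_K_mult:
  "(\<Sum>i<2*k. (\<Sum>j<2*k. K_mat k c M i j * x j)\<^sup>2) = (\<Sum>i<2*k. (\<Sum>j<2*k. D_mat c M i j * x j)\<^sup>2)"
proof -
  have "(\<Sum>j<2*k. K_mat k c M i j * x j) = - (\<Sum>j<2*k. D_mat c M (k + i) j * x j)"
    "(\<Sum>j<2*k. K_mat k c M (k + i) j * x j) = (\<Sum>j<2*k. D_mat c M i j * x j)" if "i < k" for i
    using that by (simp_all add: K_mat_entry sum_negf)
  then show ?thesis unfolding sum_block[of "\<lambda>i. (_ i)\<^sup>2"] by simp
qed

lemma norm_K: "(\<Sum>i<2*k. \<Sum>j<2*k. (K_mat k c M i j)\<^sup>2) = (\<Sum>i<2*k. \<Sum>j<2*k. (D_mat c M i j)\<^sup>2)"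
proof -
  have "(\<Sum>j<2*k. (K_mat k c M i j)\<^sup>2) = (\<Sum>j<2*k. (D_mat c M (k + i) j)\<^sup>2)"
    "(\<Sum>j<2*k. (K_mat k c M (k + i) j)\<^sup>2) = (\<Sum>j<2*k. (D_mat c M i j)\<^sup>2)" if "i < k" for i
    using that by (simp_all add: K_mat_entry)
  then show ?thesis unfolding sum_block[of "\<lambda>i. \<Sum>j<2*k. (K_mat k c M i j)\<^sup>2" k]
      sum_block[of "\<lambda>i. \<Sum>j<2*k. (D_mat c M i j)\<^sup>2" k] by simp
qed

text \<open>The trace of B^2 is at most the squared Hilbert-Schmidt norm of B, although B = (J M)^2
  + c^2 need not be symmetric. The part of B linear in K costs nothing under multiplication by the
  orthogonal matrix J. The part K^2 is kept as it is, to be estimated in two ways for small and for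
  large deviations.\<close>

lemma sum_symp_eigs_le:
  assumes L: "is_symp_eigs k M L"
  shows "(\<Sum>l\<in>#L. (l\<^sup>2 - c\<^sup>2)\<^sup>2) \<le> (\<Sum>i<2*k. \<Sum>j<2*k. (\<Sum>m<2*k. K_mat k c M i m * K_mat k c M m j)\<^sup>2)
    + 4 * c\<^sup>2 * (\<Sum>i<2*k. \<Sum>j<2*k. (D_mat c M i j)\<^sup>2)"
proof -
  define A where "A = matmul (2 * k) (J_mat k) M"
  define B where "B i j = (\<Sum>m<2*k. A i m * A m j) + (if i = j then c\<^sup>2 else 0)" for i j
  define K where "K = K_mat k c M"
  define J where "J = J_mat k"
  have A: "A i j = K i j + c * J i j" for i j by (simp add: A_def K_def J_def K_mat_def)
  define X Y V where "X i j = (\<Sum>m<2*k. K i m * K m j)" and "Y i j = (\<Sum>m<2*k. J i m * K m j)"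
    and "V i j = (\<Sum>m<2*k. K i m * J m j)" for i j
  have B: "B i j = X i j + c * (Y i j + V i j)" if "i < 2 * k" "j < 2 * k" for i j
  proof -
    have "(\<Sum>m<2*k. A i m * A m j) = (\<Sum>m<2*k. K i m * K m j + c * (J i m * K m j + K i m * J m j)
        + c\<^sup>2 * (J i m * J m j))"
      by (intro sum.cong refl) (simp add: A algebra_simps power2_eq_square)
    also have "\<dots> = X i j + c * (Y i j + V i j) + c\<^sup>2 * (\<Sum>m<2*k. J i m * J m j)"
      by (simp add: sum.distrib sum_distrib_left[symmetric] X_def Y_def V_def)
    finally show ?thesis using J_square[OF that] by (simp add: B_def J_def)
  qed
  have KK: "(\<Sum>i<2*k. \<Sum>j<2*k. (Y i j)\<^sup>2) = (\<Sum>i<2*k. \<Sum>j<2*k. (K i j)\<^sup>2)"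
  proof -
    have "(\<Sum>i<2*k. \<Sum>j<2*k. (Y i j)\<^sup>2) = (\<Sum>j<2*k. \<Sum>i<2*k. (Y i j)\<^sup>2)" by (rule sum.swap)
    also have "\<dots> = (\<Sum>j<2*k. \<Sum>i<2*k. (K i j)\<^sup>2)"
      unfolding Y_def J_def norm_J_left ..
    also have "\<dots> = (\<Sum>i<2*k. \<Sum>j<2*k. (K i j)\<^sup>2)" by (rule sum.swap)
    finally show ?thesis .
  qed
  have KV: "(\<Sum>i<2*k. \<Sum>j<2*k. (V i j)\<^sup>2) = (\<Sum>i<2*k. \<Sum>j<2*k. (K i j)\<^sup>2)"
    unfolding V_def J_def by (simp only: norm_J_right)
  have "2 * (\<Sum>l\<in>#L. (l\<^sup>2 - c\<^sup>2)\<^sup>2) = (\<Sum>i<2*k. \<Sum>j<2*k. B i j * B j i)"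
    using sum_symp_eigs_eq_trace[OF L, of c] by (simp add: A_def B_def)
  also have "\<dots> \<le> (\<Sum>i<2*k. \<Sum>j<2*k. ((B i j)\<^sup>2 + (B j i)\<^sup>2) / 2)"
  proof (intro sum_mono)
    fix i j show "B i j * B j i \<le> ((B i j)\<^sup>2 + (B j i)\<^sup>2) / 2"
      using sum_squares_bound[of "B i j" "B j i"] by simp
  qed
  also have "\<dots> = (\<Sum>i<2*k. \<Sum>j<2*k. (B i j)\<^sup>2)"
  proof -
    have "(\<Sum>i<2*k. \<Sum>j<2*k. (B j i)\<^sup>2) = (\<Sum>i<2*k. \<Sum>j<2*k. (B i j)\<^sup>2)" by (rule sum.swap)
    then show ?thesis by (simp add: sum.distrib add_divide_distrib sum_divide_distrib[symmetric])
  qed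
  also have "\<dots> \<le> (\<Sum>i<2*k. \<Sum>j<2*k. 2 * (X i j)\<^sup>2 + 4 * c\<^sup>2 * ((Y i j)\<^sup>2 + (V i j)\<^sup>2))"
  proof (intro sum_mono)
    fix i j assume "i \<in> {..<2*k}" "j \<in> {..<2*k}"
    then have "(B i j)\<^sup>2 \<le> 2 * (X i j)\<^sup>2 + 2 * (c * (Y i j + V i j))\<^sup>2"
      using sum_power2_add_le by (simp add: B)
    also have "(c * (Y i j + V i j))\<^sup>2 \<le> c\<^sup>2 * (2 * (Y i j)\<^sup>2 + 2 * (V i j)\<^sup>2)"
      unfolding power_mult_distrib by (intro mult_left_mono sum_power2_add_le) auto
    finally show "(B i j)\<^sup>2 \<le> 2 * (X i j)\<^sup>2 + 4 * c\<^sup>2 * ((Y i j)\<^sup>2 + (V i j)\<^sup>2)"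
      by (simp add: algebra_simps)
  qed
  also have "\<dots> = 2 * (\<Sum>i<2*k. \<Sum>j<2*k. (X i j)\<^sup>2)
      + 4 * c\<^sup>2 * ((\<Sum>i<2*k. \<Sum>j<2*k. (Y i j)\<^sup>2) + (\<Sum>i<2*k. \<Sum>j<2*k. (V i j)\<^sup>2))"
    by (simp add: sum.distrib sum_distrib_left[symmetric])
  also have "\<dots> = 2 * ((\<Sum>i<2*k. \<Sum>j<2*k. (X i j)\<^sup>2) + 4 * c\<^sup>2 * (\<Sum>i<2*k. \<Sum>j<2*k. (D_mat c M i j)\<^sup>2))"
    unfolding KK KV unfolding K_def norm_K by simp
  finally have "(\<Sum>l\<in>#L. (l\<^sup>2 - c\<^sup>2)\<^sup>2) \<le> (\<Sum>i<2*k. \<Sum>j<2*k. (X i j)\<^sup>2)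
      + 4 * c\<^sup>2 * (\<Sum>i<2*k. \<Sum>j<2*k. (D_mat c M i j)\<^sup>2)"
    by (rule mult_left_le_imp_le) simp
  then show ?thesis by (simp only: X_def K_def)
qed

lemma norm_K_square_le:
  "(\<Sum>i<2*k. \<Sum>j<2*k. (\<Sum>m<2*k. K_mat k c M i m * K_mat k c M m j)\<^sup>2)
    \<le> (\<Sum>i<2*k. \<Sum>j<2*k. (D_mat c M i j)\<^sup>2)\<^sup>2"
proof -
  define K where "K = K_mat k c M"
  have "(\<Sum>i<2*k. \<Sum>j<2*k. (\<Sum>m<2*k. K i m * K m j)\<^sup>2)
      \<le> (\<Sum>i<2*k. \<Sum>j<2*k. (\<Sum>m<2*k. (K i m)\<^sup>2) * (\<Sum>m<2*k. (K m j)\<^sup>2))"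
    by (intro sum_mono Cauchy_Schwarz_ineq_sum)
  also have "\<dots> = (\<Sum>i<2*k. \<Sum>m<2*k. (K i m)\<^sup>2) * (\<Sum>j<2*k. \<Sum>m<2*k. (K m j)\<^sup>2)"
    by (simp only: sum_product)
  also have "(\<Sum>j<2*k. \<Sum>m<2*k. (K m j)\<^sup>2) = (\<Sum>i<2*k. \<Sum>m<2*k. (K i m)\<^sup>2)" by (rule sum.swap)
  finally have "(\<Sum>i<2*k. \<Sum>j<2*k. (\<Sum>m<2*k. K i m * K m j)\<^sup>2)
      \<le> (\<Sum>i<2*k. \<Sum>m<2*k. (K i m)\<^sup>2)\<^sup>2"
    by (simp only: power2_eq_square[of "\<Sum>i<2*k. \<Sum>m<2*k. (K i m)\<^sup>2"])
  then show ?thesis by (simp only: K_def norm_K)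
qed

text \<open>For large deviations: one factor K is measured in operator norm, so the bound stays
  linear in the squared Hilbert-Schmidt norm, whereas \<open>norm_K_square_le\<close> is quadratic
  in it.\<close>

lemma norm_K_square_op_le:
  assumes op: "\<And>x. (\<Sum>i<2*k. (\<Sum>j<2*k. D_mat c M i j * x j)\<^sup>2) \<le> C * (\<Sum>j<2*k. (x j)\<^sup>2)"
  shows "(\<Sum>i<2*k. \<Sum>j<2*k. (\<Sum>m<2*k. K_mat k c M i m * K_mat k c M m j)\<^sup>2)
    \<le> C * (\<Sum>i<2*k. \<Sum>j<2*k. (D_mat c M i j)\<^sup>2)"
proof -
  have "(\<Sum>i<2*k. \<Sum>j<2*k. (\<Sum>m<2*k. K_mat k c M i m * K_mat k c M m j)\<^sup>2)
      = (\<Sum>j<2*k. \<Sum>i<2*k. (\<Sum>m<2*k. K_mat k c M i m * K_mat k c M m j)\<^sup>2)" by (rule sum.swap)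
  also have "\<dots> \<le> (\<Sum>j<2*k. C * (\<Sum>m<2*k. (K_mat k c M m j)\<^sup>2))"
    unfolding norm_K_mult by (intro sum_mono op)
  also have "\<dots> = C * (\<Sum>j<2*k. \<Sum>m<2*k. (K_mat k c M m j)\<^sup>2)" by (simp add: sum_distrib_left)
  also have "(\<Sum>j<2*k. \<Sum>m<2*k. (K_mat k c M m j)\<^sup>2) = (\<Sum>i<2*k. \<Sum>j<2*k. (K_mat k c M i j)\<^sup>2)"
    by (rule sum.swap)
  finally show ?thesis by (simp only: norm_K)
qed

text \<open>The bound \<open>R\<close> is a free parameter rather than the maximum of the
  \<open>z l\<close>: it will be the power bound on the squeezing for large \<open>n\<close>, and
  the sum of all \<open>z l\<close> for the remaining ones.\<close>

locale squeezed =
  fixes n k :: nat and z :: "nat \<Rightarrow> real" and R :: real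
  assumes k_le: "k \<le> n" and n_gt_0: "n > 0"
    and z_ge_1: "\<And>l. l < n \<Longrightarrow> 1 \<le> z l"
    and z_le: "\<And>l. l < n \<Longrightarrow> z l \<le> R"
begin

abbreviation lam :: real where "lam \<equiv> avg_energy n z"

lemma R_ge_1: "1 \<le> R"
  using z_ge_1[OF n_gt_0] z_le[OF n_gt_0] by linarith

lemma mean_bounds:
  assumes "l < n"
  shows "1 \<le> (z l + 1 / z l) / 2" "(z l + 1 / z l) / 2 \<le> R"
proof -
  have z: "1 \<le> z l" by (rule z_ge_1[OF assms])
  have "0 \<le> (z l - 1)\<^sup>2 / z l" using z by simp
  also have "\<dots> = z l + 1 / z l - 2" using z by (simp add: power2_eq_square field_simps)
  finally show "1 \<le> (z l + 1 / z l) / 2" by simp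
  have "1 / z l \<le> 1" using z by simp
  from add_mono[OF z_le[OF assms] order_trans[OF this R_ge_1]]
  show "(z l + 1 / z l) / 2 \<le> R" by simp
qed

lemma lam_mult: "lam * real n = (\<Sum>l<n. (z l + 1 / z l) / 2)"
  using n_gt_0 by (simp add: avg_energy_def sum_divide_distrib[symmetric])

lemma lam_ge_1: "1 \<le> lam"
proof -
  have "real n * 1 \<le> (\<Sum>l<n. (z l + 1 / z l) / 2)"
    using sum_mono[of "{..<n}" "\<lambda>_. 1" "\<lambda>l. (z l + 1 / z l) / 2"] mean_bounds(1) by simp
  then show ?thesis unfolding lam_mult[symmetric] using n_gt_0 by simp
qed

lemma lam_le_R: "lam \<le> R"
proof -
  have "(\<Sum>l<n. (z l + 1 / z l) / 2) \<le> real n * R"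
    using sum_mono[of "{..<n}" "\<lambda>l. (z l + 1 / z l) / 2" "\<lambda>_. R"] mean_bounds(2) by simp
  then show ?thesis unfolding lam_mult[symmetric] using n_gt_0 by simp
qed

sublocale network n k "\<lambda>l. (z l + 1 / z l) / 2" "\<lambda>l. (z l - 1 / z l) / 2" lam R
proof
  fix l assume l: "l < n"
  define y where "y = 1 / z l"
  have y: "0 \<le> y" "0 \<le> z l" using z_ge_1[OF l] by (auto simp: y_def)
  then show "0 \<le> (z l + 1 / z l) / 2" by (simp flip: y_def)
  show "\<bar>(z l - 1 / z l) / 2\<bar> \<le> (z l + 1 / z l) / 2"
    unfolding y_def[symmetric] using y by (simp add: abs_le_iff)
qed (use k_le n_gt_0 lam_mult lam_ge_1 mean_bounds in auto)

definition row :: "(nat \<Rightarrow> nat \<Rightarrow> complex) \<Rightarrow> nat \<Rightarrow> nat \<Rightarrow> real" where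
  "row U i l = eta n U (sub_idx n k i) l"

definition sg :: "nat \<Rightarrow> real" where
  "sg l = sqz_mat n z l l"

lemma row_simps:
  assumes "i < k" "l < n"
  shows "row U i l = Re (U i l)" "row U i (n + l) = Im (U i l)"
    "row U (k + i) l = - Im (U i l)" "row U (k + i) (n + l) = Re (U i l)"
  using assms k_le by (auto simp: row_def eta_def sub_idx_def)

lemma sg_simps: "l < n \<Longrightarrow> sg l = z l" "l < n \<Longrightarrow> sg (n + l) = 1 / z l"
  by (auto simp: sg_def sqz_mat_def)

lemma red_cov_mat_eq:
  assumes "i < 2 * k" "j < 2 * k"
  shows "red_cov_mat n k z U i j = (\<Sum>l<2*n. sg l * (row U i l * row U j l))"
proof -
  have idx: "sub_idx n k i < 2 * n" if "i < 2 * k" for i using that k_le by (auto simp: sub_idx_def)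
  have "(\<Sum>l<2*n. eta n U a l * sqz_mat n z l m) = eta n U a m * sg m" if "m < 2 * n" for a m
  proof -
    have "(\<Sum>l<2*n. eta n U a l * sqz_mat n z l m) = (\<Sum>l<2*n. if l = m then eta n U a l * sg l else 0)"
      by (intro sum.cong refl) (auto simp: sqz_mat_def sg_def)
    then show ?thesis using that by simp
  qed
  then show ?thesis
    using assms idx[of i] idx[of j]
    by (simp add: red_cov_mat_def cov_mat_def matmul_def transp_mat_def row_def) (simp add: mult_ac)
qed

text \<open>The real and imaginary parts of the row relations of \<open>U\<close> settle equal and
  different blocks, respectively.\<close>

lemma row_orthonormal:
  assumes U: "U \<in> unitary_set n" and ij: "i < 2 * k" "j < 2 * k"
  shows "(\<Sum>l<2*n. row U i l * row U j l) = (if i = j then 1 else 0)"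
proof -
  have re: "(\<Sum>l<n. Re (U i l) * Re (U j l) + Im (U i l) * Im (U j l)) = (if i = j then 1 else 0)"
    and im: "(\<Sum>l<n. Im (U i l) * Re (U j l) - Re (U i l) * Im (U j l)) = 0"
    if "i < k" "j < k" for i j
  proof -
    have "(\<Sum>l<n. U i l * cnj (U j l)) = (if i = j then 1 else 0)"
      using that k_le by (intro unitary_setD_row[OF U]) auto
    from arg_cong[OF this, of Re] arg_cong[OF this, of Im]
    show "(\<Sum>l<n. Re (U i l) * Re (U j l) + Im (U i l) * Im (U j l)) = (if i = j then 1 else 0)"
      "(\<Sum>l<n. Im (U i l) * Re (U j l) - Re (U i l) * Im (U j l)) = 0"
      by (simp_all split: if_splits)
  qed
  have cases: "(\<exists>i'<k. i = i') \<or> (\<exists>i'<k. i = k + i')" if "i < 2 * k" for i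
    using that by (metis add_diff_inverse_nat less_diff_conv2 linorder_not_less mult_2)
  from cases[OF ij(1)] cases[OF ij(2)] show ?thesis
  proof (elim disjE exE conjE)
    fix i' j' assume "i' < k" "i = i'" "j' < k" "j = j'"
    then show ?thesis using re[of i' j'] by (simp add: sum_block row_simps sum.distrib)
  next
    fix i' j' assume *: "i' < k" "i = i'" "j' < k" "j = k + j'"
    have "(\<Sum>l<2*n. row U i l * row U j l) = (\<Sum>l<n. Im (U i' l) * Re (U j' l) - Re (U i' l) * Im (U j' l))"
      unfolding sum_block sum.distrib[symmetric] using * by (intro sum.cong refl) (simp add: row_simps)
    then show ?thesis using im[of i' j'] * by simp
  next
    fix i' j' assume *: "i' < k" "i = k + i'" "j' < k" "j = j'"
    have "(\<Sum>l<2*n. row U i l * row U j l) = (\<Sum>l<n. Im (U j' l) * Re (U i' l) - Re (U j' l) * Im (U i' l))"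
      unfolding sum_block sum.distrib[symmetric] using * by (intro sum.cong refl) (simp add: row_simps mult.commute)
    then show ?thesis using im[of j' i'] * by simp
  next
    fix i' j' assume *: "i' < k" "i = k + i'" "j' < k" "j = k + j'"
    have "(\<Sum>l<2*n. row U i l * row U j l) = (\<Sum>l<n. Re (U i' l) * Re (U j' l) + Im (U i' l) * Im (U j' l))"
      unfolding sum_block sum.distrib[symmetric] using * by (intro sum.cong refl) (simp add: row_simps)
    then show ?thesis using re[of i' j'] * by simp
  qed
qed

lemma sg_bounds: "l < 2 * n \<Longrightarrow> 0 < sg l \<and> sg l \<le> R"
proof -
  assume l: "l < 2 * n"
  have "0 < sg l \<and> sg l \<le> R" if "l < n" for l
    using that z_ge_1[OF that] z_le[OF that] by (simp add: sg_simps)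
  moreover have "0 < sg (n + l) \<and> sg (n + l) \<le> R" if "l < n" for l
  proof -
    have "1 / z l \<le> 1" using z_ge_1[OF that] by simp
    from order_trans[OF this R_ge_1] show ?thesis using that z_ge_1[OF that] by (simp add: sg_simps)
  qed
  ultimately show ?thesis using l by (metis add_diff_inverse_nat less_diff_conv2 linorder_not_less mult_2)
qed

lemma red_cov_op_le:
  assumes U: "U \<in> unitary_set n"
  shows "(\<Sum>i<2*k. (\<Sum>j<2*k. red_cov_mat n k z U i j * x j)\<^sup>2) \<le> R\<^sup>2 * (\<Sum>j<2*k. (x j)\<^sup>2)"
proof -
  define y where "y x l = (\<Sum>j<2*k. x j * row U j l)" for x l
  define a where "a i = (\<Sum>j<2*k. red_cov_mat n k z U i j * x j)" for i
  have pars: "(\<Sum>l<2*n. y u l * y v l) = (\<Sum>i<2*k. u i * v i)" for u v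
    unfolding y_def by (rule parseval[OF row_orthonormal[OF U]])
  have a: "a i = (\<Sum>l<2*n. row U i l * (sg l * y x l))" if "i < 2 * k" for i
  proof -
    have "a i = (\<Sum>j<2*k. \<Sum>l<2*n. row U i l * (sg l * (x j * row U j l)))"
    proof -
      have "red_cov_mat n k z U i j * x j = (\<Sum>l<2*n. row U i l * (sg l * (x j * row U j l)))"
        if "j < 2 * k" for j
        unfolding red_cov_mat_eq[OF \<open>i < 2 * k\<close> that] sum_distrib_right
        by (intro sum.cong refl) (simp add: mult_ac)
      then show ?thesis by (simp add: a_def)
    qed
    also have "\<dots> = (\<Sum>l<2*n. row U i l * (sg l * y x l))"
      unfolding y_def by (subst sum.swap) (simp add: sum_distrib_left)
    finally show ?thesis .
  qed
  have "(\<Sum>i<2*k. (a i)\<^sup>2) = (\<Sum>i<2*k. \<Sum>l<2*n. a i * (row U i l * (sg l * y x l)))"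
    by (intro sum.cong refl) (simp add: power2_eq_square sum_distrib_left[symmetric] flip: a)
  also have "\<dots> = (\<Sum>l<2*n. y a l * (sg l * y x l))"
    unfolding y_def[of a] by (subst sum.swap) (simp add: sum_distrib_right mult.assoc)
  \<comment> \<open>The arithmetic-geometric mean replaces Cauchy-Schwarz. By Parseval the first
    half is half of the left-hand side, into which it is absorbed at the end.\<close>
  also have "\<dots> \<le> (\<Sum>l<2*n. (y a l * y a l) / 2 + R\<^sup>2 * (y x l * y x l) / 2)"
  proof (rule sum_mono)
    fix l assume "l \<in> {..<2*n}"
    then have "(sg l)\<^sup>2 \<le> R\<^sup>2" using sg_bounds[of l] by (intro power_mono) auto
    then have "(sg l)\<^sup>2 * (y x l)\<^sup>2 \<le> R\<^sup>2 * (y x l)\<^sup>2" by (rule mult_right_mono) simp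
    then have "(sg l * y x l)\<^sup>2 \<le> R\<^sup>2 * (y x l * y x l)"
      by (simp add: power_mult_distrib flip: power2_eq_square)
    moreover have "v * u \<le> v * v / 2 + b / 2" if "u\<^sup>2 \<le> b" for u v b :: real
      using sum_squares_bound[of v u] that by (simp add: power2_eq_square)
    ultimately show "y a l * (sg l * y x l) \<le> (y a l * y a l) / 2 + R\<^sup>2 * (y x l * y x l) / 2"
      by blast
  qed
  also have "\<dots> = (\<Sum>i<2*k. (a i)\<^sup>2) / 2 + R\<^sup>2 * (\<Sum>i<2*k. (x i)\<^sup>2) / 2"
    using pars[of a a] pars[of x x]
    by (simp add: sum.distrib sum_divide_distrib[symmetric] sum_distrib_left[symmetric] power2_eq_square)
  finally show ?thesis by (simp add: a_def)
qed

lemma D_op_le: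
  assumes U: "U \<in> unitary_set n"
  shows "(\<Sum>i<2*k. (\<Sum>j<2*k. D_mat lam (red_cov_mat n k z U) i j * x j)\<^sup>2) \<le> 4 * R\<^sup>2 * (\<Sum>j<2*k. (x j)\<^sup>2)"
proof -
  have eq: "(\<Sum>j<2*k. D_mat lam (red_cov_mat n k z U) i j * x j)
      = (\<Sum>j<2*k. red_cov_mat n k z U i j * x j) + - (lam * x i)" if "i < 2 * k" for i
  proof -
    have "(\<Sum>j<2*k. D_mat lam (red_cov_mat n k z U) i j * x j)
      = (\<Sum>j<2*k. red_cov_mat n k z U i j * x j - (if j = i then lam * x j else 0))"
      by (intro sum.cong refl) (auto simp: D_mat_def algebra_simps)
    then show ?thesis using that by (simp add: sum_subtractf)
  qed
  have "(\<Sum>i<2*k. (\<Sum>j<2*k. D_mat lam (red_cov_mat n k z U) i j * x j)\<^sup>2)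
     \<le> (\<Sum>i<2*k. 2 * (\<Sum>j<2*k. red_cov_mat n k z U i j * x j)\<^sup>2 + 2 * (- (lam * x i))\<^sup>2)"
    using sum_power2_add_le by (intro sum_mono) (simp only: lessThan_iff eq)
  also have "\<dots> = 2 * (\<Sum>i<2*k. (\<Sum>j<2*k. red_cov_mat n k z U i j * x j)\<^sup>2) + 2 * lam\<^sup>2 * (\<Sum>i<2*k. (x i)\<^sup>2)"
    by (simp add: sum.distrib sum_distrib_left power_mult_distrib mult.assoc)
  also have "\<dots> \<le> 2 * (R\<^sup>2 * (\<Sum>i<2*k. (x i)\<^sup>2)) + 2 * R\<^sup>2 * (\<Sum>i<2*k. (x i)\<^sup>2)"
    using lam_le_R lam_ge_1
    by (intro add_mono mult_left_mono red_cov_op_le[OF U] mult_right_mono power_mono sum_nonneg) auto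
  finally show ?thesis by simp
qed

text \<open>Since z = p + q and 1/z = p - q, the terms with p collect into U cnj U, that is
  \<open>W\<close>, and those with q into U U, that is \<open>S\<close>.\<close>

lemma red_cov_blocks:
  assumes ij: "i < k" "j < k"
  shows "red_cov_mat n k z U i j = Re (W i j U) + Re (S i j U)"
    "red_cov_mat n k z U (k + i) (k + j) = Re (W i j U) - Re (S i j U)"
    "red_cov_mat n k z U i (k + j) = Im (W i j U) - Im (S i j U)"
    "red_cov_mat n k z U (k + i) j = - Im (W i j U) - Im (S i j U)"
proof -
  have idx: "i < 2 * k" "j < 2 * k" "k + i < 2 * k" "k + j < 2 * k" using ij by auto
  show "red_cov_mat n k z U i j = Re (W i j U) + Re (S i j U)"
    unfolding red_cov_mat_eq[OF idx(1,2)] sum_block W_def S_def Re_sum sum.distrib[symmetric]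
    by (intro sum.cong refl) (simp add: row_simps ij sg_simps, simp add: algebra_simps add_divide_distrib diff_divide_distrib)
  show "red_cov_mat n k z U (k + i) (k + j) = Re (W i j U) - Re (S i j U)"
    unfolding red_cov_mat_eq[OF idx(3,4)] sum_block W_def S_def Re_sum sum.distrib[symmetric] sum_subtractf[symmetric]
    by (intro sum.cong refl) (simp add: row_simps ij sg_simps, simp add: algebra_simps add_divide_distrib diff_divide_distrib)
  show "red_cov_mat n k z U i (k + j) = Im (W i j U) - Im (S i j U)"
    unfolding red_cov_mat_eq[OF idx(1,4)] sum_block W_def S_def Im_sum sum.distrib[symmetric] sum_subtractf[symmetric]
    by (intro sum.cong refl) (simp add: row_simps ij sg_simps, simp add: algebra_simps add_divide_distrib diff_divide_distrib)
  show "red_cov_mat n k z U (k + i) j = - Im (W i j U) - Im (S i j U)"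
    unfolding red_cov_mat_eq[OF idx(3,2)] sum_block W_def S_def Im_sum sum.distrib[symmetric] sum_subtractf[symmetric] sum_negf[symmetric]
    by (intro sum.cong refl) (simp add: row_simps ij sg_simps, simp add: algebra_simps add_divide_distrib diff_divide_distrib)
qed

text \<open>Opposite blocks are sums and differences of the same parts of \<open>T\<close> and
  \<open>S\<close>, so the parallelogram identity applies.\<close>

lemma norm_D_eq_dev:
  "(\<Sum>i<2*k. \<Sum>j<2*k. (D_mat lam (red_cov_mat n k z U) i j)\<^sup>2) = 2 * dev U"
proof -
  have "(\<Sum>i<2*k. \<Sum>j<2*k. (D_mat lam (red_cov_mat n k z U) i j)\<^sup>2)
    = (\<Sum>i<k. \<Sum>j<k. (D_mat lam (red_cov_mat n k z U) i j)\<^sup>2 + (D_mat lam (red_cov_mat n k z U) i (k + j))\<^sup>2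
      + ((D_mat lam (red_cov_mat n k z U) (k + i) j)\<^sup>2 + (D_mat lam (red_cov_mat n k z U) (k + i) (k + j))\<^sup>2))"
    unfolding sum_block by (simp only: sum.distrib)
  also have "\<dots> = (\<Sum>i<k. \<Sum>j<k. 2 * ((cmod (T i j U))\<^sup>2 + (cmod (S i j U))\<^sup>2))"
  proof (intro sum.cong refl, goal_cases)
    case (1 i j)
    then have ij: "i < k" "j < k" by auto
    have T: "Re (T i j U) = Re (W i j U) - (if i = j then lam else 0)" "Im (T i j U) = Im (W i j U)"
      by (auto simp: T_def)
    show ?case
      unfolding cmod_power2 T D_mat_def using ij
      by (simp add: red_cov_blocks[OF ij]) (simp add: power2_eq_square algebra_simps)
  qed
  finally show ?thesis by (simp add: dev_def sum_distrib_left)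
qed

text \<open>In the coordinates \<open>y v\<close>, the image of \<open>v\<close> under the
  transposed rows, both forms decouple into modes. For a single mode the claim is 2 a b \<le> z a^2
  + b^2 / z, which holds because the two squeezing factors are reciprocal.\<close>

lemma uncertainty_red_cov:
  assumes U: "U \<in> unitary_set n"
  shows "uncertainty k (red_cov_mat n k z U)"
  unfolding uncertainty_def
proof (intro allI impI)
  fix v :: "nat \<Rightarrow> complex" assume nz: "\<exists>i<2*k. v i \<noteq> 0"
  define y where "y v l = (\<Sum>j<2*k. v j * of_real (row U j l))" for v :: "nat \<Rightarrow> complex" and l
  \<comment> \<open>This is - J v. The rows of \<open>eta\<close> intertwine the two matrices J
    (\<open>y_v'\<close>), so Parseval applied to \<open>v\<close> and \<open>v'\<close> rewrites
    \<open>tau k v\<close> as a sum over the \<open>n\<close> modes.\<close>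
  define v' where "v' i = (if i < k then v (k + i) else - v (i - k))" for i
  have orth: "(\<Sum>l<2*n. complex_of_real (row U i l) * of_real (row U j l)) = (if i = j then 1 else 0)"
    if "i < 2 * k" "j < 2 * k" for i j
    using arg_cong[OF row_orthonormal[OF U that], of complex_of_real] by (simp split: if_splits)
  have cy: "cnj (y u l) = y (\<lambda>i. cnj (u i)) l" for u l by (simp add: y_def)
  have pars: "(\<Sum>l<2*n. cnj (y u l) * y w l) = (\<Sum>i<2*k. cnj (u i) * w i)" for u w
    unfolding cy unfolding y_def by (rule parseval[OF orth])
  have y_v': "y v' l = y v (n + l)" "y v' (n + l) = - y v l" if "l < n" for l
    unfolding y_def sum_block using that
    by (simp_all add: v'_def row_simps sum_negf)
  have tau: "tau k v = (\<Sum>l<n. 2 * Im (cnj (y v l) * y v (n + l)))"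
  proof -
    have "(\<Sum>i<2*k. cnj (v i) * v' i) = (\<Sum>i<k. cnj (v i) * v (k + i)) - cnj (\<Sum>i<k. cnj (v i) * v (k + i))"
      unfolding sum_block by (simp add: v'_def sum_negf mult.commute)
    moreover have "(\<Sum>l<2*n. cnj (y v l) * y v' l)
        = (\<Sum>l<n. cnj (y v l) * y v (n + l)) - cnj (\<Sum>l<n. cnj (y v l) * y v (n + l))"
      unfolding sum_block[of _ n] by (simp add: y_v' sum_negf mult.commute)
    ultimately have "Im ((\<Sum>i<k. cnj (v i) * v (k + i)) - cnj (\<Sum>i<k. cnj (v i) * v (k + i)))
        = Im ((\<Sum>l<n. cnj (y v l) * y v (n + l)) - cnj (\<Sum>l<n. cnj (y v l) * y v (n + l)))"
      using pars[of v v'] by simp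
    then have "2 * Im (\<Sum>i<k. cnj (v i) * v (k + i)) = 2 * Im (\<Sum>l<n. cnj (y v l) * y v (n + l))"
      by (simp only: minus_complex.sel cnj.sel)
    then show ?thesis unfolding tau_def by (simp only: Im_sum sum_distrib_left)
  qed
  define Q where "Q = (\<Sum>l<2*n. sg l * (cmod (y v l))\<^sup>2)"
  have form: "(\<Sum>i<2*k. \<Sum>j<2*k. cnj (v i) * of_real (red_cov_mat n k z U i j) * v j) = of_real Q"
  proof -
    have "(\<Sum>i<2*k. \<Sum>j<2*k. cnj (v i) * of_real (red_cov_mat n k z U i j) * v j)
        = (\<Sum>i<2*k. \<Sum>j<2*k. \<Sum>l<2*n. of_real (sg l) * ((cnj (v i) * of_real (row U i l)) * (v j * of_real (row U j l))))"
      by (intro sum.cong refl) (simp add: red_cov_mat_eq sum_distrib_left sum_distrib_right mult_ac)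
    also have "\<dots> = (\<Sum>i<2*k. \<Sum>l<2*n. \<Sum>j<2*k. of_real (sg l) * ((cnj (v i) * of_real (row U i l)) * (v j * of_real (row U j l))))"
      by (rule sum.cong[OF refl], rule sum.swap)
    also have "\<dots> = (\<Sum>l<2*n. \<Sum>i<2*k. \<Sum>j<2*k. of_real (sg l) * ((cnj (v i) * of_real (row U i l)) * (v j * of_real (row U j l))))"
      by (rule sum.swap)
    also have "\<dots> = (\<Sum>l<2*n. of_real (sg l) * (y v l * cnj (y v l)))"
    proof (rule sum.cong[OF refl])
      fix l
      have "(\<Sum>i<2*k. \<Sum>j<2*k. (cnj (v i) * of_real (row U i l)) * (v j * of_real (row U j l)))
          = cnj (y v l) * y v l"
        unfolding cy unfolding y_def by (rule sum_product[symmetric])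
      then show "(\<Sum>i<2*k. \<Sum>j<2*k. of_real (sg l) * ((cnj (v i) * of_real (row U i l)) * (v j * of_real (row U j l))))
          = of_real (sg l) * (y v l * cnj (y v l))"
        by (simp only: sum_distrib_left[symmetric] mult.commute[of "y v l"])
    qed
    also have "\<dots> = of_real Q"
      unfolding Q_def of_real_sum of_real_mult complex_norm_square ..
    finally show ?thesis .
  qed
  have "Q > 0"
  proof -
    have "(\<Sum>l<2*n. (cmod (y v l))\<^sup>2) = (\<Sum>i<2*k. (cmod (v i))\<^sup>2)"
    proof -
      have "complex_of_real (\<Sum>l<2*n. (cmod (y v l))\<^sup>2) = of_real (\<Sum>i<2*k. (cmod (v i))\<^sup>2)"
        unfolding of_real_sum complex_norm_square using pars[of v v] by (simp add: mult.commute)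
      then show ?thesis by (simp only: of_real_eq_iff)
    qed
    moreover have "(\<Sum>i<2*k. (cmod (v i))\<^sup>2) \<noteq> 0"
      using nz by (subst sum_nonneg_eq_0_iff) auto
    ultimately obtain l where l: "l < 2 * n" "y v l \<noteq> 0"
      by (metis (no_types, lifting) lessThan_iff norm_zero sum.neutral zero_power2)
    have "0 < sg l * (cmod (y v l))\<^sup>2" using l sg_bounds[OF l(1)] by simp
    also have "\<dots> \<le> Q" unfolding Q_def
      using l sg_bounds by (intro member_le_sum) (auto simp: less_imp_le)
    finally show ?thesis .
  qed
  moreover have "\<bar>tau k v\<bar> \<le> Q"
  proof -
    have "\<bar>tau k v\<bar> \<le> (\<Sum>l<n. \<bar>2 * Im (cnj (y v l) * y v (n + l))\<bar>)"
      unfolding tau by (rule sum_abs)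
    also have "\<dots> \<le> (\<Sum>l<n. sg l * (cmod (y v l))\<^sup>2 + sg (n + l) * (cmod (y v (n + l)))\<^sup>2)"
    proof (rule sum_mono)
      fix l assume "l \<in> {..<n}"
      then have l: "l < n" by simp
      define a b where "a = cmod (y v l)" and "b = cmod (y v (n + l))"
      have z: "z l > 0" using z_ge_1[OF l] by simp
      have "\<bar>2 * Im (cnj (y v l) * y v (n + l))\<bar> \<le> 2 * (a * b)"
        using abs_Im_le_cmod[of "cnj (y v l) * y v (n + l)"] by (simp add: norm_mult a_def b_def abs_mult del: times_complex.sel)
      also have "\<dots> \<le> z l * a\<^sup>2 + b\<^sup>2 / z l"
      proof -
        have "0 \<le> (z l * a - b)\<^sup>2 / z l" using z by simp
        also have "\<dots> = z l * a\<^sup>2 + b\<^sup>2 / z l - 2 * (a * b)"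
          using z by (simp add: power2_eq_square field_simps)
        finally show ?thesis by simp
      qed
      finally show "\<bar>2 * Im (cnj (y v l) * y v (n + l))\<bar> \<le> sg l * (cmod (y v l))\<^sup>2 + sg (n + l) * (cmod (y v (n + l)))\<^sup>2"
        using l by (simp add: sg_simps a_def b_def)
    qed
    also have "\<dots> = Q" unfolding Q_def sum_block[of _ n] sum.distrib ..
    finally show ?thesis .
  qed
  ultimately show "\<exists>Q>0. \<bar>tau k v\<bar> \<le> Q \<and>
     (\<Sum>i<2*k. \<Sum>j<2*k. cnj (v i) * of_real (red_cov_mat n k z U i j) * v j) = of_real Q"
    using form by blast
qed

section \<open>Tail bounds for the symplectic eigenvalues\<close>

definition spread :: "(nat \<Rightarrow> nat \<Rightarrow> complex) \<Rightarrow> real" where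
  "spread U = (\<Sum>l\<in>#symp_eigs k (red_cov_mat n k z U). (l\<^sup>2 - lam\<^sup>2)\<^sup>2)"

text \<open>The first bound is of order \<open>dev\<close> with a constant free of \<open>R\<close>
  when \<open>dev\<close> \<le> 1; the second is linear for all \<open>dev\<close> at the price of
  \<open>R\<^sup>2\<close>. The third sums the operator bound over the unit vectors.\<close>

lemma spread_le:
  assumes U: "U \<in> unitary_set n"
  shows "spread U \<le> 8 * lam\<^sup>2 * dev U + 4 * (dev U)\<^sup>2" "spread U \<le> 16 * R\<^sup>2 * dev U"
    "dev U \<le> 4 * real k * R\<^sup>2"
proof -
  let ?M = "red_cov_mat n k z U"
  note main = sum_symp_eigs_le[OF symp_eigs_exist[OF uncertainty_red_cov[OF U]], of lam, folded spread_def, unfolded norm_D_eq_dev]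
  show "spread U \<le> 8 * lam\<^sup>2 * dev U + 4 * (dev U)\<^sup>2"
    using main norm_K_square_le[of k lam ?M, unfolded norm_D_eq_dev] by (simp add: power_mult_distrib)
  have "lam\<^sup>2 \<le> R\<^sup>2" using lam_ge_1 lam_le_R by (intro power_mono) auto
  then have "8 * lam\<^sup>2 * dev U \<le> 8 * R\<^sup>2 * dev U" using dev_nonneg by (intro mult_right_mono) auto
  then show "spread U \<le> 16 * R\<^sup>2 * dev U"
    using main norm_K_square_op_le[OF D_op_le[OF U], unfolded norm_D_eq_dev] by simp
  have "2 * dev U = (\<Sum>j<2*k. \<Sum>i<2*k. (D_mat lam ?M i j)\<^sup>2)"
    unfolding norm_D_eq_dev[symmetric] by (rule sum.swap)
  also have "\<dots> \<le> (\<Sum>j<2*k. 4 * R\<^sup>2)"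
  proof (rule sum_mono)
    fix j assume j: "j \<in> {..<2*k}"
    have "(\<Sum>m<2*k. D_mat lam ?M i m * (if m = j then 1 else 0)) = D_mat lam ?M i j" for i
    proof -
      have "(\<Sum>m<2*k. D_mat lam ?M i m * (if m = j then 1 else 0)) = (\<Sum>m<2*k. if m = j then D_mat lam ?M i m else 0)"
        by (intro sum.cong) auto
      then show ?thesis using j by simp
    qed
    moreover have "(\<Sum>m<2*k. (if m = j then 1 else 0 :: real)\<^sup>2) = 1"
    proof -
      have "(\<Sum>m<2*k. (if m = j then 1 else 0 :: real)\<^sup>2) = (\<Sum>m<2*k. if m = j then 1 else 0)"
        by (intro sum.cong) auto
      then show ?thesis using j by simp
    qed
    ultimately show "(\<Sum>i<2*k. (D_mat lam ?M i j)\<^sup>2) \<le> 4 * R\<^sup>2"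
      using D_op_le[OF U, of "\<lambda>m. if m = j then 1 else 0"] by simp
  qed
  finally show "dev U \<le> 4 * real k * R\<^sup>2" by simp
qed

lemma spread_le_max: "U \<in> unitary_set n \<Longrightarrow> spread U \<le> 64 * real k * R ^ 4"
proof -
  assume U: "U \<in> unitary_set n"
  have "spread U \<le> 16 * R\<^sup>2 * dev U" by (rule spread_le(2)[OF U])
  also have "\<dots> \<le> 16 * R\<^sup>2 * (4 * real k * R\<^sup>2)"
    by (intro mult_left_mono spread_le(3)[OF U]) auto
  finally show ?thesis by (simp add: power2_eq_square power4_eq_xxxx mult_ac)
qed

lemma spread_tail:
  assumes haar: "haar_measure n \<mu>" and kR: "16 * real k * R \<le> real n"
    and B: "lam \<le> B" and small: "64 * (real k)\<^sup>2 * R * B \<le> real n"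
    and eps: "(8 * B\<^sup>2 + 4) * (64 * (real k)\<^sup>2 * R * B / real n) \<le> \<epsilon>"
  shows "measure \<mu> {U \<in> unitary_set n. spread U > \<epsilon>}
    \<le> exp (- (real n * \<epsilon> / (1024 * (8 * B\<^sup>2 + 4) * R ^ 4)))"
proof -
  interpret prob_space \<mu> by (rule haar_prob_space[OF haar])
  define c where "c = 8 * B\<^sup>2 + 4"
  have c: "c \<ge> 4" by (simp add: c_def)
  then have cpos: "0 < c" by simp
  have R: "R \<ge> 1" by (rule R_ge_1)
  have B1: "1 \<le> B" using B lam_ge_1 by simp
  have "A \<le> 16 * (real k)\<^sup>2 * R * B / real n"
    unfolding A_def using B R by (intro divide_right_mono mult_left_mono) auto
  then have A: "4 * A \<le> 64 * (real k)\<^sup>2 * R * B / real n" by simp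
  have A1: "4 * A \<le> 1"
  proof -
    have "64 * (real k)\<^sup>2 * R * B / real n \<le> 1" using small n_gt_0 by simp
    with A show ?thesis by linarith
  qed
  have eps_c: "64 * (real k)\<^sup>2 * R * B / real n \<le> \<epsilon> / c"
    by (rule pos_le_divide_eq[OF cpos, THEN iffD2]) (use eps in \<open>simp only: c_def mult.commute\<close>)
  have "0 \<le> 64 * (real k)\<^sup>2 * R * B / real n" using R B1 by simp
  then have "0 \<le> \<epsilon> / c" using eps_c by linarith
  then have eps0: "0 \<le> \<epsilon>" using c by (simp add: zero_le_divide_iff)
  have spread_c: "spread U \<le> c * dev U" if "U \<in> unitary_set n" "dev U \<le> 1" for U
  proof -
    have "lam\<^sup>2 \<le> B\<^sup>2" using lam_ge_1 B by (intro power_mono) auto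
    then have "8 * lam\<^sup>2 * dev U \<le> 8 * B\<^sup>2 * dev U" using dev_nonneg by (intro mult_right_mono) auto
    moreover have "(dev U)\<^sup>2 \<le> 1 * dev U"
      unfolding power2_eq_square using that(2) dev_nonneg by (intro mult_right_mono) auto
    ultimately show ?thesis using spread_le(1)[OF that(1)] by (simp add: c_def algebra_simps)
  qed
  \<comment> \<open>Any \<open>t\<close> allowed here gives the same final exponent; 1024 is 64 from
    \<open>dev_tail\<close> times 16 from the lower bound on \<open>t\<close>. The two regimes of
    \<epsilon> differ only in the choice of \<open>t\<close>.\<close>
  have tail: "measure \<mu> {U \<in> unitary_set n. spread U > \<epsilon>} \<le> exp (- (real n * \<epsilon> / (1024 * c * R ^ 4)))"
    if t: "4 * A \<le> t" and sub: "\<And>U. U \<in> unitary_set n \<Longrightarrow> dev U \<le> t \<Longrightarrow> spread U \<le> \<epsilon>"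
      and exponent: "\<epsilon> / (16 * c * R\<^sup>2) \<le> t" for t
  proof -
    have "{U. t < dev U} \<in> sets \<mu>" using haar_sets[OF haar] by measurable
    then have "measure \<mu> {U \<in> unitary_set n. spread U > \<epsilon>} \<le> measure \<mu> {U. t < dev U}"
      by (intro finite_measure_mono) (use sub in \<open>auto simp: not_le[symmetric]\<close>)
    also have "\<dots> \<le> exp (- (real n * t / (64 * R\<^sup>2)))"
      using R by (intro dev_tail[OF haar kR _ t]) auto
    also have "\<dots> \<le> exp (- (real n * \<epsilon> / (1024 * c * R ^ 4)))"
    proof -
      have "real n * \<epsilon> / (1024 * c * R ^ 4) = real n * (\<epsilon> / (16 * c * R\<^sup>2)) / (64 * R\<^sup>2)"
        by (simp add: power2_eq_square power4_eq_xxxx)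
      also have "\<dots> \<le> real n * t / (64 * R\<^sup>2)"
        using exponent by (intro divide_right_mono mult_left_mono) auto
      finally show ?thesis by simp
    qed
    finally show ?thesis .
  qed
  have R2: "1 \<le> R\<^sup>2" using R by simp
  have den: "\<epsilon> / (16 * c * R\<^sup>2) \<le> \<epsilon> / c" "\<epsilon> / (16 * c * R\<^sup>2) \<le> \<epsilon> / (16 * R\<^sup>2)"
  proof -
    have "c * 1 \<le> c * (16 * R\<^sup>2)" using c R2 by (intro mult_left_mono) auto
    then show "\<epsilon> / (16 * c * R\<^sup>2) \<le> \<epsilon> / c"
      using eps0 c R2 by (intro divide_left_mono mult_pos_pos) auto
    have "1 * (16 * R\<^sup>2) \<le> c * (16 * R\<^sup>2)" using c by (intro mult_right_mono) auto
    then show "\<epsilon> / (16 * c * R\<^sup>2) \<le> \<epsilon> / (16 * R\<^sup>2)"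
      using eps0 c R2 by (intro divide_left_mono mult_pos_pos) auto
  qed
  show ?thesis unfolding c_def[symmetric]
  proof (cases "\<epsilon> \<le> c")
    case True
    show "measure \<mu> {U \<in> unitary_set n. spread U > \<epsilon>} \<le> exp (- (real n * \<epsilon> / (1024 * c * R ^ 4)))"
    proof (rule tail[of "\<epsilon> / c"])
      show "4 * A \<le> \<epsilon> / c" using A eps_c by linarith
      fix U assume U: "U \<in> unitary_set n" and d: "dev U \<le> \<epsilon> / c"
      have "\<epsilon> / c \<le> 1" using True c by simp
      then have "spread U \<le> c * dev U" using d by (intro spread_c U) linarith
      also have "\<dots> \<le> \<epsilon>" using d c by (simp add: pos_le_divide_eq mult.commute)
      finally show "spread U \<le> \<epsilon>" .
    qed (rule den)
  next
    case False
    \<comment> \<open>The maximum with 1 keeps \<open>t\<close> above \<open>4 * A\<close>. If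
      \<open>dev\<close> \<le> 1, the spread is at most c < \<epsilon>; if \<open>dev\<close> is
      larger, the bound with \<open>R\<^sup>2\<close> applies.\<close>
    show "measure \<mu> {U \<in> unitary_set n. spread U > \<epsilon>} \<le> exp (- (real n * \<epsilon> / (1024 * c * R ^ 4)))"
    proof (rule tail[of "max 1 (\<epsilon> / (16 * R\<^sup>2))"])
      show "4 * A \<le> max 1 (\<epsilon> / (16 * R\<^sup>2))" using A1 by simp
      show "\<epsilon> / (16 * c * R\<^sup>2) \<le> max 1 (\<epsilon> / (16 * R\<^sup>2))" using den(2) by simp
      fix U assume U: "U \<in> unitary_set n" and d: "dev U \<le> max 1 (\<epsilon> / (16 * R\<^sup>2))"
      show "spread U \<le> \<epsilon>"
      proof (cases "dev U \<le> 1")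
        case True
        then have "spread U \<le> c * dev U" by (intro spread_c U)
        also have "\<dots> \<le> c" using True c by simp
        finally show ?thesis using False by simp
      next
        case False
        then have "dev U \<le> \<epsilon> / (16 * R\<^sup>2)" using d by simp
        moreover have "0 < 16 * R\<^sup>2" using R by simp
        ultimately have "16 * R\<^sup>2 * dev U \<le> \<epsilon>"
          using pos_le_divide_eq[of "16 * R\<^sup>2" "dev U" \<epsilon>] by (simp only: mult.commute)
        then show ?thesis using spread_le(2)[OF U] by linarith
      qed
    qed
  qed
qed

end

text \<open>The conditions \<open>big\<close> are the two size conditions of
  \<open>spread_tail\<close>, expressed through the power bounds on \<open>k\<close> and on the
  squeezing.\<close>

lemma spread_tail_asymptotic:
  fixes \<zeta> \<kappa> C K B \<epsilon> :: real
  assumes sq: "squeezed n k z (C * real n powr \<zeta>)" and haar: "haar_measure n \<mu>"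
    and C: "C > 0" and K: "K > 0" and B: "avg_energy n z \<le> B"
    and kK: "real k \<le> K * real n powr \<kappa>"
    and big: "16 * K * C * real n powr (\<kappa> + \<zeta> - 1) \<le> 1"
      "64 * K\<^sup>2 * C * B * real n powr (\<zeta> + 2 * \<kappa> - 1) \<le> 1"
    and eps: "(8 * B\<^sup>2 + 4) * (64 * K\<^sup>2 * C * B) * real n powr (\<zeta> + 2 * \<kappa> - 1) \<le> \<epsilon>"
  shows "measure \<mu> {U \<in> unitary_set n.
      (\<Sum>l\<in>#symp_eigs k (red_cov_mat n k z U). (l\<^sup>2 - (avg_energy n z)\<^sup>2)\<^sup>2) > \<epsilon>}
    \<le> exp (- (1 / (65536 * (8 * B\<^sup>2 + 4) * K * C ^ 8)) * \<epsilon>\<^sup>2 * real n powr (1 - 8 * \<zeta> - \<kappa>))"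
proof -
  interpret squeezed n k z "C * real n powr \<zeta>" by (rule sq)
  define R where "R = C * real n powr \<zeta>"
  define c where "c = 8 * B\<^sup>2 + 4"
  have c: "c > 0" by (simp add: c_def add_nonneg_pos)
  have n0: "real n > 0" using n_gt_0 by simp
  have B1: "1 \<le> B" using B lam_ge_1 by simp
  have R1: "1 \<le> R" unfolding R_def by (rule R_ge_1)
  have kR: "real k * R \<le> K * C * real n powr (\<kappa> + \<zeta> - 1) * real n"
  proof -
    have "real k * R \<le> (K * real n powr \<kappa>) * R" using kK R1 by (intro mult_right_mono) auto
    also have "\<dots> = K * C * (real n powr \<kappa> * real n powr \<zeta>)" by (simp add: R_def)
    also have "real n powr \<kappa> * real n powr \<zeta> = real n powr (\<kappa> + \<zeta> - 1) * real n powr 1"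
      by (simp only: powr_add[symmetric]) simp
    finally show ?thesis using n0 by simp
  qed
  have kkR: "(real k)\<^sup>2 * R * B \<le> K\<^sup>2 * C * B * real n powr (\<zeta> + 2 * \<kappa> - 1) * real n"
  proof -
    have "(real k)\<^sup>2 \<le> (K * real n powr \<kappa>)\<^sup>2" using kK by (intro power_mono) auto
    then have "(real k)\<^sup>2 * R * B \<le> (K * real n powr \<kappa>)\<^sup>2 * R * B"
      using R1 B1 by (intro mult_right_mono) auto
    also have "\<dots> = K\<^sup>2 * C * B * (real n powr \<zeta> * (real n powr \<kappa> * real n powr \<kappa>))"
      by (simp add: R_def power2_eq_square mult_ac)
    also have "real n powr \<zeta> * (real n powr \<kappa> * real n powr \<kappa>)
        = real n powr (\<zeta> + 2 * \<kappa> - 1) * real n powr 1"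
      by (simp only: powr_add[symmetric]) simp
    finally show ?thesis using n0 by simp
  qed
  have 1: "16 * real k * R \<le> real n"
  proof -
    have "16 * (real k * R) \<le> 16 * (K * C * real n powr (\<kappa> + \<zeta> - 1) * real n)"
      using kR by simp
    also have "\<dots> = (16 * K * C * real n powr (\<kappa> + \<zeta> - 1)) * real n" by simp
    also have "\<dots> \<le> 1 * real n" using big(1) by (intro mult_right_mono) auto
    finally show ?thesis by simp
  qed
  have 2: "64 * (real k)\<^sup>2 * R * B \<le> (64 * K\<^sup>2 * C * B * real n powr (\<zeta> + 2 * \<kappa> - 1)) * real n"
    using kkR by simp
  also have "\<dots> \<le> 1 * real n" using big(2) by (intro mult_right_mono) auto
  finally have 3: "64 * (real k)\<^sup>2 * R * B \<le> real n" by simp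
  have 4: "c * (64 * (real k)\<^sup>2 * R * B / real n) \<le> \<epsilon>"
  proof -
    have "64 * (real k)\<^sup>2 * R * B / real n \<le> 64 * K\<^sup>2 * C * B * real n powr (\<zeta> + 2 * \<kappa> - 1)"
      using 2 n0 by (simp add: pos_divide_le_eq)
    then have "c * (64 * (real k)\<^sup>2 * R * B / real n) \<le> c * (64 * K\<^sup>2 * C * B * real n powr (\<zeta> + 2 * \<kappa> - 1))"
      using c by (intro mult_left_mono) auto
    also have "\<dots> \<le> \<epsilon>" using eps by (simp add: c_def mult.assoc)
    finally show ?thesis .
  qed
  have set_eq: "{U \<in> unitary_set n.
      (\<Sum>l\<in>#symp_eigs k (red_cov_mat n k z U). (l\<^sup>2 - (avg_energy n z)\<^sup>2)\<^sup>2) > \<epsilon>}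
     = {U \<in> unitary_set n. spread U > \<epsilon>}" by (simp add: spread_def)
  show ?thesis
  proof (cases "\<epsilon> \<le> 64 * real k * R ^ 4")
    case False
    then have "{U \<in> unitary_set n. spread U > \<epsilon>} = {}"
      using spread_le_max[folded R_def] by fastforce
    then have "measure \<mu> {U \<in> unitary_set n. spread U > \<epsilon>} = 0" by (simp only: measure_empty)
    then show ?thesis unfolding set_eq by simp
  next
    case True
    have nz: "0 \<le> \<epsilon>"
    proof -
      have "0 \<le> c * (64 * (real k)\<^sup>2 * R * B / real n)" using c R1 B1 by simp
      with 4 show ?thesis by linarith
    qed
    have "64 * real k * R ^ 4 \<le> 64 * (K * real n powr \<kappa>) * R ^ 4"
      using kK R1 by (intro mult_right_mono mult_left_mono) auto
    with True have "\<epsilon> \<le> 64 * (K * real n powr \<kappa>) * R ^ 4" by (rule order_trans)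
    also have "\<dots> = 64 * K * C ^ 4 * (real n powr \<kappa> * (real n powr \<zeta>) ^ 4)"
      by (simp add: R_def power_mult_distrib)
    also have "(real n powr \<zeta>) ^ 4 = real n powr (4 * \<zeta>)"
      using n0 by (simp add: powr_powr mult.commute flip: powr_realpow)
    finally have eps_le: "\<epsilon> \<le> 64 * K * C ^ 4 * (real n powr \<kappa> * real n powr (4 * \<zeta>))" .
    \<comment> \<open>One factor of \<epsilon>^2 is replaced by its upper bound
      \<open>eps_le\<close>; the constant 65536 is 64 * 1024 and cancels the 64 of that
      bound.\<close>
    have "1 / (65536 * c * K * C ^ 8) * \<epsilon>\<^sup>2 * real n powr (1 - 8 * \<zeta> - \<kappa>)
        = \<epsilon> * (1 / (65536 * c * K * C ^ 8) * \<epsilon> * real n powr (1 - 8 * \<zeta> - \<kappa>))"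
      by (simp add: power2_eq_square)
    also have "\<dots> \<le> \<epsilon> * (1 / (65536 * c * K * C ^ 8) *
        (64 * K * C ^ 4 * (real n powr \<kappa> * real n powr (4 * \<zeta>))) * real n powr (1 - 8 * \<zeta> - \<kappa>))"
      using nz eps_le c K C by (intro mult_left_mono mult_right_mono) auto
    also have "\<dots> = \<epsilon> * (1 / (1024 * c * C ^ 4) *
        (real n powr \<kappa> * real n powr (4 * \<zeta>) * real n powr (1 - 8 * \<zeta> - \<kappa>)))"
      using K C c by (simp add: field_simps power_add[symmetric])
    also have "real n powr \<kappa> * real n powr (4 * \<zeta>) * real n powr (1 - 8 * \<zeta> - \<kappa>) = real n powr (1 - 4 * \<zeta>)"
      by (simp flip: powr_add)
    also have "real n powr (1 - 4 * \<zeta>) = real n / (real n powr \<zeta>) ^ 4"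
      using n0 by (simp add: powr_diff powr_powr mult.commute flip: powr_realpow)
    also have "\<epsilon> * (1 / (1024 * c * C ^ 4) * (real n / (real n powr \<zeta>) ^ 4)) = real n * \<epsilon> / (1024 * c * R ^ 4)"
      by (simp add: R_def power_mult_distrib mult_ac)
    finally have le: "1 / (65536 * c * K * C ^ 8) * \<epsilon>\<^sup>2 * real n powr (1 - 8 * \<zeta> - \<kappa>)
        \<le> real n * \<epsilon> / (1024 * c * R ^ 4)" .
    have "measure \<mu> {U \<in> unitary_set n. spread U > \<epsilon>} \<le> exp (- (real n * \<epsilon> / (1024 * c * R ^ 4)))"
      using spread_tail[OF haar, folded R_def, of B \<epsilon>] 1 3 4 B by (simp add: c_def)
    also have "\<dots> \<le> exp (- (1 / (65536 * c * K * C ^ 8)) * \<epsilon>\<^sup>2 * real n powr (1 - 8 * \<zeta> - \<kappa>))"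
      using le by simp
    finally show ?thesis unfolding set_eq c_def .
  qed
qed

theorem theorem2:
  fixes \<zeta> \<kappa> :: real and z :: "nat \<Rightarrow> nat \<Rightarrow> real" and kk :: "nat \<Rightarrow> nat"
  assumes "\<zeta> \<ge> 0" and "\<kappa> \<ge> 0" and "8 * \<zeta> + \<kappa> < 1" and "\<zeta> + 2 * \<kappa> < 1"
    and z_ge: "\<And>n j. j < n \<Longrightarrow> z n j \<ge> 1"
    and squeezing: "\<exists>C>0. \<forall>\<^sub>F n in sequentially. \<forall>j<n. z n j \<le> C * real n powr \<zeta>"
    and energy: "\<exists>B. \<forall>n. \<bar>avg_energy n (z n)\<bar> \<le> B"
    and k_range: "\<And>n. n \<ge> 1 \<Longrightarrow> 1 \<le> kk n \<and> kk n \<le> n"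
    and k_degree: "\<exists>K>0. \<forall>\<^sub>F n in sequentially. real (kk n) \<le> K * real n powr \<kappa>"
  shows "\<exists>C>0. \<exists>c>0. \<forall>n\<ge>1. \<forall>\<mu>. haar_measure n \<mu> \<longrightarrow>
           (\<forall>\<epsilon>. \<epsilon> > C * real n powr (\<zeta> + 2 * \<kappa> - 1) \<longrightarrow>
              measure \<mu> {U \<in> unitary_set n.
                 (\<Sum>l\<in>#symp_eigs (kk n) (red_cov_mat n (kk n) (z n) U).
                    (l\<^sup>2 - (avg_energy n (z n))\<^sup>2)\<^sup>2) > \<epsilon>}
              \<le> exp (- c * \<epsilon>\<^sup>2 * real n powr (1 - 8 * \<zeta> - \<kappa>)))"
proof -
  obtain C where C: "C > 0" "\<forall>\<^sub>F n in sequentially. \<forall>j<n. z n j \<le> C * real n powr \<zeta>"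
    using squeezing by blast
  obtain K where K: "K > 0" "\<forall>\<^sub>F n in sequentially. real (kk n) \<le> K * real n powr \<kappa>"
    using k_degree by blast
  obtain B0 where B0: "\<And>n. \<bar>avg_energy n (z n)\<bar> \<le> B0" using energy by blast
  define B where "B = max 1 B0"
  have B: "avg_energy n (z n) \<le> B" for n using B0[of n] by (auto simp: B_def)
  have B1: "1 \<le> B" by (simp add: B_def)
  have small: "\<forall>\<^sub>F n in sequentially. a * real n powr s \<le> 1" if "s < 0" for a s :: real
  proof -
    have "(\<lambda>n. a * real n powr s) \<longlonglongrightarrow> a * 0"
      by (intro tendsto_mult tendsto_const tendsto_neg_powr[OF that] filterlim_real_sequentially)
    then have "\<forall>\<^sub>F n in sequentially. a * real n powr s < 1" by (rule order_tendstoD) simp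
    then show ?thesis by eventually_elim simp
  qed
  have "\<forall>\<^sub>F n in sequentially. (\<forall>j<n. z n j \<le> C * real n powr \<zeta>) \<and> real (kk n) \<le> K * real n powr \<kappa> \<and>
     16 * K * C * real n powr (\<kappa> + \<zeta> - 1) \<le> 1 \<and> 64 * K\<^sup>2 * C * B * real n powr (\<zeta> + 2 * \<kappa> - 1) \<le> 1"
    \<comment> \<open>The exponent \<kappa> + \<zeta> - 1 is negative by 8 \<zeta> + \<kappa> < 1
      and \<zeta> \<ge> 0.\<close>
    using assms(1-4) by (intro eventually_conj C(2) K(2) small) auto
  then obtain N where N: "\<And>n. n \<ge> N \<Longrightarrow> (\<forall>j<n. z n j \<le> C * real n powr \<zeta>) \<and> real (kk n) \<le> K * real n powr \<kappa> \<and>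
     16 * K * C * real n powr (\<kappa> + \<zeta> - 1) \<le> 1 \<and> 64 * K\<^sup>2 * C * B * real n powr (\<zeta> + 2 * \<kappa> - 1) \<le> 1"
    unfolding eventually_sequentially by blast
  \<comment> \<open>For a fixed \<open>n\<close> any upper bound on the squeezing will do, and the
    sum is one because all terms are nonnegative.\<close>
  define R where "R n = (\<Sum>j<n. z n j)" for n
  \<comment> \<open>Chosen so that \<open>b n\<close> times the power in the threshold is the
    largest possible spread; once the constant is at least \<open>b n\<close>, the event is empty.

    @DONE placeholder\<close>
  define b where "b n = 64 * real (kk n) * R n ^ 4 * real n powr (1 - \<zeta> - 2 * \<kappa>)" for n
  have b0: "0 \<le> b n" for n by (simp add: b_def)
  define D where "D = (8 * B\<^sup>2 + 4) * (64 * K\<^sup>2 * C * B) + (\<Sum>n<N. b n)"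
  define c where "c = 1 / (65536 * (8 * B\<^sup>2 + 4) * K * C ^ 8)"
  have pos: "0 < (8 * B\<^sup>2 + 4) * (64 * K\<^sup>2 * C * B)"
    using K(1) C(1) B1 by (intro mult_pos_pos add_nonneg_pos) auto
  have sum_b: "0 \<le> (\<Sum>n<N. b n)" using b0 by (intro sum_nonneg) auto
  show ?thesis
  proof (intro exI conjI allI impI)
    show "D > 0" unfolding D_def using pos sum_b by linarith
    show "c > 0" using K(1) C(1) by (simp add: c_def add_nonneg_pos)
    fix n \<mu> \<epsilon> assume n: "1 \<le> n" and haar: "haar_measure n \<mu>"
      and eps: "D * real n powr (\<zeta> + 2 * \<kappa> - 1) < \<epsilon>"
    let ?X = "{U \<in> unitary_set n. (\<Sum>l\<in>#symp_eigs (kk n) (red_cov_mat n (kk n) (z n) U).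
                    (l\<^sup>2 - (avg_energy n (z n))\<^sup>2)\<^sup>2) > \<epsilon>}"
    show "measure \<mu> ?X \<le> exp (- c * \<epsilon>\<^sup>2 * real n powr (1 - 8 * \<zeta> - \<kappa>))"
    proof (cases "n < N")
      case True
      have "squeezed n (kk n) (z n) (R n)"
      proof
        show "z n l \<le> R n" if "l < n" for l
          unfolding R_def using that z_ge[of _ n]
          by (intro member_le_sum) (auto intro: order_trans[OF zero_le_one])
      qed (use k_range[OF n] n z_ge in auto)
      then interpret squeezed n "kk n" "z n" "R n" .
      have "64 * real (kk n) * R n ^ 4 = b n * real n powr (\<zeta> + 2 * \<kappa> - 1)"
      proof -
        have "real n powr (1 - \<zeta> - 2 * \<kappa>) * real n powr (\<zeta> + 2 * \<kappa> - 1) = 1"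
          using n by (simp flip: powr_add)
        then show ?thesis by (simp add: b_def)
      qed
      also have "\<dots> \<le> D * real n powr (\<zeta> + 2 * \<kappa> - 1)"
      proof (rule mult_right_mono)
        have "b n \<le> (\<Sum>n<N. b n)" using True b0 by (intro member_le_sum) auto
        then show "b n \<le> D" unfolding D_def using pos by linarith
      qed simp
      finally have "64 * real (kk n) * R n ^ 4 < \<epsilon>" using eps by simp
      then have "?X = {}"
        using spread_le_max unfolding spread_def by fastforce
      then have "measure \<mu> ?X = 0" by (simp only: measure_empty)
      then show ?thesis by simp
    next
      case False
      then have Nn: "\<forall>j<n. z n j \<le> C * real n powr \<zeta>" "real (kk n) \<le> K * real n powr \<kappa>"
        "16 * K * C * real n powr (\<kappa> + \<zeta> - 1) \<le> 1" "64 * K\<^sup>2 * C * B * real n powr (\<zeta> + 2 * \<kappa> - 1) \<le> 1"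
        using N[of n] by auto
      have sq: "squeezed n (kk n) (z n) (C * real n powr \<zeta>)"
        by unfold_locales (use k_range[OF n] n z_ge Nn(1) in auto)
      have "(8 * B\<^sup>2 + 4) * (64 * K\<^sup>2 * C * B) * real n powr (\<zeta> + 2 * \<kappa> - 1)
          \<le> D * real n powr (\<zeta> + 2 * \<kappa> - 1)"
        using sum_b by (intro mult_right_mono) (auto simp: D_def)
      then have "(8 * B\<^sup>2 + 4) * (64 * K\<^sup>2 * C * B) * real n powr (\<zeta> + 2 * \<kappa> - 1) \<le> \<epsilon>"
        using eps by linarith
      from spread_tail_asymptotic[OF sq haar C(1) K(1) B Nn(2,3,4) this]
      show ?thesis by (simp only: c_def)
    qed
  qed
qed

end
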